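(* Let $(p_n)_{n\ge1}$ be a sequence in $[0,1]$ with $\lim_{n\to\infty}n^{1/2}p_n=0$ and $\lim_{n\to\infty}np_n=\infty$. Consider the fire dynamics with parameter $p_n$ on a uniform Cayley tree $\mathbf{t}_n$ with $n$ vertices, and let $b_{n,1},\dots,b_{n,\kappa_n}$ be the sizes of the burnt subtrees, listed in order of appearance. Let $(\mathbf{e}_i)_{i\ge1}$ be independent exponential random variables with parameter $1$, $\gamma_i=\mathbf{e}_1+\dots+\mathbf{e}_i$ for $i\ge1$, and let $(Z_i)_{i\ge1}$ be i.i.d. standard Gaussian random variables, independent of $(\gamma_i)_{i\ge1}$. Then $$\lim_{n\to\infty}(np_n)^{-2}(b_{n,1},\dots,b_{n,\kappa_n})=(\gamma_i^{-2}Z_i^2)_{i\ge1}$$ in distribution for the $\ell^1$ topology.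
   Context: A uniform Cayley tree $\mathbf{t}_n$ of size $n$ is a tree picked uniformly at random amongst the $n^{n-2}$ trees on the vertex set $[n]=\{1,\dots,n\}$. Fire dynamics with parameter $p\in[0,1]$ on a tree: initially every edge is flammable. Then successively, in a uniformly random order, each edge is either made fireproof with probability $1-p$ or set on fire with probability $p$ (independently). When an edge is set on fire it burns, sets on fire its flammable neighboring edges, and the fire propagates instantly in the tree, only stopped by fireproof edges. An edge burnt through propagation is not subject to the dynamics thereafter. The dynamics continue until all edges are either burnt or fireproof. A vertex is called fireproof if all its adjacent edges are fireproof at the end, and burnt otherwise. Discarding the fireproof edges having at least one burnt extremity yields two forests, one of fireproof trees and one of burnt trees; the burnt subtrees are the connected components of the latter (each is the subtree burnt by one fire), $\kappa_n$ is their number, and size means number of vertices. Finite vectors are identified with elements of $\ell^1(\mathbf{R})$ (real summable sequences) by appending zeros. *)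

theory Defs
  imports "HOL-Probability.Probability"
begin

section \<open>Uniform Cayley trees\<close>

text \<open>Graphs on the vertex set \<open>{1..n}\<close> are given by their edge sets; an edge is a two-element set.\<close>

definition adj :: "nat set set \<Rightarrow> (nat \<times> nat) set" where
  "adj E = {(u, v). {u, v} \<in> E}"

definition is_cycle :: "nat set set \<Rightarrow> nat list \<Rightarrow> bool" where
  "is_cycle E vs \<longleftrightarrow> length vs \<ge> 3 \<and> distinct vs \<and>
     (\<forall>i<length vs. {vs ! i, vs ! (Suc i mod length vs)} \<in> E)"

definition cayley_trees :: "nat \<Rightarrow> nat set set set" where
  "cayley_trees n = {E. E \<subseteq> {e. e \<subseteq> {1..n} \<and> card e = 2}
     \<and> (\<forall>u\<in>{1..n}. \<forall>v\<in>{1..n}. (u, v) \<in> (adj E)\<^sup>*)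
     \<and> (\<nexists>vs. is_cycle E vs)}"

lemma finite_cayley_trees: "finite (cayley_trees n)"
proof (rule finite_subset)
  show "cayley_trees n \<subseteq> Pow (Pow {1..n})" by (auto simp: cayley_trees_def)
qed simp

lemma cayley_trees_nonempty: "cayley_trees n \<noteq> {}"
proof -
  define E :: "nat set set" where "E = (\<lambda>i. {1, i}) ` {2..n}"
  have "E \<subseteq> {e. e \<subseteq> {1..n} \<and> card e = 2}" by (auto simp: E_def)
  moreover have "(u, v) \<in> (adj E)\<^sup>*" if "u \<in> {1..n}" "v \<in> {1..n}" for u v
  proof -
    have "(u, 1) \<in> (adj E)\<^sup>*"
    proof (cases "u = 1")
      case False
      then have "(u, 1) \<in> adj E" using that by (auto simp: adj_def E_def)
      then show ?thesis by simp
    qed simp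
    moreover have "(1, v) \<in> (adj E)\<^sup>*"
    proof (cases "v = 1")
      case False
      then have "(1, v) \<in> adj E" using that by (auto simp: adj_def E_def)
      then show ?thesis by simp
    qed simp
    ultimately show ?thesis by simp
  qed
  moreover have "\<not> is_cycle E vs" for vs
  proof
    assume c: "is_cycle E vs"
    then have l: "length vs \<ge> 3" and d: "distinct vs"
      and e: "\<And>i. i < length vs \<Longrightarrow> {vs ! i, vs ! (Suc i mod length vs)} \<in> E"
      by (auto simp: is_cycle_def)
    have one: "1 \<in> e" if "e \<in> E" for e using that by (auto simp: E_def)
    define k where "k = Suc (Suc (Suc 0)) mod length vs"
    have k: "k < length vs" "k \<noteq> Suc 0" using l by (auto simp: k_def mod_if)
    have m: "Suc 0 mod length vs = Suc 0" "Suc (Suc 0) mod length vs = Suc (Suc 0)"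
      and i: "0 < length vs" "Suc 0 < length vs" "Suc (Suc 0) < length vs"
      using l by auto
    have "1 \<in> {vs ! 0, vs ! Suc 0}" "1 \<in> {vs ! Suc 0, vs ! Suc (Suc 0)}"
      "1 \<in> {vs ! Suc (Suc 0), vs ! k}"
      using i[THEN e, THEN one] unfolding m k_def[symmetric] .
    moreover have "vs ! 0 \<noteq> vs ! Suc 0" "vs ! 0 \<noteq> vs ! Suc (Suc 0)"
      "vs ! Suc 0 \<noteq> vs ! Suc (Suc 0)" "vs ! Suc 0 \<noteq> vs ! k"
      using i k by (auto simp: nth_eq_iff_index_eq[OF d] simp del: length_greater_0_conv)
    ultimately show False unfolding insert_iff empty_iff by metis
  qed
  ultimately have "E \<in> cayley_trees n" by (auto simp: cayley_trees_def)
  then show ?thesis by blast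
qed


section \<open>Fire dynamics\<close>

text \<open>
  The edges in neither \<open>fireproof\<close> nor \<open>burnt\<close> are the flammable ones. The list \<open>ignited\<close>
  records, in chronological order, the edges that were set on fire by the dynamics
  (as opposed to burnt through propagation).
\<close>

record fire_state =
  fireproof :: "nat set set"
  burnt :: "nat set set"
  ignited :: "nat set list"

definition initial_state :: fire_state where
  "initial_state = \<lparr>fireproof = {}, burnt = {}, ignited = []\<rparr>"

definition flammable :: "nat set set \<Rightarrow> fire_state \<Rightarrow> nat set set" where
  "flammable E s = E - fireproof s - burnt s"

definition neighbouring :: "nat set set \<Rightarrow> (nat set \<times> nat set) set" where
  "neighbouring A = {(e, f). e \<in> A \<and> f \<in> A \<and> e \<inter> f \<noteq> {}}"

definition make_fireproof :: "nat set \<Rightarrow> fire_state \<Rightarrow> fire_state" where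
  "make_fireproof e s = s\<lparr>fireproof := insert e (fireproof s)\<rparr>"

definition set_on_fire :: "nat set set \<Rightarrow> nat set \<Rightarrow> fire_state \<Rightarrow> fire_state" where
  "set_on_fire E e s =
     s\<lparr>burnt := burnt s \<union> (neighbouring (flammable E s))\<^sup>* `` {e}, ignited := ignited s @ [e]\<rparr>"

text \<open>The edges are examined in the order of the given list; those already burnt are skipped.\<close>

fun fire_dynamics :: "real \<Rightarrow> nat set set \<Rightarrow> nat set list \<Rightarrow> fire_state \<Rightarrow> fire_state pmf" where
  "fire_dynamics p E [] s = return_pmf s"
| "fire_dynamics p E (e # es) s =
     (if e \<in> burnt s then fire_dynamics p E es s
      else bind_pmf (bernoulli_pmf p) (\<lambda>fire.
        fire_dynamics p E es (if fire then set_on_fire E e s else make_fireproof e s)))"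

definition fireproof_vertex :: "nat set set \<Rightarrow> fire_state \<Rightarrow> nat \<Rightarrow> bool" where
  "fireproof_vertex E s v \<longleftrightarrow> (\<forall>e\<in>E. v \<in> e \<longrightarrow> e \<in> fireproof s)"

text \<open>The edge set left after discarding the fireproof edges with at least one burnt extremity.\<close>

definition remaining_edges :: "nat set set \<Rightarrow> fire_state \<Rightarrow> nat set set" where
  "remaining_edges E s = E - {e \<in> fireproof s. \<exists>v\<in>e. \<not> fireproof_vertex E s v}"

definition burnt_components :: "nat \<Rightarrow> nat set set \<Rightarrow> fire_state \<Rightarrow> nat set set" where
  "burnt_components n E s =
     (\<lambda>v. (adj (remaining_edges E s))\<^sup>* `` {v}) ` {v\<in>{1..n}. \<not> fireproof_vertex E s v}"

text \<open>
  The same components, listed in order of appearance: the \<open>i\<close>-th one is the component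
  containing the \<open>i\<close>-th edge set on fire. That this enumerates \<open>burnt_components\<close> without
  repetition is lemma \<open>burnt_subtrees_enumerate\<close> below.
\<close>

definition burnt_subtrees :: "nat set set \<Rightarrow> fire_state \<Rightarrow> nat set list" where
  "burnt_subtrees E s = map (\<lambda>e. (adj (remaining_edges E s))\<^sup>* `` e) (ignited s)"

text \<open>Law of \<open>(b\<^bsub>n,1\<^esub>, \<dots>, b\<^bsub>n,\<kappa>\<^sub>n\<^esub>)\<close>.\<close>

definition burnt_subtree_sizes :: "nat \<Rightarrow> real \<Rightarrow> nat list pmf" where
  "burnt_subtree_sizes n p =
     bind_pmf (pmf_of_set (cayley_trees n)) (\<lambda>E.
     bind_pmf (pmf_of_set (permutations_of_set E)) (\<lambda>es.
     map_pmf (\<lambda>s. map card (burnt_subtrees E s)) (fire_dynamics p E es initial_state)))"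


text \<open>
  The remaining lemmas of this section justify the enumeration: fires started at different times
  burn different components, and every component with a burnt vertex was burnt by some fire.
\<close>

definition fire_invariant :: "nat set set \<Rightarrow> fire_state \<Rightarrow> bool" where
  "fire_invariant E s \<longleftrightarrow>
     burnt s \<subseteq> E \<and> fireproof s \<inter> burnt s = {} \<and> set (ignited s) \<subseteq> burnt s \<and> distinct (ignited s)
     \<and> (\<forall>b\<in>burnt s. \<exists>i\<in>set (ignited s). (i, b) \<in> (neighbouring (burnt s))\<^sup>*)
     \<and> (\<forall>i\<in>set (ignited s). \<forall>j\<in>set (ignited s). (i, j) \<in> (neighbouring (burnt s))\<^sup>* \<longrightarrow> i = j)
     \<and> (\<forall>b\<in>burnt s. \<forall>f\<in>flammable E s. b \<inter> f = {})"

lemma fire_invariant_initial: "fire_invariant E initial_state"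
  by (simp add: fire_invariant_def initial_state_def)

lemma fire_invariant_make_fireproof:
  assumes "fire_invariant E s" "e \<in> flammable E s"
  shows "fire_invariant E (make_fireproof e s)"
  using assms by (auto simp: fire_invariant_def make_fireproof_def flammable_def)

lemma fire_invariant_set_on_fire:
  assumes inv: "fire_invariant E s" and e: "e \<in> flammable E s"
  shows "fire_invariant E (set_on_fire E e s)"
proof -
  define B where "B = burnt s"
  define L where "L = flammable E s"
  define C where "C = (neighbouring L)\<^sup>* `` {e}"
  define I where "I = ignited s"
  have eC: "e \<in> C" by (simp add: C_def)
  have CL: "C \<subseteq> L"
  proof
    fix c assume "c \<in> C"
    then have "(e, c) \<in> (neighbouring L)\<^sup>*" by (simp add: C_def)
    then show "c \<in> L"
      by (induction rule: rtrancl_induct) (use e in \<open>auto simp: L_def neighbouring_def\<close>)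
  qed
  have L: "L \<subseteq> E" "L \<inter> fireproof s = {}" "L \<inter> B = {}" by (auto simp: L_def B_def flammable_def)
  have sep: "b \<inter> f = {}" if "b \<in> B" "f \<in> L" for b f
    using inv that by (auto simp: fire_invariant_def B_def L_def)
  have step: "z \<in> C" if "y \<in> C" "(y, z) \<in> neighbouring L" for y z
    using that by (auto simp: C_def intro: rtrancl_into_rtrancl)
  have fromB: "x \<in> B \<and> (i, x) \<in> (neighbouring B)\<^sup>*"
    if "(i, x) \<in> (neighbouring (B \<union> C))\<^sup>*" "i \<in> B" for i x
    using that
  proof (induction rule: rtrancl_induct)
    case (step y z)
    then have "z \<in> B" using sep[of y z] CL by (auto simp: neighbouring_def)
    with step have "(y, z) \<in> neighbouring B" by (auto simp: neighbouring_def)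
    with step \<open>z \<in> B\<close> show ?case by (auto intro: rtrancl_into_rtrancl)
  qed simp
  have fromC: "x \<in> C" if "(i, x) \<in> (neighbouring (B \<union> C))\<^sup>*" "i \<in> C" for i x
    using that
  proof (induction rule: rtrancl_induct)
    case (step y z)
    then have "y \<in> C" "z \<in> B \<union> C" "y \<inter> z \<noteq> {}" by (auto simp: neighbouring_def)
    then show ?case using sep[of z y] CL by blast
  qed
  have reachC: "(e, c) \<in> (neighbouring (B \<union> C))\<^sup>*" if "c \<in> C" for c
  proof -
    from that have "(e, c) \<in> (neighbouring L)\<^sup>*" by (simp add: C_def)
    then have "c \<in> C \<and> (e, c) \<in> (neighbouring (B \<union> C))\<^sup>*"
    proof (induction rule: rtrancl_induct)
      case (step y z)
      then have "z \<in> C" using \<open>\<And>y z. y \<in> C \<Longrightarrow> (y, z) \<in> neighbouring L \<Longrightarrow> z \<in> C\<close> by blast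
      with step have "(y, z) \<in> neighbouring (B \<union> C)" by (auto simp: neighbouring_def)
      with step \<open>z \<in> C\<close> show ?case by (auto intro: rtrancl_into_rtrancl)
    qed (simp add: eC)
    then show ?thesis by simp
  qed
  have mono: "(neighbouring B)\<^sup>* \<subseteq> (neighbouring (B \<union> C))\<^sup>*"
    by (rule rtrancl_mono) (auto simp: neighbouring_def)
  have IB: "set I \<subseteq> B" "distinct I"
    and reachB: "\<And>b. b \<in> B \<Longrightarrow> \<exists>i\<in>set I. (i, b) \<in> (neighbouring B)\<^sup>*"
    and uniq: "\<And>i j. i \<in> set I \<Longrightarrow> j \<in> set I \<Longrightarrow> (i, j) \<in> (neighbouring B)\<^sup>* \<Longrightarrow> i = j"
    and B: "B \<subseteq> E" "fireproof s \<inter> B = {}"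
    using inv by (auto simp: fire_invariant_def B_def I_def)
  have BC: "B \<inter> C = {}" using L CL by auto
  have s': "burnt (set_on_fire E e s) = B \<union> C" "ignited (set_on_fire E e s) = I @ [e]"
    "fireproof (set_on_fire E e s) = fireproof s"
    by (simp_all add: set_on_fire_def B_def C_def L_def I_def)
  have fl: "flammable E (set_on_fire E e s) = L - C"
    by (auto simp: flammable_def s' L_def B_def)
  show ?thesis
    unfolding fire_invariant_def s' fl
  proof (intro conjI ballI impI)
    show "B \<union> C \<subseteq> E" using B L CL by auto
    show "fireproof s \<inter> (B \<union> C) = {}" using B L CL by auto
    show "set (I @ [e]) \<subseteq> B \<union> C" using IB eC by auto
    show "distinct (I @ [e])" using IB eC BC by auto
  next
    fix b assume "b \<in> B \<union> C"
    then show "\<exists>i\<in>set (I @ [e]). (i, b) \<in> (neighbouring (B \<union> C))\<^sup>*"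
      using reachB[of b] reachC[of b] mono by auto
  next
    fix i j assume ij: "i \<in> set (I @ [e])" "j \<in> set (I @ [e])"
      "(i, j) \<in> (neighbouring (B \<union> C))\<^sup>*"
    then consider "i \<in> set I" | "i = e" by auto
    then show "i = j"
    proof cases
      case 1
      then have "j \<in> B" "(i, j) \<in> (neighbouring B)\<^sup>*" using fromB[OF ij(3)] IB by auto
      with ij 1 show ?thesis using BC eC uniq by auto
    next
      case 2
      then have "j \<in> C" using fromC[OF ij(3)] eC by auto
      with ij 2 IB BC show ?thesis by auto
    qed
  next
    fix b f assume bf: "b \<in> B \<union> C" "f \<in> L - C"
    then show "b \<inter> f = {}"
      using sep[of b f] step[of b f] CL by (auto simp: neighbouring_def)
  qed
qed

lemma fire_dynamics_final:
  assumes "s' \<in> set_pmf (fire_dynamics p E es s)" "fire_invariant E s" "distinct es"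
    "set es \<subseteq> E" "flammable E s \<subseteq> set es" "set es \<inter> fireproof s = {}"
  shows "fire_invariant E s' \<and> flammable E s' = {}"
  using assms
proof (induction p E es s rule: fire_dynamics.induct)
  case (2 p E e es s)
  show ?case
  proof (cases "e \<in> burnt s")
    case True
    then have "flammable E s \<subseteq> set es" using "2.prems"(5) by (auto simp: flammable_def)
    then show ?thesis using "2.IH"(1)[OF True] "2.prems" True by simp
  next
    case False
    with "2.prems" have e: "e \<in> flammable E s" by (auto simp: flammable_def)
    from "2.prems"(1) False obtain c where c: "c \<in> set_pmf (bernoulli_pmf p)"
      "s' \<in> set_pmf (fire_dynamics p E es (if c then set_on_fire E e s else make_fireproof e s))"
      by (auto simp del: set_pmf_bernoulli)
    let ?s = "if c then set_on_fire E e s else make_fireproof e s"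
    have "fire_invariant E ?s"
      using fire_invariant_set_on_fire fire_invariant_make_fireproof "2.prems"(2) e by simp
    moreover have "flammable E ?s \<subseteq> set es"
      using "2.prems"(5) by (auto simp: flammable_def set_on_fire_def make_fireproof_def)
    moreover have "set es \<inter> fireproof ?s = {}"
      using "2.prems"(3,6) by (auto simp: set_on_fire_def make_fireproof_def)
    ultimately show ?thesis using "2.IH"(2)[OF False c(1) c(2)] "2.prems"(3,4) by simp
  qed
qed auto

lemma burnt_subtrees_enumerate:
  assumes E: "E \<subseteq> {e. e \<subseteq> {1..n} \<and> card e = 2}"
    and es: "es \<in> permutations_of_set E"
    and s: "s \<in> set_pmf (fire_dynamics p E es initial_state)"
  shows "set (burnt_subtrees E s) = burnt_components n E s" "distinct (burnt_subtrees E s)"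
proof -
  define B where "B = burnt s"
  define R where "R = remaining_edges E s"
  define I where "I = ignited s"
  have "fire_invariant E s \<and> flammable E s = {}"
    by (rule fire_dynamics_final[OF s fire_invariant_initial])
      (use es in \<open>auto simp: permutations_of_set_def flammable_def initial_state_def\<close>)
  then have inv: "fire_invariant E s" and fl: "flammable E s = {}" by auto
  have B: "B \<subseteq> E" "fireproof s \<inter> B = {}" and IB: "set I \<subseteq> B" "distinct I"
    and reach: "\<And>b. b \<in> B \<Longrightarrow> \<exists>i\<in>set I. (i, b) \<in> (neighbouring B)\<^sup>*"
    and uniq: "\<And>i j. i \<in> set I \<Longrightarrow> j \<in> set I \<Longrightarrow> (i, j) \<in> (neighbouring B)\<^sup>* \<Longrightarrow> i = j"
    using inv by (auto simp: fire_invariant_def B_def I_def)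
  have EB: "E - fireproof s = B" using fl B by (auto simp: flammable_def B_def)
  have burnt_vertex: "\<not> fireproof_vertex E s v \<longleftrightarrow> (\<exists>b\<in>B. v \<in> b)" for v
    using EB by (auto simp: fireproof_vertex_def)
  have BR: "B \<subseteq> R" using B by (auto simp: R_def remaining_edges_def)
  have RB: "f \<in> B" if "f \<in> R" "v \<in> f" "b \<in> B" "v \<in> b" for f v b
    using that EB burnt_vertex[of v] by (auto simp: R_def remaining_edges_def)
  have pair: "{u, v} = b" if "b \<in> B" "u \<in> b" "v \<in> b" "u \<noteq> v" for b u v
  proof -
    have "card b = 2" using that B E by auto
    then show ?thesis using that by (auto simp: card_2_iff)
  qed
  have link: "(u, v) \<in> (adj R)\<^sup>*" if "b \<in> B" "u \<in> b" "v \<in> b" for b u v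
  proof (cases "u = v")
    case False
    then have "(u, v) \<in> adj R" using pair[OF that] BR that by (auto simp: adj_def)
    then show ?thesis by simp
  qed simp
  have "sym (adj R)" by (auto simp: sym_def adj_def insert_commute)
  then have symR: "(v, u) \<in> (adj R)\<^sup>*" if "(u, v) \<in> (adj R)\<^sup>*" for u v
    using that sym_rtrancl symD by metis
  have sup: "v \<in> (adj R)\<^sup>* `` i" if "(i, b) \<in> (neighbouring B)\<^sup>*" "v \<in> b" for i b v
    using that
  proof (induction arbitrary: v rule: rtrancl_induct)
    case (step y z)
    then obtain w where w: "w \<in> y" "w \<in> z" "z \<in> B" by (auto simp: neighbouring_def)
    from step.IH[OF w(1)] obtain u where "u \<in> i" "(u, w) \<in> (adj R)\<^sup>*" by auto
    moreover have "(w, v) \<in> (adj R)\<^sup>*" using link w step.prems by blast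
    ultimately show ?case by (auto intro: rtrancl_trans)
  qed auto
  have sub: "\<exists>b\<in>B. (i, b) \<in> (neighbouring B)\<^sup>* \<and> v \<in> b"
    if "(u, v) \<in> (adj R)\<^sup>*" "u \<in> i" "i \<in> B" for i u v
    using that
  proof (induction rule: rtrancl_induct)
    case (step v w)
    then obtain b where b: "b \<in> B" "(i, b) \<in> (neighbouring B)\<^sup>*" "v \<in> b" by auto
    have "{v, w} \<in> B" using RB[of "{v, w}" v b] b step by (auto simp: adj_def)
    moreover from this have "(b, {v, w}) \<in> neighbouring B" using b by (auto simp: neighbouring_def)
    ultimately show ?case using b by (intro bexI[of _ "{v, w}"]) (auto intro: rtrancl_into_rtrancl)
  qed auto
  have comp: "(adj R)\<^sup>* `` {v} = (adj R)\<^sup>* `` i" if "i \<in> B" "v \<in> (adj R)\<^sup>* `` i" for i v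
  proof -
    from that obtain u where u: "u \<in> i" "(u, v) \<in> (adj R)\<^sup>*" by auto
    show ?thesis
    proof
      show "(adj R)\<^sup>* `` {v} \<subseteq> (adj R)\<^sup>* `` i" using u by (auto intro: rtrancl_trans)
      show "(adj R)\<^sup>* `` i \<subseteq> (adj R)\<^sup>* `` {v}"
      proof
        fix x assume "x \<in> (adj R)\<^sup>* `` i"
        then obtain w where w: "w \<in> i" "(w, x) \<in> (adj R)\<^sup>*" by auto
        have "(v, u) \<in> (adj R)\<^sup>*" "(u, w) \<in> (adj R)\<^sup>*" using symR u link that w by blast+
        then show "x \<in> (adj R)\<^sup>* `` {v}" using w by (auto intro: rtrancl_trans)
      qed
    qed
  qed
  have nonempty: "\<exists>v. v \<in> b" if "b \<in> B" for b
  proof -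
    have "card b = 2" using that B E by auto
    then show ?thesis by (auto simp: card_2_iff)
  qed
  have trees: "burnt_subtrees E s = map (\<lambda>e. (adj R)\<^sup>* `` e) I"
    by (simp add: burnt_subtrees_def R_def I_def)
  have comps: "burnt_components n E s =
      (\<lambda>v. (adj R)\<^sup>* `` {v}) ` {v\<in>{1..n}. \<exists>b\<in>B. v \<in> b}"
    unfolding burnt_components_def burnt_vertex R_def ..
  show "set (burnt_subtrees E s) = burnt_components n E s"
  proof
    show "set (burnt_subtrees E s) \<subseteq> burnt_components n E s"
    proof
      fix x assume "x \<in> set (burnt_subtrees E s)"
      then obtain i where i: "i \<in> set I" "x = (adj R)\<^sup>* `` i" by (auto simp: trees)
      then have "i \<in> B" using IB by auto
      then obtain v where v: "v \<in> i" using nonempty by auto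
      then have "v \<in> (adj R)\<^sup>* `` i" by auto
      from comp[OF \<open>i \<in> B\<close> this] have "x = (adj R)\<^sup>* `` {v}" using i by simp
      moreover have "v \<in> {1..n}" using v \<open>i \<in> B\<close> B(1) E by blast
      ultimately show "x \<in> burnt_components n E s" using v \<open>i \<in> B\<close> by (auto simp: comps)
    qed
    show "burnt_components n E s \<subseteq> set (burnt_subtrees E s)"
    proof
      fix x assume "x \<in> burnt_components n E s"
      then obtain v b where v: "x = (adj R)\<^sup>* `` {v}" "b \<in> B" "v \<in> b" by (auto simp: comps)
      from reach[OF v(2)] obtain i where i: "i \<in> set I" "(i, b) \<in> (neighbouring B)\<^sup>*" by auto
      have "x = (adj R)\<^sup>* `` i" using comp[OF _ sup[OF i(2) v(3)]] i IB v by auto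
      then show "x \<in> set (burnt_subtrees E s)" using i by (auto simp: trees)
    qed
  qed
  have "inj_on (\<lambda>e. (adj R)\<^sup>* `` e) (set I)"
  proof (rule inj_onI)
    fix i j assume ij: "i \<in> set I" "j \<in> set I" "(adj R)\<^sup>* `` i = (adj R)\<^sup>* `` j"
    then have "i \<in> B" "j \<in> B" using IB by auto
    from nonempty[OF \<open>j \<in> B\<close>] obtain v where v: "v \<in> j" by auto
    then have "v \<in> (adj R)\<^sup>* `` i" using ij by auto
    then obtain u where "u \<in> i" "(u, v) \<in> (adj R)\<^sup>*" by auto
    from sub[OF this(2) this(1) \<open>i \<in> B\<close>] obtain b where
      b: "b \<in> B" "(i, b) \<in> (neighbouring B)\<^sup>*" "v \<in> b" by auto
    then have "(b, j) \<in> neighbouring B" using v \<open>j \<in> B\<close> by (auto simp: neighbouring_def)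
    with b have "(i, j) \<in> (neighbouring B)\<^sup>*" by auto
    with uniq ij show "i = j" by auto
  qed
  then show "distinct (burnt_subtrees E s)" using IB by (simp add: trees distinct_map)
qed


section \<open>The space of absolutely summable real sequences\<close>

typedef ell1 = "{x :: nat \<Rightarrow> real. summable (\<lambda>i. \<bar>x i\<bar>)}"
  morphisms ell1_nth Abs_ell1
  by (rule exI[of _ "\<lambda>_. 0"]) simp

setup_lifting type_definition_ell1

instantiation ell1 :: real_vector
begin

lift_definition zero_ell1 :: ell1 is "\<lambda>_. 0" by simp

lift_definition plus_ell1 :: "ell1 \<Rightarrow> ell1 \<Rightarrow> ell1" is "\<lambda>x y i. x i + y i"
proof -
  fix x y :: "nat \<Rightarrow> real"
  assume "summable (\<lambda>i. \<bar>x i\<bar>)" "summable (\<lambda>i. \<bar>y i\<bar>)"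
  from summable_add[OF this] show "summable (\<lambda>i. \<bar>x i + y i\<bar>)"
    by (rule summable_comparison_test') (simp add: abs_triangle_ineq)
qed

lift_definition uminus_ell1 :: "ell1 \<Rightarrow> ell1" is "\<lambda>x i. - x i" by simp

lift_definition minus_ell1 :: "ell1 \<Rightarrow> ell1 \<Rightarrow> ell1" is "\<lambda>x y i. x i - y i"
proof -
  fix x y :: "nat \<Rightarrow> real"
  assume "summable (\<lambda>i. \<bar>x i\<bar>)" "summable (\<lambda>i. \<bar>y i\<bar>)"
  from summable_add[OF this] show "summable (\<lambda>i. \<bar>x i - y i\<bar>)"
    by (rule summable_comparison_test') (simp add: abs_triangle_ineq4)
qed

lift_definition scaleR_ell1 :: "real \<Rightarrow> ell1 \<Rightarrow> ell1" is "\<lambda>c x i. c * x i"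
  by (auto simp: abs_mult intro: summable_mult)

instance
  by standard (transfer; simp add: algebra_simps)+

end

instantiation ell1 :: real_normed_vector
begin

lift_definition norm_ell1 :: "ell1 \<Rightarrow> real" is "\<lambda>x. \<Sum>i. \<bar>x i\<bar>" .

definition dist_ell1 :: "ell1 \<Rightarrow> ell1 \<Rightarrow> real" where "dist_ell1 x y = norm (x - y)"

definition sgn_ell1 :: "ell1 \<Rightarrow> ell1" where "sgn_ell1 x = x /\<^sub>R norm x"

definition uniformity_ell1 :: "(ell1 \<times> ell1) filter" where
  "uniformity_ell1 = (INF e\<in>{0<..}. principal {(x, y). dist x y < e})"

definition open_ell1 :: "ell1 set \<Rightarrow> bool" where
  "open_ell1 S = (\<forall>x\<in>S. \<forall>\<^sub>F (x', y) in uniformity. x' = x \<longrightarrow> y \<in> S)"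

instance
proof
  fix x y :: ell1 and c :: real
  show "norm x = 0 \<longleftrightarrow> x = 0"
    by transfer (auto simp: suminf_eq_zero_iff fun_eq_iff)
  show "norm (x + y) \<le> norm x + norm y"
  proof transfer
    fix x y :: "nat \<Rightarrow> real"
    assume s: "summable (\<lambda>i. \<bar>x i\<bar>)" "summable (\<lambda>i. \<bar>y i\<bar>)"
    from summable_add[OF s] have "summable (\<lambda>i. \<bar>x i + y i\<bar>)"
      by (rule summable_comparison_test') (simp add: abs_triangle_ineq)
    then show "(\<Sum>i. \<bar>x i + y i\<bar>) \<le> (\<Sum>i. \<bar>x i\<bar>) + (\<Sum>i. \<bar>y i\<bar>)"
      unfolding suminf_add[OF s] by (intro suminf_le summable_add s) auto
  qed
  show "norm (c *\<^sub>R x) = \<bar>c\<bar> * norm x"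
    by transfer (simp add: abs_mult suminf_mult)
qed (auto simp: dist_ell1_def sgn_ell1_def uniformity_ell1_def open_ell1_def)

end

text \<open>The value outside \<open>\<ell>\<^sup>1\<close> is a dummy.\<close>

definition to_ell1 :: "(nat \<Rightarrow> real) \<Rightarrow> ell1" where
  "to_ell1 x = (if summable (\<lambda>i. \<bar>x i\<bar>) then Abs_ell1 x else 0)"

definition ell1_of_list :: "real list \<Rightarrow> ell1" where
  "ell1_of_list xs = to_ell1 (\<lambda>i. if i < length xs then xs ! i else 0)"

lemma ell1_nth_of_list: "ell1_nth (ell1_of_list xs) i = (if i < length xs then xs ! i else 0)"
proof -
  have "summable (\<lambda>i. \<bar>if i < length xs then xs ! i else 0\<bar>)"
    by (rule summable_finite[of "{..<length xs}"]) auto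
  then show ?thesis by (simp add: ell1_of_list_def to_ell1_def Abs_ell1_inverse)
qed


section \<open>Convergence in distribution\<close>

text \<open>Weak convergence of Borel probability measures on an arbitrary topological space.\<close>

definition weak_convergence :: "(nat \<Rightarrow> 'a::topological_space measure) \<Rightarrow> 'a measure \<Rightarrow> bool" where
  "weak_convergence \<mu> \<nu> \<longleftrightarrow>
     (\<forall>f :: 'a \<Rightarrow> real. continuous_on UNIV f \<and> bounded (range f) \<longrightarrow>
        (\<lambda>n. \<integral>x. f x \<partial>\<mu> n) \<longlonglongrightarrow> (\<integral>x. f x \<partial>\<nu>))"

end

theory Submission
  imports Defs "HOL-Real_Asymp.Real_Asymp"
begin

text \<open>
  Give a forest with \<open>k\<close> trees on \<open>N\<close> vertices a weight equal to the product of its tree sizes, that is,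
  the number of ways to root its trees. The dynamics preserves these weighted laws: deleting a uniform
  edge leads from \<open>k\<close> to \<open>k + 1\<close> trees, and burning the tree of size \<open>s\<close> around a uniform edge leads to
  \<open>N - s\<close> vertices and \<open>k - 1\<close> trees. Hence the pair \<open>(N, k)\<close> is a Markov chain, with an explicit law of the
  burnt size \<open>s\<close>. By Stirling's formula, this law, rescaled by \<open>(k / N)\<^sup>2\<close>, converges to the law of the square of
  a standard Gaussian variable when \<open>N / k\<^sup>2\<close> and \<open>k / N\<close> tend to 0; its mean is at most \<open>2 (N / k)\<^sup>2\<close>.

  The fires occur at geometric times, so that \<open>k\<close> is about \<open>\<gamma>\<^sub>i / p\<^sub>n\<close> at the \<open>i\<close>-th one, while \<open>N\<close> stays
  close to \<open>n\<close>. Sampling the geometric times from the \<open>\<^bold>e\<^sub>i\<close> and the burnt sizes by the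
  quantile functions from the \<open>Z\<^sub>i\<close> realizes all chains on the given probability space, where the
  convergence holds almost surely. In \<open>\<ell>\<^sup>1\<close> it follows by dominated convergence, since Markov's inequality
  bounds the quantile at level \<open>u\<close> by \<open>2 (N / k)\<^sup>2 / (1 - u)\<close>.
\<close>

section \<open>Weighted forests\<close>

text \<open>The weight is forced by the deletions: a forest with \<open>k\<close> trees on
  \<open>N\<close> vertices lies in \<open>N^(k-2)\<close> times the product of its tree sizes many
  trees, so the forest left after deleting \<open>k - 1\<close> uniform edges of a uniform tree is
  not uniform but weighted by this product. Fires respect the weight because it factors over the
  burnt tree and the rest.

  The hypotheses on \<open>p\<close> bound the regime from both sides. With \<open>k\<close> of
  order \<open>1 / p\<close>, burnt sizes are of order \<open>(N / k)^2\<close>, that is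
  \<open>(n p)^2\<close>. This diverges since \<open>n p\<close> does, and it is negligible against
  \<open>n\<close> since \<open>sqrt n * p\<close> vanishes, so finitely many fires leave
  \<open>N\<close> close to \<open>n\<close>.

  The obstacle is the \<open>ell1\<close> topology. Coordinatewise limits say nothing about late
  fires, so one bound has to cover all coordinates at once for each large \<open>n\<close>. The
  bound by Markov's inequality carries a factor \<open>1 / (1 - U)\<close> with \<open>U\<close>
  uniform, whose mean is infinite.\<close>

definition component :: "nat set set \<Rightarrow> nat \<Rightarrow> nat set" where
  "component F v = (adj F)\<^sup>* `` {v}"

definition trees :: "nat set \<Rightarrow> nat set set \<Rightarrow> nat set set" where
  "trees V F = component F ` V"

definition edges_on :: "nat set \<Rightarrow> nat set set" where
  "edges_on V = {e. e \<subseteq> V \<and> card e = 2}"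

text \<open>Every edge is a bridge. This form of acyclicity suits arguments that add or delete a
  single edge; \<open>forest_iff_acyclic\<close> relates it to \<open>is_cycle\<close>.\<close>

definition forest :: "nat set set \<Rightarrow> bool" where
  "forest F \<longleftrightarrow> (\<forall>u v. {u, v} \<in> F \<longrightarrow> v \<notin> component (F - {{u, v}}) u)"

definition forests :: "nat set \<Rightarrow> nat \<Rightarrow> nat set set set" where
  "forests V k = {F. F \<subseteq> edges_on V \<and> forest F \<and> card (trees V F) = k}"

definition forest_weight :: "nat set \<Rightarrow> nat set set \<Rightarrow> real" where
  "forest_weight V F = (\<Prod>C\<in>trees V F. real (card C))"

text \<open>The edges whose addition merges two trees; read backwards, the edges that a deletion
  leading to \<open>F\<close> may have removed.\<close>

definition joining :: "nat set \<Rightarrow> nat set set \<Rightarrow> nat set set" where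
  "joining V F = {{u, v} | u v. u \<in> V \<and> v \<in> V \<and> v \<notin> component F u}"

section \<open>Components and the addition of an edge\<close>

lemma component_refl [simp]: "v \<in> component F v"
  by (simp add: component_def)

lemma component_sym: "v \<in> component F u \<longleftrightarrow> u \<in> component F v"
proof -
  have "sym ((adj F)\<^sup>*)"
    by (rule sym_rtrancl) (auto simp: sym_def adj_def insert_commute)
  then show ?thesis by (auto simp: component_def dest: symD)
qed

lemma component_eq: "v \<in> component F u \<Longrightarrow> component F v = component F u"
  using component_sym[of v F u] by (auto simp: component_def intro: rtrancl_trans)

lemma component_eq_iff: "component F v = component F u \<longleftrightarrow> v \<in> component F u"
  using component_eq component_refl by blast

lemma component_disjoint: "v \<notin> component F u \<Longrightarrow> component F u \<inter> component F v = {}"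
  using component_eq component_eq_iff by blast

lemma component_mono: "F \<subseteq> G \<Longrightarrow> component F v \<subseteq> component G v"
proof -
  assume "F \<subseteq> G"
  then have "(adj F)\<^sup>* \<subseteq> (adj G)\<^sup>*" by (intro rtrancl_mono) (auto simp: adj_def)
  then show ?thesis by (auto simp: component_def)
qed

lemma component_edge: "{u, v} \<in> F \<Longrightarrow> v \<in> component F u"
  by (auto simp: component_def adj_def)

lemma component_closed:
  assumes "v \<in> S" "\<And>x y. x \<in> S \<Longrightarrow> {x, y} \<in> F \<Longrightarrow> y \<in> S"
  shows "component F v \<subseteq> S"
proof
  fix x assume "x \<in> component F v"
  then have "(v, x) \<in> (adj F)\<^sup>*" by (simp add: component_def)
  then show "x \<in> S" by (induction rule: rtrancl_induct) (use assms in \<open>auto simp: adj_def\<close>)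
qed

lemma component_subset: "F \<subseteq> edges_on V \<Longrightarrow> v \<in> V \<Longrightarrow> component F v \<subseteq> V"
  by (rule component_closed) (auto simp: edges_on_def)

lemma component_empty [simp]: "component {} v = {v}"
  by (auto simp: component_def adj_def)

lemma component_insert:
  "component (insert {u, v} F) x =
    (if x \<in> component F u \<union> component F v then component F u \<union> component F v else component F x)"
proof (cases "x \<in> component F u \<union> component F v")
  case True
  have 1: "component (insert {u, v} F) x \<subseteq> component F u \<union> component F v"
  proof (rule component_closed)
    fix a b assume ab: "a \<in> component F u \<union> component F v" "{a, b} \<in> insert {u, v} F"
    show "b \<in> component F u \<union> component F v"
    proof (cases "{a, b} \<in> F")
      case True
      with ab component_edge[OF True] component_eq show ?thesis by blast
    next
      case False
      with ab have "b = u \<or> b = v" by (auto simp: doubleton_eq_iff)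
      then show ?thesis by auto
    qed
  qed (use True in auto)
  have uv: "v \<in> component (insert {u, v} F) u" by (rule component_edge) simp
  have "component F u \<union> component F v \<subseteq> component (insert {u, v} F) u"
    using component_mono[of F "insert {u, v} F" u] component_mono[of F "insert {u, v} F" v]
      component_eq[OF uv] by blast
  with True have "component (insert {u, v} F) x = component (insert {u, v} F) u"
    using component_eq by blast
  with 1 \<open>component F u \<union> component F v \<subseteq> component (insert {u, v} F) u\<close> True show ?thesis by auto
next
  case False
  have "component (insert {u, v} F) x \<subseteq> component F x"
  proof (rule component_closed)
    fix a b assume ab: "a \<in> component F x" "{a, b} \<in> insert {u, v} F"
    have "{a, b} \<noteq> {u, v}"
      using ab(1) False component_sym[of _ F] component_eq by (auto simp: doubleton_eq_iff)
    then show "b \<in> component F x" using ab component_edge component_eq by blast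
  qed simp
  with False component_mono[of F "insert {u, v} F" x] show ?thesis by auto
qed

lemma forest_mono: "forest G \<Longrightarrow> F \<subseteq> G \<Longrightarrow> forest F"
  unfolding forest_def using component_mono[OF Diff_mono[OF _ order_refl]] by blast

text \<open>Suppose an old edge \<open>{x, y}\<close> stops being a bridge. The new connection from
  \<open>x\<close> to \<open>y\<close> passes through \<open>{u, v}\<close>, so one of
  \<open>x\<close>, \<open>y\<close> lies on the side of \<open>u\<close> and the other on the side
  of \<open>v\<close>. Then \<open>{x, y}\<close> itself connects \<open>u\<close> to
  \<open>v\<close> in \<open>F\<close>.\<close>

lemma forest_insert:
  assumes "forest F" "v \<notin> component F u"
  shows "forest (insert {u, v} F)"
  unfolding forest_def
proof (intro allI impI notI)
  fix x y assume xy: "{x, y} \<in> insert {u, v} F" "y \<in> component (insert {u, v} F - {{x, y}}) x"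
  have uvF: "{u, v} \<notin> F" using assms(2) component_edge by blast
  show False
  proof (cases "{x, y} = {u, v}")
    case True
    then have "y \<in> component F x" using xy(2) uvF by simp
    with True assms(2) component_sym show False by (auto simp: doubleton_eq_iff)
  next
    case False
    define G where "G = F - {{x, y}}"
    have "insert {u, v} F - {{x, y}} = insert {u, v} G" using False by (auto simp: G_def)
    with xy(2) have 1: "y \<in> component (insert {u, v} G) x" by simp
    have xyF: "{x, y} \<in> F" using xy(1) False by simp
    then have 2: "y \<notin> component G x" using assms(1) by (auto simp: forest_def G_def)
    with 1 have "x \<in> component G u \<union> component G v" "y \<in> component G u \<union> component G v"
      by (auto simp: component_insert split: if_splits)
    with 2 have "(x \<in> component G u \<and> y \<in> component G v) \<or> (x \<in> component G v \<and> y \<in> component G u)"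
      by (cases "x \<in> component G u") (auto dest!: component_eq[of x])
    moreover have "component G u \<subseteq> component F u" "component G v \<subseteq> component F v"
      using component_mono[of G F] by (auto simp: G_def)
    ultimately have "(x \<in> component F u \<and> y \<in> component F v) \<or> (x \<in> component F v \<and> y \<in> component F u)"
      by blast
    with component_edge[OF xyF] component_eq component_sym assms(2) show False by metis
  qed
qed

lemma forest_remove:
  assumes "forest F" "{u, v} \<in> F"
  shows "v \<notin> component (F - {{u, v}}) u"
  using assms by (auto simp: forest_def)

context
  fixes V :: "nat set"
  assumes V: "finite V"
begin

lemma finite_edges_on: "finite (edges_on V)"
  using V by (auto simp: edges_on_def)

lemma finite_forests: "finite (forests V k)"
  by (rule finite_subset[of _ "Pow (edges_on V)"]) (auto simp: forests_def finite_edges_on)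

lemma finite_trees: "finite (trees V F)"
  using V by (simp add: trees_def)

lemma edges_on_cases:
  assumes "e \<in> edges_on V"
  obtains u v where "e = {u, v}" "u \<in> V" "v \<in> V" "u \<noteq> v"
  using assms by (auto simp: edges_on_def card_2_iff)

lemma joining_subset: "joining V F \<subseteq> edges_on V"
  by (auto simp: joining_def edges_on_def card_2_iff doubleton_eq_iff) (metis component_refl)

lemma trees_insert:
  assumes "u \<in> V" "v \<in> V"
  shows "trees V (insert {u, v} F) =
    insert (component F u \<union> component F v) (trees V F - {component F u, component F v})"
    (is "?L = insert ?C ?R")
proof (intro equalityI subsetI)
  fix C assume "C \<in> ?L"
  then obtain x where x: "x \<in> V" "C = component (insert {u, v} F) x" by (auto simp: trees_def)
  then show "C \<in> insert ?C ?R"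
    by (auto simp: component_insert trees_def component_eq_iff)
next
  fix C assume "C \<in> insert ?C ?R"
  then have "C = ?C \<or> (\<exists>x\<in>V. C = component F x \<and> x \<notin> component F u \<union> component F v)"
    using component_eq[of _ F u] component_eq[of _ F v] unfolding trees_def by blast
  then consider "C = ?C" | x where "x \<in> V" "C = component F x" "x \<notin> component F u \<union> component F v"
    by blast
  then show "C \<in> ?L"
  proof cases
    case 1
    then have "C = component (insert {u, v} F) u" by (simp add: component_insert)
    then show ?thesis using assms by (auto simp: trees_def)
  next
    case 2
    then have "C = component (insert {u, v} F) x" by (simp add: component_insert)
    then show ?thesis using 2 by (auto simp: trees_def)
  qed
qed

lemma union_not_in_trees:
  assumes "v \<notin> component F u"
  shows "component F u \<union> component F v \<notin> trees V F"
proof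
  assume "component F u \<union> component F v \<in> trees V F"
  then obtain x where "component F u \<union> component F v = component F x" by (auto simp: trees_def)
  then show False using assms component_eq component_refl by (metis UnI1 UnI2)
qed

lemma card_trees_insert:
  assumes "u \<in> V" "v \<in> V" "v \<notin> component F u"
  shows "Suc (card (trees V (insert {u, v} F))) = card (trees V F)"
proof -
  have ne: "component F u \<noteq> component F v" using assms(3) component_refl by blast
  have "card (trees V F - {component F u, component F v}) = card (trees V F) - 2"
    using ne assms V by (subst card_Diff_subset) (auto simp: trees_def)
  moreover have "card {component F u, component F v} \<le> card (trees V F)"
    by (rule card_mono) (use assms V in \<open>auto simp: trees_def\<close>)
  ultimately show ?thesis
    using ne finite_trees union_not_in_trees[OF assms(3)]
    by (simp add: trees_insert[OF assms(1,2)])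
qed

lemma component_card_pos:
  assumes "F \<subseteq> edges_on V" "v \<in> V"
  shows "card (component F v) > 0"
  using finite_subset[OF component_subset[OF assms] V] by (auto simp: card_gt_0_iff) (metis component_refl empty_iff)

lemma forest_weight_pos: "F \<subseteq> edges_on V \<Longrightarrow> forest_weight V F > 0"
  unfolding forest_weight_def using component_card_pos by (auto intro!: prod_pos simp: trees_def)

text \<open>Merging replaces the factors \<open>a\<close> and \<open>b\<close> by
  \<open>a + b\<close>. Writing the quotient \<open>(a + b) / (a * b)\<close> as
  \<open>1 / a + 1 / b\<close> lets sums over pairs of vertices split.\<close>

lemma forest_weight_insert:
  assumes "u \<in> V" "v \<in> V" "v \<notin> component F u" "F \<subseteq> edges_on V"
  shows "forest_weight V (insert {u, v} F) =
    forest_weight V F * (1 / card (component F u) + 1 / card (component F v))"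
proof -
  let ?Cu = "component F u" and ?Cv = "component F v"
  let ?R = "trees V F - {?Cu, ?Cv}"
  have ne: "?Cu \<noteq> ?Cv" using assms(3) component_refl by blast
  have pos: "card ?Cu > 0" "card ?Cv > 0" using component_card_pos assms by auto
  have "forest_weight V (insert {u, v} F) = real (card (?Cu \<union> ?Cv)) * (\<Prod>C\<in>?R. real (card C))"
    unfolding forest_weight_def trees_insert[OF assms(1,2)]
    using finite_trees union_not_in_trees[OF assms(3)] by (subst prod.insert) auto
  moreover have "card (?Cu \<union> ?Cv) = card ?Cu + card ?Cv"
    using pos component_disjoint[OF assms(3)] by (intro card_Un_disjoint) (auto simp: card_gt_0_iff)
  moreover have "forest_weight V F = real (card ?Cu) * (real (card ?Cv) * (\<Prod>C\<in>?R. real (card C)))"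
  proof -
    have "trees V F = insert ?Cu (insert ?Cv ?R)" using assms by (auto simp: trees_def)
    then have "forest_weight V F = (\<Prod>C\<in>insert ?Cu (insert ?Cv ?R). real (card C))"
      by (simp add: forest_weight_def)
    also have "\<dots> = real (card ?Cu) * (\<Prod>C\<in>insert ?Cv ?R. real (card C))"
      using finite_trees ne by (intro prod.insert) auto
    also have "(\<Prod>C\<in>insert ?Cv ?R. real (card C)) = real (card ?Cv) * (\<Prod>C\<in>?R. real (card C))"
      using finite_trees by (intro prod.insert) auto
    finally show ?thesis .
  qed
  ultimately show ?thesis using pos by (simp add: field_simps)
qed

section \<open>Double counting of added and deleted edges\<close>

lemma sum_by_component:
  fixes g :: "nat set \<Rightarrow> real"
  assumes "F \<subseteq> edges_on V"
  shows "(\<Sum>v\<in>V. g (component F v)) = (\<Sum>C\<in>trees V F. card C * g C)"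
proof -
  have "(\<Sum>v\<in>V. g (component F v)) =
      (\<Sum>C\<in>trees V F. \<Sum>v\<in>{v\<in>V. component F v = C}. g (component F v))"
    unfolding trees_def by (rule sum.image_gen[OF V])
  also have "\<dots> = (\<Sum>C\<in>trees V F. card C * g C)"
  proof (rule sum.cong)
    fix C assume "C \<in> trees V F"
    then have "{v\<in>V. component F v = C} = C"
      using component_subset[OF assms] component_eq component_refl by (auto simp: trees_def)
    moreover have "(\<Sum>v\<in>{v\<in>V. component F v = C}. g (component F v)) = (\<Sum>v\<in>{v\<in>V. component F v = C}. g C)"
      by (rule sum.cong) auto
    ultimately show "(\<Sum>v\<in>{v\<in>V. component F v = C}. g (component F v)) = card C * g C" by simp
  qed simp
  finally show ?thesis .
qed

text \<open>A tree with \<open>c\<close> vertices contributes \<open>c\<close> terms equal to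
  \<open>1 / c\<close>.\<close>

lemma sum_inverse_card:
  assumes "F \<subseteq> edges_on V"
  shows "(\<Sum>v\<in>V. 1 / real (card (component F v))) = card (trees V F)"
proof -
  have "(\<Sum>v\<in>V. 1 / real (card (component F v))) = (\<Sum>C\<in>trees V F. card C * (1 / real (card C)))"
    by (rule sum_by_component[OF assms])
  also have "\<dots> = (\<Sum>C\<in>trees V F. 1)"
    using component_card_pos[OF assms] by (intro sum.cong) (auto simp: trees_def)
  finally show ?thesis by simp
qed

text \<open>Deleting and adding the marked edge are inverse bijections. A sum over deletions thus
  becomes a sum over additions, for which the weights are computable.\<close>

lemma sum_edge_removal:
  fixes \<phi> :: "nat set set \<Rightarrow> nat set \<Rightarrow> real"
  shows "(\<Sum>F\<in>forests V k. \<Sum>e\<in>F. \<phi> F e) =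
    (\<Sum>F\<in>forests V (Suc k). \<Sum>e\<in>joining V F. \<phi> (insert e F) e)"
proof -
  have fin: "finite F" if "F \<in> forests V j" for F j
    using that finite_subset finite_edges_on by (auto simp: forests_def)
  have finj: "finite (joining V F)" for F using joining_subset finite_subset finite_edges_on by blast
  have "(\<Sum>F\<in>forests V k. \<Sum>e\<in>F. \<phi> F e) = (\<Sum>(F, e)\<in>Sigma (forests V k) (\<lambda>F. F). \<phi> F e)"
    by (rule sum.Sigma) (auto simp: finite_forests fin)
  also have "\<dots> = (\<Sum>(F, e)\<in>Sigma (forests V (Suc k)) (joining V). \<phi> (insert e F) e)"
  proof (rule sum.reindex_bij_witness[where i = "\<lambda>(F, e). (insert e F, e)" and j = "\<lambda>(F, e). (F - {e}, e)"])
    fix a assume "a \<in> Sigma (forests V k) (\<lambda>F. F)"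
    then obtain F e where a: "a = (F, e)" "F \<in> forests V k" "e \<in> F" by auto
    then have "e \<in> edges_on V" by (auto simp: forests_def)
    then obtain u v where uv: "e = {u, v}" "u \<in> V" "v \<in> V" by (rule edges_on_cases)
    have nc: "v \<notin> component (F - {e}) u" using a uv forest_remove by (auto simp: forests_def)
    have ins: "insert e (F - {e}) = F" using a by auto
    have "F - {e} \<in> forests V (Suc k)"
      using a card_trees_insert[OF uv(2,3) nc] ins uv(1) forest_mono[of F "F - {e}"]
      by (auto simp: forests_def)
    moreover have "e \<in> joining V (F - {e})" using uv nc by (auto simp: joining_def)
    ultimately show "(case a of (F, e) \<Rightarrow> (F - {e}, e)) \<in> Sigma (forests V (Suc k)) (joining V)"
      and "(case case a of (F, e) \<Rightarrow> (F - {e}, e) of (F, e) \<Rightarrow> (insert e F, e)) = a"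
      and "(case case a of (F, e) \<Rightarrow> (F - {e}, e) of (F, e) \<Rightarrow> \<phi> (insert e F) e) = (case a of (F, e) \<Rightarrow> \<phi> F e)"
      using a ins by auto
  next
    fix b assume "b \<in> Sigma (forests V (Suc k)) (joining V)"
    then obtain F e where b: "b = (F, e)" "F \<in> forests V (Suc k)" "e \<in> joining V F" by auto
    then obtain u v where uv: "e = {u, v}" "u \<in> V" "v \<in> V" "v \<notin> component F u"
      by (auto simp: joining_def)
    have "e \<notin> F" using uv component_edge by blast
    moreover have "insert e F \<in> forests V k"
      using b card_trees_insert[OF uv(2-4)] forest_insert[OF _ uv(4)] joining_subset uv(1)
      by (auto simp: forests_def)
    ultimately show "(case b of (F, e) \<Rightarrow> (insert e F, e)) \<in> Sigma (forests V k) (\<lambda>F. F)"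
      and "(case case b of (F, e) \<Rightarrow> (insert e F, e) of (F, e) \<Rightarrow> (F - {e}, e)) = b"
      using b by auto
  qed
  also have "\<dots> = (\<Sum>F\<in>forests V (Suc k). \<Sum>e\<in>joining V F. \<phi> (insert e F) e)"
    by (rule sum.Sigma[symmetric]) (auto simp: finite_forests finj)
  finally show ?thesis .
qed

text \<open>The factor 2 counts the two orientations of an edge; ordered pairs allow the symmetry
  \<open>sum_separated_swap\<close>.\<close>

lemma sum_joining:
  fixes h :: "nat set \<Rightarrow> real"
  shows "2 * (\<Sum>e\<in>joining V F. h e) = (\<Sum>u\<in>V. \<Sum>v\<in>V - component F u. h {u, v})"
proof -
  let ?P = "Sigma V (\<lambda>u. V - component F u)"
  have finP: "finite ?P" using V by auto
  have "(\<Sum>u\<in>V. \<Sum>v\<in>V - component F u. h {u, v}) = (\<Sum>x\<in>?P. h {fst x, snd x})"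
    by (subst sum.Sigma) (auto simp: V split_def)
  also have "\<dots> = (\<Sum>e\<in>(\<lambda>x. {fst x, snd x}) ` ?P. \<Sum>x\<in>{x\<in>?P. {fst x, snd x} = e}. h {fst x, snd x})"
    by (rule sum.image_gen[OF finP])
  also have "(\<lambda>x. {fst x, snd x}) ` ?P = joining V F"
    by (force simp: joining_def image_iff)
  also have "(\<Sum>e\<in>joining V F. \<Sum>x\<in>{x\<in>?P. {fst x, snd x} = e}. h {fst x, snd x}) = (\<Sum>e\<in>joining V F. 2 * h e)"
  proof (rule sum.cong)
    fix e assume "e \<in> joining V F"
    then obtain u v where uv: "e = {u, v}" "u \<in> V" "v \<in> V" "v \<notin> component F u" by (auto simp: joining_def)
    then have "u \<notin> component F v" "u \<noteq> v" using component_sym[of u F v] by auto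
    then have "{x\<in>?P. {fst x, snd x} = e} = {(u, v), (v, u)}"
      using uv by (auto simp: doubleton_eq_iff)
    then have "(\<Sum>x\<in>{x\<in>?P. {fst x, snd x} = e}. h {fst x, snd x}) = (\<Sum>x\<in>{(u, v), (v, u)}. h {fst x, snd x})" by simp
    also have "\<dots> = 2 * h e" using \<open>u \<noteq> v\<close> uv(1) by (simp add: insert_commute)
    finally show "(\<Sum>x\<in>{x\<in>?P. {fst x, snd x} = e}. h {fst x, snd x}) = 2 * h e" .
  qed simp
  finally show ?thesis by (simp add: sum_distrib_left)
qed

lemma sum_separated_swap:
  fixes h :: "nat \<Rightarrow> nat \<Rightarrow> real"
  shows "(\<Sum>u\<in>V. \<Sum>v\<in>V - component F u. h u v) = (\<Sum>u\<in>V. \<Sum>v\<in>V - component F u. h v u)"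
proof -
  have *: "V - component F u = {v\<in>V. u \<notin> component F v}" for u using component_sym[of _ F u] by auto
  have "(\<Sum>u\<in>V. \<Sum>v\<in>V - component F u. h u v) = (\<Sum>u\<in>V. \<Sum>v\<in>{v\<in>V. u \<notin> component F v}. h u v)"
    by (simp add: *)
  also have "\<dots> = (\<Sum>v\<in>V. \<Sum>u\<in>{u\<in>V. u \<notin> component F v}. h u v)"
    by (rule sum.swap_restrict[OF V V])
  also have "\<dots> = (\<Sum>v\<in>V. \<Sum>u\<in>V - component F v. h u v)" by (intro sum.cong) auto
  finally show ?thesis .
qed

lemma sum_inverse_card_outside:
  assumes "F \<subseteq> edges_on V" "u \<in> V"
  shows "(\<Sum>v\<in>V - component F u. 1 / real (card (component F v))) = real (card (trees V F)) - 1"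
proof -
  have "(\<Sum>v\<in>component F u. 1 / real (card (component F v))) = (\<Sum>v\<in>component F u. 1 / real (card (component F u)))"
    by (rule sum.cong) (auto dest: component_eq)
  also have "\<dots> = 1" using component_card_pos[OF assms] by simp
  finally show ?thesis
    using sum_diff[OF V component_subset[OF assms], of "\<lambda>v. 1 / real (card (component F v))"]
      sum_inverse_card[OF assms(1)] by simp
qed

text \<open>This is what the weights are for: the factor \<open>card V * k\<close> is the same for
  every \<open>F\<close>, so deleting a uniform edge maps the weighted law with \<open>k\<close>
  trees to the one with \<open>Suc k\<close> trees. The factor arises since, seen from any
  \<open>u\<close>, each of the \<open>k\<close> other trees contributes 1 to the sum of inverse
  sizes.\<close>

lemma sum_forest_weight_joining:
  assumes "F \<in> forests V (Suc k)"
  shows "(\<Sum>e\<in>joining V F. forest_weight V (insert e F)) = real (card V) * k * forest_weight V F"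
proof -
  have F: "F \<subseteq> edges_on V" "card (trees V F) = Suc k" using assms by (auto simp: forests_def)
  let ?c = "\<lambda>v. 1 / real (card (component F v))"
  have "2 * (\<Sum>e\<in>joining V F. forest_weight V (insert e F)) =
      (\<Sum>u\<in>V. \<Sum>v\<in>V - component F u. forest_weight V (insert {u, v} F))"
    by (rule sum_joining)
  also have "\<dots> = (\<Sum>u\<in>V. \<Sum>v\<in>V - component F u. forest_weight V F * (?c u + ?c v))"
    by (intro sum.cong refl forest_weight_insert) (use F in auto)
  also have "\<dots> = forest_weight V F * ((\<Sum>u\<in>V. \<Sum>v\<in>V - component F u. ?c u) + (\<Sum>u\<in>V. \<Sum>v\<in>V - component F u. ?c v))"
    by (simp only: sum_distrib_left sum.distrib distrib_left)
  also have "(\<Sum>u\<in>V. \<Sum>v\<in>V - component F u. ?c u) = (\<Sum>u\<in>V. \<Sum>v\<in>V - component F u. ?c v)"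
    by (rule sum_separated_swap)
  also have "(\<Sum>u\<in>V. \<Sum>v\<in>V - component F u. ?c v) = (\<Sum>u\<in>V. real k)"
    using sum_inverse_card_outside[OF F(1)] F(2) by (intro sum.cong) auto
  finally show ?thesis by simp
qed

end

section \<open>Cayley's formula for rooted forests\<close>

definition total_weight :: "nat set \<Rightarrow> nat \<Rightarrow> real" where
  "total_weight V k = (\<Sum>F\<in>forests V k. forest_weight V F)"

context
  fixes V :: "nat set"
  assumes V: "finite V"
begin

lemma trees_empty: "trees V {} = (\<lambda>v. {v}) ` V"
  by (simp add: trees_def)

lemma card_forest:
  assumes "F \<subseteq> edges_on V" "forest F"
  shows "card F + card (trees V F) = card V"
proof -
  have "finite F" using assms finite_edges_on[OF V] finite_subset by blast
  then show ?thesis using assms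
  proof (induction F rule: finite_induct)
    case empty
    then show ?case by (simp add: trees_empty card_image)
  next
    case (insert e F)
    then have "e \<in> edges_on V" by auto
    then obtain u v where uv: "e = {u, v}" "u \<in> V" "v \<in> V" by (rule edges_on_cases[OF V])
    have "v \<notin> component F u" using forest_remove[of "insert e F" u v] insert uv by simp
    from card_trees_insert[OF V uv(2,3) this] insert uv forest_mono[of "insert e F" F]
    show ?case by (auto simp: subset_insertI)
  qed
qed

lemma card_forests: "F \<in> forests V k \<Longrightarrow> card F + k = card V"
  using card_forest by (auto simp: forests_def)

lemma forest_empty: "forest {}"
  by (simp add: forest_def)

lemma forests_card: "forests V (card V) = {{}}"
proof -
  have "F = {}" if "F \<in> forests V (card V)" for F
  proof -
    have "finite F" using that finite_edges_on[OF V] finite_subset by (auto simp: forests_def)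
    then show ?thesis using card_forests[OF that] by simp
  qed
  moreover have "{} \<in> forests V (card V)"
    by (auto simp: forests_def forest_empty trees_empty card_image)
  ultimately show ?thesis by blast
qed

lemma forests_eq_empty: "card V < k \<Longrightarrow> forests V k = {}"
  using card_forests by fastforce

lemma forests_0: "V \<noteq> {} \<Longrightarrow> forests V 0 = {}"
  using V by (auto simp: forests_def trees_def)

text \<open>Pairs of a forest and one of its edges are counted in two ways; a forest with
  \<open>k\<close> trees has \<open>card V - k\<close> edges.\<close>

lemma total_weight_Suc:
  assumes "k \<le> card V"
  shows "real (card V - k) * total_weight V k = real (card V) * k * total_weight V (Suc k)"
proof -
  have "real (card V - k) * total_weight V k = (\<Sum>F\<in>forests V k. \<Sum>e\<in>F. forest_weight V F)"
    unfolding total_weight_def sum_distrib_left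
    by (rule sum.cong) (use card_forests in force)+
  also have "\<dots> = (\<Sum>F\<in>forests V (Suc k). \<Sum>e\<in>joining V F. forest_weight V (insert e F))"
    by (rule sum_edge_removal[OF V])
  also have "\<dots> = (\<Sum>F\<in>forests V (Suc k). real (card V) * k * forest_weight V F)"
    by (rule sum.cong[OF refl]) (rule sum_forest_weight_joining[OF V])
  finally show ?thesis by (simp add: total_weight_def sum_distrib_left)
qed

end

text \<open>Cayley's number of forests of \<open>k\<close> rooted trees on \<open>N\<close> labelled
  vertices. The case \<open>k = 0\<close> admits only the empty vertex set; it occurs when a fire
  burns the last tree.\<close>

definition rooted_forests :: "nat \<Rightarrow> nat \<Rightarrow> real" where
  "rooted_forests N k = (if N < k then 0 else if k = 0 then of_bool (N = 0)
     else real ((N - 1) choose (k - 1)) * real N ^ (N - k))"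

lemma rooted_forests_pos: "0 < k \<Longrightarrow> k \<le> N \<Longrightarrow> 0 < rooted_forests N k"
  by (auto simp: rooted_forests_def)

lemma rooted_forests_nonneg: "0 \<le> rooted_forests N k"
  by (auto simp: rooted_forests_def)

lemma rooted_forests_Suc:
  assumes "0 < k" "k < N"
  shows "real (N - k) * rooted_forests N k = real N * k * rooted_forests N (Suc k)"
proof -
  obtain j where k: "k = Suc j" using assms by (cases k) auto
  obtain m where N: "N = Suc m" using assms by (cases N) auto
  obtain d where d: "m = Suc (j + d)" using assms k N less_imp_Suc_add by (metis Suc_less_eq)
  have "Suc j * (m choose Suc j) = (m - j) * (m choose j)"
    by (simp only: binomial_absorption binomial_absorb_comp)
  then have *: "real (Suc j) * real (m choose Suc j) = real (m - j) * real (m choose j)"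
    by (metis of_nat_mult)
  have "real (N - k) * rooted_forests N k = real (m - j) * real (m choose j) * real N ^ (m - j)"
    using assms by (simp add: rooted_forests_def k N)
  also have "\<dots> = real (Suc j) * real (m choose Suc j) * (real N * real N ^ (m - Suc j))"
    unfolding * using d by (simp del: power_Suc of_nat_Suc add: power_Suc[symmetric] Suc_diff_le)
  finally show ?thesis using assms by (simp add: rooted_forests_def k N)
qed

text \<open>Both sides obey the same recursion in \<open>k\<close>, which determines them downwards
  from the edgeless forest at \<open>k = card V\<close>.\<close>

lemma total_weight_eq:
  assumes V: "finite V"
  shows "total_weight V k = rooted_forests (card V) k"
proof -
  consider "card V < k" | "k = 0" | "0 < k" "k \<le> card V" by linarith
  then show ?thesis
  proof cases
    case 1
    then show ?thesis using forests_eq_empty[OF V] by (simp add: total_weight_def rooted_forests_def)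
  next
    case 2
    show ?thesis
    proof (cases "V = {}")
      case True
      then show ?thesis using 2 forests_card[OF V]
        by (simp add: total_weight_def rooted_forests_def forest_weight_def trees_def)
    next
      case False
      then show ?thesis using 2 V forests_0[OF V] by (simp add: total_weight_def rooted_forests_def)
    qed
  next
    case 3
    from 3(2,1) show ?thesis
    proof (induction k rule: inc_induct)
      case base
      then have "V \<noteq> {}" by auto
      moreover have "forest_weight V {} = 1"
        by (simp add: forest_weight_def trees_empty[OF V] prod.reindex)
      ultimately show ?case using base forests_card[OF V]
        by (simp add: total_weight_def rooted_forests_def)
    next
      case (step k)
      have "real (card V - k) * total_weight V k = real (card V - k) * rooted_forests (card V) k"
        using total_weight_Suc[OF V, of k] rooted_forests_Suc[of k "card V"] step by simp
      then show ?case using step by simp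
    qed
  qed
qed

section \<open>Removing a whole tree\<close>

lemma component_Un:
  assumes "T \<subseteq> edges_on S" "G \<subseteq> edges_on S'" "S \<inter> S' = {}" "v \<in> S"
  shows "component (T \<union> G) v = component T v"
proof
  have "component (T \<union> G) v \<subseteq> component T v \<inter> S"
  proof (rule component_closed)
    fix x y assume xy: "x \<in> component T v \<inter> S" "{x, y} \<in> T \<union> G"
    then have "{x, y} \<in> T" using assms unfolding edges_on_def by blast
    then show "y \<in> component T v \<inter> S"
      using xy assms component_edge[of x y T] component_eq[of x T v] by (auto simp: edges_on_def)
  qed (use assms in auto)
  then show "component (T \<union> G) v \<subseteq> component T v" by simp
qed (simp add: component_mono)

lemma trees_Un:
  assumes "T \<subseteq> edges_on S" "G \<subseteq> edges_on S'" "S \<inter> S' = {}"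
  shows "trees (S \<union> S') (T \<union> G) = trees S T \<union> trees S' G"
proof -
  have "component (T \<union> G) v = component G v" if "v \<in> S'" for v
    using component_Un[of G S' T S v] assms that by (simp add: Un_commute Int_commute)
  then show ?thesis using component_Un[OF assms] by (auto simp: trees_def image_Un)
qed

lemma trees_subset: "T \<subseteq> edges_on S \<Longrightarrow> C \<in> trees S T \<Longrightarrow> C \<subseteq> S \<and> C \<noteq> {}"
  using component_subset component_refl unfolding trees_def by blast

lemma trees_Un_disjoint:
  assumes "T \<subseteq> edges_on S" "G \<subseteq> edges_on S'" "S \<inter> S' = {}"
  shows "trees S T \<inter> trees S' G = {}"
  using trees_subset[OF assms(1)] trees_subset[OF assms(2)] assms(3) by blast

lemma forest_Un:
  assumes "T \<subseteq> edges_on S" "G \<subseteq> edges_on S'" "S \<inter> S' = {}" "forest T" "forest G"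
  shows "forest (T \<union> G)"
  unfolding forest_def
proof (intro allI impI)
  fix u v assume uv: "{u, v} \<in> T \<union> G"
  have eq: "T \<union> G - {{u, v}} = (T - {{u, v}}) \<union> (G - {{u, v}})" by auto
  have sub: "T - {{u, v}} \<subseteq> edges_on S" "G - {{u, v}} \<subseteq> edges_on S'" using assms by auto
  from uv show "v \<notin> component (T \<union> G - {{u, v}}) u"
  proof
    assume T: "{u, v} \<in> T"
    then have "u \<in> S" using assms by (auto simp: edges_on_def)
    from component_Un[OF sub assms(3) this] show ?thesis
      using assms(4) T unfolding eq by (auto simp: forest_def)
  next
    assume G: "{u, v} \<in> G"
    then have "u \<in> S'" using assms by (auto simp: edges_on_def)
    from component_Un[OF sub(2,1) _ this] show ?thesis
      using assms(3,5) G unfolding eq by (auto simp: forest_def Un_commute Int_commute)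
  qed
qed

lemma trees_singleton:
  assumes "T \<in> forests S (Suc 0)"
  shows "trees S T = {S}" "v \<in> S \<Longrightarrow> component T v = S"
proof -
  from assms have T: "T \<subseteq> edges_on S" "card (trees S T) = 1" by (auto simp: forests_def)
  then obtain C where C: "trees S T = {C}" by (auto simp: card_1_singleton_iff)
  have "S \<subseteq> C"
  proof
    fix x assume "x \<in> S"
    then have "component T x = C" using C by (auto simp: trees_def)
    then show "x \<in> C" using component_refl by blast
  qed
  then have "C = S" using trees_subset[OF T(1), of C] C by auto
  with C show "trees S T = {S}" by simp
  then show "v \<in> S \<Longrightarrow> component T v = S" by (auto simp: trees_def)
qed

text \<open>Both ends of an edge lie in one component, so no edge leaves \<open>S\<close>.\<close>

lemma forest_split:
  assumes V: "finite V" and "F \<in> forests V k" "S \<in> trees V F"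
  shows "F \<inter> Pow S \<union> F \<inter> Pow (V - S) = F" "F \<inter> Pow S \<in> forests S 1" "F \<inter> Pow (V - S) \<in> forests (V - S) (k - 1)"
proof -
  from assms(2) have F: "F \<subseteq> edges_on V" "forest F" "card (trees V F) = k" by (auto simp: forests_def)
  have S: "S \<subseteq> V" "S \<noteq> {}" using trees_subset[OF F(1) assms(3)] by auto
  let ?T = "F \<inter> Pow S" and ?G = "F \<inter> Pow (V - S)"
  have split: "?T \<union> ?G = F"
  proof -
    have "e \<subseteq> S \<or> e \<subseteq> V - S" if "e \<in> F" for e
    proof -
      obtain x y where xy: "e = {x, y}" "x \<in> V" "y \<in> V" using \<open>e \<in> F\<close> F(1) edges_on_cases[OF V] by blast
      obtain w where w: "S = component F w" using assms(3) by (auto simp: trees_def)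
      have "y \<in> component F x" using component_edge[of x y F] that xy(1) by simp
      then have "x \<in> S \<longleftrightarrow> y \<in> S"
        unfolding w component_eq_iff[symmetric] by simp
      then show ?thesis using xy by auto
    qed
    then show ?thesis by auto
  qed
  have sub: "?T \<subseteq> edges_on S" "?G \<subseteq> edges_on (V - S)" using F(1) by (auto simp: edges_on_def)
  have VS: "S \<union> (V - S) = V" using S by auto
  have dis: "S \<inter> (V - S) = {}" by auto
  have tr: "trees V F = trees S ?T \<union> trees (V - S) ?G"
    using trees_Un[OF sub dis] unfolding split VS .
  have "trees S ?T = {S}"
  proof -
    have "component ?T v = S" if "v \<in> S" for v
    proof -
      have "component F v = component ?T v" using component_Un[OF sub dis that] unfolding split .
      moreover have "component F v = S" using assms(3) that component_eq by (auto simp: trees_def)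
      ultimately show ?thesis by simp
    qed
    then show ?thesis using S by (auto simp: trees_def)
  qed
  moreover have "card (trees V F) = card (trees S ?T) + card (trees (V - S) ?G)"
    unfolding tr by (rule card_Un_disjoint)
      (use finite_trees[OF finite_subset[OF S(1) V]] finite_trees[of "V - S"] V
        trees_Un_disjoint[OF sub dis] in auto)
  ultimately have "?T \<in> forests S 1" "?G \<in> forests (V - S) (k - 1)"
    using sub F forest_mono[OF F(2)] by (auto simp: forests_def)
  with split show "F \<inter> Pow S \<union> F \<inter> Pow (V - S) = F" "F \<inter> Pow S \<in> forests S 1"
    "F \<inter> Pow (V - S) \<in> forests (V - S) (k - 1)" by auto
qed

text \<open>A forest with a marked tree is the same as a vertex set, a tree on it, and a forest with
  one tree fewer on the complement.\<close>

lemma sum_tree_removal: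
  fixes \<phi> :: "nat set \<Rightarrow> nat set set \<Rightarrow> real"
  assumes V: "finite V" and k: "0 < k"
  shows "(\<Sum>F\<in>forests V k. \<Sum>S\<in>trees V F. \<phi> S F) =
    (\<Sum>S\<in>Pow V - {{}}. \<Sum>T\<in>forests S 1. \<Sum>G\<in>forests (V - S) (k - 1). \<phi> S (T \<union> G))"
proof -
  have finS: "finite S" if "S \<in> Pow V - {{}}" for S using that V finite_subset by auto
  let ?A = "Sigma (forests V k) (trees V)"
  let ?B = "Sigma (Pow V - {{}}) (\<lambda>S. forests S 1 \<times> forests (V - S) (k - 1))"
  have "(\<Sum>F\<in>forests V k. \<Sum>S\<in>trees V F. \<phi> S F) = (\<Sum>(F, S)\<in>?A. \<phi> S F)"
    by (rule sum.Sigma) (auto simp: finite_forests V finite_trees)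
  also have "\<dots> = (\<Sum>(S, T, G)\<in>?B. \<phi> S (T \<union> G))"
  proof (rule sum.reindex_bij_witness[where i = "\<lambda>(S, T, G). (T \<union> G, S)"
        and j = "\<lambda>(F, S). (S, F \<inter> Pow S, F \<inter> Pow (V - S))"])
    fix a assume "a \<in> ?A"
    then obtain F S where a: "a = (F, S)" "F \<in> forests V k" "S \<in> trees V F" by auto
    then have S: "S \<subseteq> V" "S \<noteq> {}" using trees_subset[of F V S] by (auto simp: forests_def)
    let ?T = "F \<inter> Pow S" and ?G = "F \<inter> Pow (V - S)"
    have split: "?T \<union> ?G = F" and "?T \<in> forests S 1" "?G \<in> forests (V - S) (k - 1)"
      using forest_split[OF V a(2,3)] by auto
    then show "(case a of (F, S) \<Rightarrow> (S, F \<inter> Pow S, F \<inter> Pow (V - S))) \<in> ?B"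
      and "(case case a of (F, S) \<Rightarrow> (S, F \<inter> Pow S, F \<inter> Pow (V - S)) of (S, T, G) \<Rightarrow> (T \<union> G, S)) = a"
      and "(case case a of (F, S) \<Rightarrow> (S, F \<inter> Pow S, F \<inter> Pow (V - S)) of (S, T, G) \<Rightarrow> \<phi> S (T \<union> G)) =
        (case a of (F, S) \<Rightarrow> \<phi> S F)"
      using a(1) S split by auto
  next
    fix b assume "b \<in> ?B"
    then obtain S T G where b: "b = (S, T, G)" "S \<subseteq> V" "S \<noteq> {}" "T \<in> forests S 1" "G \<in> forests (V - S) (k - 1)"
      by auto
    have sub: "T \<subseteq> edges_on S" "G \<subseteq> edges_on (V - S)" using b by (auto simp: forests_def)
    have VS: "S \<union> (V - S) = V" using b by auto
    have dis: "S \<inter> (V - S) = {}" by auto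
    have tr: "trees V (T \<union> G) = trees S T \<union> trees (V - S) G"
      using trees_Un[OF sub dis] unfolding VS .
    have "card (trees V (T \<union> G)) = card (trees S T) + card (trees (V - S) G)"
      unfolding tr by (rule card_Un_disjoint)
        (use finite_trees[OF finite_subset[OF b(2) V]] finite_trees[of "V - S"] V
          trees_Un_disjoint[OF sub dis] in auto)
    then have "T \<union> G \<in> forests V k"
      using b k forest_Un[OF sub dis] sub by (auto simp: forests_def edges_on_def)
    moreover have "S \<in> trees V (T \<union> G)" using tr trees_singleton(1) b by auto
    moreover have "(T \<union> G) \<inter> Pow S = T" "(T \<union> G) \<inter> Pow (V - S) = G"
    proof -
      \<comment> \<open>The empty set belongs to both power sets, so it has to be excluded before
        \<open>T\<close> and \<open>G\<close> can be read off their union.\<close>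
      have "e \<noteq> {}" if "e \<in> T \<union> G" for e using sub that by (auto simp: edges_on_def)
      then show "(T \<union> G) \<inter> Pow S = T" "(T \<union> G) \<inter> Pow (V - S) = G"
        using sub unfolding edges_on_def by blast+
    qed
    ultimately show "(case b of (S, T, G) \<Rightarrow> (T \<union> G, S)) \<in> ?A"
      and "(case case b of (S, T, G) \<Rightarrow> (T \<union> G, S) of (F, S) \<Rightarrow> (S, F \<inter> Pow S, F \<inter> Pow (V - S))) = b"
      using b by auto
  qed
  also have "\<dots> = (\<Sum>S\<in>Pow V - {{}}. \<Sum>(T, G)\<in>forests S 1 \<times> forests (V - S) (k - 1). \<phi> S (T \<union> G))"
    by (rule sum.Sigma[symmetric]) (use finite_forests V finS in auto)
  also have "\<dots> = (\<Sum>S\<in>Pow V - {{}}. \<Sum>T\<in>forests S 1. \<Sum>G\<in>forests (V - S) (k - 1). \<phi> S (T \<union> G))"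
    by (rule sum.cong[OF refl]) (simp add: sum.cartesian_product)
  finally show ?thesis .
qed

lemma forest_weight_Un:
  assumes "finite V" "S \<subseteq> V" "T \<in> forests S 1" "G \<subseteq> edges_on (V - S)"
  shows "forest_weight V (T \<union> G) = real (card S) * forest_weight (V - S) G"
proof -
  have sub: "T \<subseteq> edges_on S" using assms by (auto simp: forests_def)
  have dis: "S \<inter> (V - S) = {}" by auto
  have "S \<union> (V - S) = V" using assms by auto
  then have tr: "trees V (T \<union> G) = {S} \<union> trees (V - S) G"
    using trees_Un[OF sub assms(4) dis] trees_singleton(1) assms(3) by simp
  have "S \<notin> trees (V - S) G"
    using trees_Un_disjoint[OF sub assms(4) dis] trees_singleton(1) assms(3) by auto
  moreover have "finite (trees (V - S) G)" using assms(1) finite_trees by auto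
  ultimately show ?thesis by (simp add: forest_weight_def tr)
qed

lemma sum_card_subsets:
  fixes h :: "nat \<Rightarrow> real"
  assumes "finite V"
  shows "(\<Sum>S\<in>Pow V. h (card S)) = (\<Sum>s\<le>card V. real (card V choose s) * h s)"
proof -
  have "(\<Sum>S\<in>Pow V. h (card S)) = (\<Sum>s\<le>card V. \<Sum>S\<in>{S\<in>Pow V. card S = s}. h (card S))"
    by (rule sum.group[symmetric]) (use assms card_mono in auto)
  also have "\<dots> = (\<Sum>s\<le>card V. real (card V choose s) * h s)"
  proof (rule sum.cong)
    fix s
    have "(\<Sum>S\<in>{S\<in>Pow V. card S = s}. h (card S)) = (\<Sum>S\<in>{S. S \<subseteq> V \<and> card S = s}. h s)"
      by (rule sum.cong) auto
    then show "(\<Sum>S\<in>{S\<in>Pow V. card S = s}. h (card S)) = real (card V choose s) * h s"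
      using n_subsets[OF assms, of s] by simp
  qed simp
  finally show ?thesis .
qed

text \<open>A fire deletes the edges inside \<open>S\<close>, whereas the bijection above keeps
  those inside \<open>V - S\<close>.\<close>

lemma forest_minus:
  assumes "finite V" "F \<in> forests V k" "S \<in> trees V F"
  shows "F - Pow S = F \<inter> Pow (V - S)"
proof -
  have F: "F \<subseteq> edges_on V" using assms(2) by (simp add: forests_def)
  then have "e \<noteq> {}" if "e \<in> F" for e using that by (auto simp: edges_on_def)
  then show ?thesis using forest_split(1)[OF assms] by blast
qed

text \<open>The weight factors into that of the marked tree and that of the rest. Once the sum over
  the rest depends on \<open>S\<close> only through its size, which is the hypothesis on
  \<open>A\<close>, only a sum over sizes remains.\<close>

lemma sum_forest_weight_trees:
  fixes \<psi> :: "nat \<Rightarrow> nat set set \<Rightarrow> real"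
  assumes V: "finite V" and k: "0 < k"
    and A: "\<And>S. S \<subseteq> V \<Longrightarrow> S \<noteq> {} \<Longrightarrow> (\<Sum>G\<in>forests (V - S) (k - 1). forest_weight (V - S) G * \<psi> (card S) G) = A (card S)"
  shows "(\<Sum>F\<in>forests V k. forest_weight V F * (\<Sum>S\<in>trees V F. \<psi> (card S) (F - Pow S))) =
    (\<Sum>s\<le>card V. real (card V choose s) * (rooted_forests s 1 * A s))"
proof -
  have "(\<Sum>F\<in>forests V k. forest_weight V F * (\<Sum>S\<in>trees V F. \<psi> (card S) (F - Pow S))) =
      (\<Sum>F\<in>forests V k. \<Sum>S\<in>trees V F. forest_weight V F * \<psi> (card S) (F \<inter> Pow (V - S)))"
    unfolding sum_distrib_left by (intro sum.cong refl) (simp add: forest_minus[OF V])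
  also have "\<dots> = (\<Sum>S\<in>Pow V - {{}}. \<Sum>T\<in>forests S 1. \<Sum>G\<in>forests (V - S) (k - 1).
      forest_weight V (T \<union> G) * \<psi> (card S) ((T \<union> G) \<inter> Pow (V - S)))"
    by (rule sum_tree_removal[OF V k])
  also have "\<dots> = (\<Sum>S\<in>Pow V - {{}}. rooted_forests (card S) 1 * A (card S))"
  proof (rule sum.cong[OF refl])
    fix S assume S: "S \<in> Pow V - {{}}"
    then have fS: "finite S" using V finite_subset by auto
    have "(\<Sum>T\<in>forests S 1. \<Sum>G\<in>forests (V - S) (k - 1).
        forest_weight V (T \<union> G) * \<psi> (card S) ((T \<union> G) \<inter> Pow (V - S))) =
      (\<Sum>T\<in>forests S 1. \<Sum>G\<in>forests (V - S) (k - 1).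
        forest_weight S T * (forest_weight (V - S) G * \<psi> (card S) G))"
    proof (intro sum.cong refl)
      fix T G assume TG: "T \<in> forests S 1" "G \<in> forests (V - S) (k - 1)"
      then have sub: "T \<subseteq> edges_on S" "G \<subseteq> edges_on (V - S)" by (auto simp: forests_def)
      then have "e \<noteq> {}" if "e \<in> T" for e using that by (auto simp: edges_on_def)
      then have "(T \<union> G) \<inter> Pow (V - S) = G" using sub unfolding edges_on_def by blast
      moreover have "forest_weight S T = real (card S)"
        using trees_singleton(1)[of T S] TG by (simp add: forest_weight_def)
      ultimately show "forest_weight V (T \<union> G) * \<psi> (card S) ((T \<union> G) \<inter> Pow (V - S)) =
          forest_weight S T * (forest_weight (V - S) G * \<psi> (card S) G)"
        using forest_weight_Un[OF V _ TG(1) sub(2)] S by simp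
    qed
    also have "\<dots> = total_weight S 1 * A (card S)"
      using A[of S] S by (simp add: sum_distrib_left[symmetric] sum_distrib_right[symmetric] total_weight_def)
    finally show "(\<Sum>T\<in>forests S 1. \<Sum>G\<in>forests (V - S) (k - 1).
        forest_weight V (T \<union> G) * \<psi> (card S) ((T \<union> G) \<inter> Pow (V - S))) = rooted_forests (card S) 1 * A (card S)"
      using total_weight_eq[OF fS, of 1] by simp
  qed
  \<comment> \<open>The empty set may be added because
    \<open>rooted_forests 0 1 = 0\<close>.\<close>
  also have "\<dots> = (\<Sum>S\<in>Pow V. rooted_forests (card S) 1 * A (card S))"
    by (rule sum.mono_neutral_left) (use V in \<open>auto simp: rooted_forests_def\<close>)
  also have "\<dots> = (\<Sum>s\<le>card V. real (card V choose s) * (rooted_forests s 1 * A s))"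
    by (rule sum_card_subsets[OF V])
  finally show ?thesis .
qed

section \<open>The tree around a uniform edge\<close>

text \<open>The union over the ends avoids choosing one of them; for an edge of \<open>F\<close>
  both ends give the same component.\<close>

definition tree_of_edge :: "nat set set \<Rightarrow> nat set \<Rightarrow> nat set" where
  "tree_of_edge F e = (\<Union>v\<in>e. component F v)"

lemma tree_of_edge_eq:
  assumes "e \<in> F" "F \<subseteq> edges_on V" "finite V" "v \<in> e"
  shows "tree_of_edge F e = component F v"
proof -
  obtain x y where e: "e = {x, y}" using assms edges_on_cases[of V e] by blast
  then have "component F y = component F x" using component_eq component_edge assms by blast
  then show ?thesis using e assms by (auto simp: tree_of_edge_def)
qed

text \<open>A tree of size \<open>s\<close> has \<open>s - 1\<close> edges; this is the bias with
  which a uniform edge selects a tree.\<close>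

lemma sum_edges_by_tree:
  fixes f :: "nat set \<Rightarrow> real"
  assumes V: "finite V" and F: "F \<in> forests V k"
  shows "(\<Sum>e\<in>F. f (tree_of_edge F e)) = (\<Sum>S\<in>trees V F. real (card S - 1) * f S)"
proof -
  have FV: "F \<subseteq> edges_on V" using F by (simp add: forests_def)
  have finF: "finite F" using FV finite_edges_on[OF V] finite_subset by blast
  have "tree_of_edge F e \<in> trees V F" if e: "e \<in> F" for e
  proof -
    obtain x y where xy: "e = {x, y}" "x \<in> V" using e FV edges_on_cases[OF V, of e] by blast
    then show ?thesis using tree_of_edge_eq[OF e FV V, of x] by (auto simp: trees_def)
  qed
  then have "(\<Sum>e\<in>F. f (tree_of_edge F e)) = (\<Sum>S\<in>trees V F. \<Sum>e\<in>{e\<in>F. tree_of_edge F e = S}. f (tree_of_edge F e))"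
    by (intro sum.group[symmetric]) (use finF finite_trees[OF V] in auto)
  also have "\<dots> = (\<Sum>S\<in>trees V F. real (card S - 1) * f S)"
  proof (rule sum.cong[OF refl])
    fix S assume S: "S \<in> trees V F"
    have "e \<subseteq> S \<longleftrightarrow> tree_of_edge F e = S" if e: "e \<in> F" for e
    proof -
      obtain x y where xy: "e = {x, y}" "x \<in> V" using e FV edges_on_cases[OF V, of e] by blast
      obtain w where w: "S = component F w" using S by (auto simp: trees_def)
      have "component F y = component F x" using e xy component_eq component_edge by blast
      then show ?thesis using tree_of_edge_eq[OF e FV V, of x] xy(1)
        unfolding w by (metis component_eq component_refl empty_subsetI insert_subset insertI1)
    qed
    then have "{e\<in>F. tree_of_edge F e = S} = F \<inter> Pow S" by auto
    moreover have "card (F \<inter> Pow S) = card S - 1"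
      using card_forests[OF _ forest_split(2)[OF V F S]] trees_subset[OF FV S] finite_subset[OF _ V] by force
    moreover have "(\<Sum>e\<in>{e\<in>F. tree_of_edge F e = S}. f (tree_of_edge F e)) = (\<Sum>e\<in>{e\<in>F. tree_of_edge F e = S}. f S)"
      by (rule sum.cong) auto
    ultimately show "(\<Sum>e\<in>{e\<in>F. tree_of_edge F e = S}. f (tree_of_edge F e)) = real (card S - 1) * f S"
      by simp
  qed
  finally show ?thesis .
qed

text \<open>
  The law of the size of the tree around a uniform edge of a weighted forest: choose its vertices, the
  tree on them, its root, the edge, and the rest of the forest.
\<close>

definition burn_prob :: "nat \<Rightarrow> nat \<Rightarrow> nat \<Rightarrow> real" where
  "burn_prob N k s = real (N choose s) * (rooted_forests s 1 * (real (s - 1) * rooted_forests (N - s) (k - 1)))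
     / (real (N - k) * rooted_forests N k)"

lemma burn_prob_nonneg: "0 \<le> burn_prob N k s"
  by (simp add: burn_prob_def rooted_forests_nonneg)

lemma burn_prob_eq_0: "s < 2 \<or> N < s \<Longrightarrow> burn_prob N k s = 0"
  by (auto simp: burn_prob_def)

text \<open>One step of burning from a weighted forest. The function \<open>\<psi>\<close> may look
  at the burnt size and at the whole remaining forest, since the rest is again a weighted forest
  given that size. Constant 1 yields the total mass, the size itself yields the mean, and the law of
  later sizes yields the Markov property.\<close>

lemma sum_burn_weight:
  fixes \<psi> :: "nat \<Rightarrow> nat set set \<Rightarrow> real"
  assumes V: "finite V" and k: "0 < k" "k < card V"
    and A: "\<And>S. S \<subseteq> V \<Longrightarrow> 2 \<le> card S \<Longrightarrow> (\<Sum>G\<in>forests (V - S) (k - 1). forest_weight (V - S) G * \<psi> (card S) G)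
      = rooted_forests (card V - card S) (k - 1) * A (card S)"
  shows "(\<Sum>F\<in>forests V k. forest_weight V F * (\<Sum>e\<in>F. \<psi> (card (tree_of_edge F e)) (F - Pow (tree_of_edge F e)))) =
    real (card V - k) * rooted_forests (card V) k * (\<Sum>s\<le>card V. burn_prob (card V) k s * A s)"
proof -
  have pos: "real (card V - k) * rooted_forests (card V) k > 0" using k rooted_forests_pos by simp
  have "(\<Sum>F\<in>forests V k. forest_weight V F * (\<Sum>e\<in>F. \<psi> (card (tree_of_edge F e)) (F - Pow (tree_of_edge F e)))) =
      (\<Sum>F\<in>forests V k. forest_weight V F * (\<Sum>S\<in>trees V F. real (card S - 1) * \<psi> (card S) (F - Pow S)))"
    using sum_edges_by_tree[OF V, where f = "\<lambda>S. \<psi> (card S) (_ - Pow S)"] by (intro sum.cong refl) simp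
  also have "\<dots> = (\<Sum>s\<le>card V. real (card V choose s) *
      (rooted_forests s 1 * (real (s - 1) * (rooted_forests (card V - s) (k - 1) * A s))))"
  proof (rule sum_forest_weight_trees[OF V k(1)])
    fix S assume S: "S \<subseteq> V" "S \<noteq> {}"
    show "(\<Sum>G\<in>forests (V - S) (k - 1). forest_weight (V - S) G * (real (card S - 1) * \<psi> (card S) G)) =
        real (card S - 1) * (rooted_forests (card V - card S) (k - 1) * A (card S))"
    \<comment> \<open>A single vertex carries no edge: the factor \<open>card S - 1\<close> vanishes
      at the sizes about which \<open>A\<close> says nothing.\<close>
    proof (cases "2 \<le> card S")
      case True
      show ?thesis
        unfolding A[OF S(1) True, symmetric] sum_distrib_left by (intro sum.cong refl) simp
    qed simp
  qed
  also have "\<dots> = real (card V - k) * rooted_forests (card V) k * (\<Sum>s\<le>card V. burn_prob (card V) k s * A s)"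
  proof -
    have *: "D * (x / D * a) = x * a" if "D > 0" for D x a :: real using that by simp
    show ?thesis unfolding sum_distrib_left burn_prob_def *[OF pos] by (simp add: mult_ac)
  qed
  finally show ?thesis .
qed

lemma card_Diff_finite: "finite V \<Longrightarrow> S \<subseteq> V \<Longrightarrow> card (V - S) = card V - card S"
  using card_Diff_subset finite_subset by metis

text \<open>The case \<open>\<psi> = 1\<close> of \<open>sum_burn_weight\<close>: the weighted
  number of marked edges, counted directly, is the denominator of \<open>burn_prob\<close>.\<close>

lemma sum_burn_prob:
  assumes "0 < k" "k < N"
  shows "(\<Sum>s\<le>N. burn_prob N k s) = 1"
proof -
  define V where "V = {..<N}"
  have V: "finite V" "card V = N" by (auto simp: V_def)
  have "(\<Sum>F\<in>forests V k. forest_weight V F * (\<Sum>e\<in>F. 1)) =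
      real (N - k) * rooted_forests N k * (\<Sum>s\<le>N. burn_prob N k s * 1)"
    unfolding V(2)[symmetric]
  proof (rule sum_burn_weight[OF V(1)])
    fix S assume "S \<subseteq> V"
    then show "(\<Sum>G\<in>forests (V - S) (k - 1). forest_weight (V - S) G * 1) = rooted_forests (card V - card S) (k - 1) * 1"
      using total_weight_eq[of "V - S" "k - 1"] V(1) by (simp add: total_weight_def card_Diff_finite)
  qed (use assms V in auto)
  moreover have "(\<Sum>F\<in>forests V k. forest_weight V F * (\<Sum>e\<in>F. 1)) = real (N - k) * rooted_forests N k"
  proof -
    have "(\<Sum>F\<in>forests V k. forest_weight V F * (\<Sum>e\<in>F. 1)) = (\<Sum>F\<in>forests V k. forest_weight V F * real (N - k))"
      by (rule sum.cong[OF refl]) (use card_forests[OF V(1)] V(2) in force)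
    then show ?thesis using total_weight_eq[OF V(1), of k] V(2)
      by (simp add: total_weight_def sum_distrib_right[symmetric])
  qed
  ultimately show ?thesis using assms rooted_forests_pos[of k N] by simp
qed

section \<open>The mean burnt size\<close>

text \<open>Summing the size of the surrounding tree over all edges gives the sum of
  \<open>s * (s - 1)\<close> over the trees, hence the mean burnt size is governed by the sum of
  squares.\<close>

definition square_weight :: "nat set \<Rightarrow> nat set set \<Rightarrow> real" where
  "square_weight V F = (\<Sum>C\<in>trees V F. (real (card C))\<^sup>2)"

lemma square_weight_insert:
  assumes V: "finite V" and "u \<in> V" "v \<in> V" "v \<notin> component F u" "F \<subseteq> edges_on V"
  shows "square_weight V (insert {u, v} F) =
    square_weight V F + 2 * real (card (component F u)) * real (card (component F v))"
proof -
  let ?Cu = "component F u" and ?Cv = "component F v"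
  let ?R = "trees V F - {?Cu, ?Cv}"
  have ne: "?Cu \<noteq> ?Cv" using assms component_refl by blast
  have pos: "card ?Cu > 0" "card ?Cv > 0" using component_card_pos[OF V] assms by auto
  have "square_weight V (insert {u, v} F) = (real (card (?Cu \<union> ?Cv)))\<^sup>2 + (\<Sum>C\<in>?R. (real (card C))\<^sup>2)"
    unfolding square_weight_def trees_insert[OF V assms(2,3)]
    using finite_trees[OF V] union_not_in_trees[OF V assms(4)] by (subst sum.insert) auto
  moreover have "card (?Cu \<union> ?Cv) = card ?Cu + card ?Cv"
    using pos component_disjoint[OF assms(4)] by (intro card_Un_disjoint) (auto simp: card_gt_0_iff)
  moreover have "square_weight V F = (real (card ?Cu))\<^sup>2 + ((real (card ?Cv))\<^sup>2 + (\<Sum>C\<in>?R. (real (card C))\<^sup>2))"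
  proof -
    have "trees V F = insert ?Cu (insert ?Cv ?R)" using assms by (auto simp: trees_def)
    then have "square_weight V F = (\<Sum>C\<in>insert ?Cu (insert ?Cv ?R). (real (card C))\<^sup>2)"
      by (simp add: square_weight_def)
    also have "\<dots> = (real (card ?Cu))\<^sup>2 + (\<Sum>C\<in>insert ?Cv ?R. (real (card C))\<^sup>2)"
      using finite_trees[OF V] ne by (intro sum.insert) auto
    also have "(\<Sum>C\<in>insert ?Cv ?R. (real (card C))\<^sup>2) = (real (card ?Cv))\<^sup>2 + (\<Sum>C\<in>?R. (real (card C))\<^sup>2)"
      using finite_trees[OF V] by (intro sum.insert) auto
    finally show ?thesis .
  qed
  ultimately show ?thesis by (simp add: power2_eq_square algebra_simps)
qed

lemma square_weight_eq:
  assumes "finite V" "F \<subseteq> edges_on V"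
  shows "square_weight V F = (\<Sum>v\<in>V. real (card (component F v)))"
  using sum_by_component[OF assms, of "\<lambda>C. real (card C)"] by (simp add: square_weight_def power2_eq_square)

text \<open>Merging sizes \<open>a\<close> and \<open>b\<close> increases the sum of squares by
  \<open>2 * a * b\<close>; multiplied by the weight factor \<open>1 / a + 1 / b\<close> this
  becomes \<open>2 * (a + b)\<close>. Bounding separated pairs by all pairs turns the factor
  \<open>k\<close> of \<open>sum_forest_weight_joining\<close> into \<open>k + 2\<close>.\<close>

lemma sum_square_weight_joining:
  assumes V: "finite V" and F: "F \<in> forests V (Suc k)"
  shows "(\<Sum>e\<in>joining V F. forest_weight V (insert e F) * square_weight V (insert e F)) \<le>
    real (card V) * (real k + 2) * (forest_weight V F * square_weight V F)"
proof -
  have FV: "F \<subseteq> edges_on V" "card (trees V F) = Suc k" using F by (auto simp: forests_def)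
  let ?a = "\<lambda>v. real (card (component F v))"
  let ?w = "forest_weight V F" and ?Q = "square_weight V F"
  have w: "?w > 0" by (rule forest_weight_pos[OF V FV(1)])
  have pos: "?a v > 0" if "v \<in> V" for v using component_card_pos[OF V FV(1) that] by simp
  have "2 * (\<Sum>e\<in>joining V F. forest_weight V (insert e F) * square_weight V (insert e F)) =
      (\<Sum>u\<in>V. \<Sum>v\<in>V - component F u. forest_weight V (insert {u, v} F) * square_weight V (insert {u, v} F))"
    by (rule sum_joining[OF V])
  also have "\<dots> = (\<Sum>u\<in>V. \<Sum>v\<in>V - component F u. ?Q * forest_weight V (insert {u, v} F) + ?w * (2 * (?a u + ?a v)))"
  proof (intro sum.cong refl)
    fix u v assume uv: "u \<in> V" "v \<in> V - component F u"
    have "forest_weight V (insert {u, v} F) * (2 * ?a u * ?a v) = ?w * (2 * (?a u + ?a v))"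
      using forest_weight_insert[OF V, of u v F] uv FV pos[of u] pos[of v] by (simp add: field_simps)
    then show "forest_weight V (insert {u, v} F) * square_weight V (insert {u, v} F) =
        ?Q * forest_weight V (insert {u, v} F) + ?w * (2 * (?a u + ?a v))"
      using square_weight_insert[OF V, of u v F] uv FV by (simp add: algebra_simps)
  qed
  also have "\<dots> = ?Q * (\<Sum>u\<in>V. \<Sum>v\<in>V - component F u. forest_weight V (insert {u, v} F)) +
      2 * ?w * ((\<Sum>u\<in>V. \<Sum>v\<in>V - component F u. ?a u) + (\<Sum>u\<in>V. \<Sum>v\<in>V - component F u. ?a v))"
    by (simp only: sum.distrib sum_distrib_left distrib_left mult.assoc mult.left_commute[of ?w 2])
  also have "(\<Sum>u\<in>V. \<Sum>v\<in>V - component F u. ?a u) = (\<Sum>u\<in>V. \<Sum>v\<in>V - component F u. ?a v)"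
    by (rule sum_separated_swap[OF V])
  also have "(\<Sum>u\<in>V. \<Sum>v\<in>V - component F u. forest_weight V (insert {u, v} F)) =
      2 * (\<Sum>e\<in>joining V F. forest_weight V (insert e F))"
    by (rule sum_joining[OF V, symmetric])
  also have "\<dots> = 2 * (real (card V) * k * ?w)" by (simp add: sum_forest_weight_joining[OF V F])
  finally have eq: "2 * (\<Sum>e\<in>joining V F. forest_weight V (insert e F) * square_weight V (insert e F)) =
     ?Q * (2 * (real (card V) * k * ?w)) + 2 * ?w * (2 * (\<Sum>u\<in>V. \<Sum>v\<in>V - component F u. ?a v))" by simp
  have "(\<Sum>u\<in>V. \<Sum>v\<in>V - component F u. ?a v) \<le> (\<Sum>u\<in>V. \<Sum>v\<in>V. ?a v)"
    by (intro sum_mono sum_mono2) (use V in auto)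
  also have "\<dots> = real (card V) * ?Q" by (simp add: square_weight_eq[OF V FV(1)])
  finally have "2 * ?w * (2 * (\<Sum>u\<in>V. \<Sum>v\<in>V - component F u. ?a v)) \<le> 2 * ?w * (2 * (real (card V) * ?Q))"
    using w by simp
  with eq show ?thesis by (simp add: algebra_simps)
qed

definition total_square :: "nat set \<Rightarrow> nat \<Rightarrow> real" where
  "total_square V k = (\<Sum>F\<in>forests V k. forest_weight V F * square_weight V F)"

lemma total_square_Suc:
  assumes V: "finite V" and k: "k \<le> card V"
  shows "real (card V - k) * total_square V k \<le> real (card V) * (real k + 2) * total_square V (Suc k)"
proof -
  have "real (card V - k) * total_square V k = (\<Sum>F\<in>forests V k. \<Sum>e\<in>F. forest_weight V F * square_weight V F)"
    unfolding total_square_def sum_distrib_left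
    by (rule sum.cong) (use card_forests[OF V] in force)+
  also have "\<dots> = (\<Sum>F\<in>forests V (Suc k). \<Sum>e\<in>joining V F. forest_weight V (insert e F) * square_weight V (insert e F))"
    by (rule sum_edge_removal[OF V])
  also have "\<dots> \<le> (\<Sum>F\<in>forests V (Suc k). real (card V) * (real k + 2) * (forest_weight V F * square_weight V F))"
    by (rule sum_mono) (rule sum_square_weight_joining[OF V])
  finally show ?thesis by (simp add: total_square_def sum_distrib_left)
qed

text \<open>Relative to the total weight, each step costs a factor \<open>(k + 2) / k\<close>. The
  product of these factors from \<open>k\<close> to \<open>N - 1\<close> telescopes to
  \<open>N * (N + 1) / (k * (k + 1))\<close>, and the edgeless forest has sum of squares
  \<open>N\<close>.\<close>

lemma total_square_le:
  assumes V: "finite V" and k: "0 < k" "k \<le> card V"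
  shows "total_square V k \<le> rooted_forests (card V) k * (real (card V) * (real (card V) * (real (card V) + 1)) / (real k * (real k + 1)))"
  using k(2,1)
proof (induction k rule: inc_induct)
  case base
  have "forest_weight V {} = 1" by (simp add: forest_weight_def trees_empty[OF V] prod.reindex)
  moreover have "square_weight V {} = card V" by (simp add: square_weight_def trees_empty[OF V] sum.reindex)
  ultimately show ?case using base by (simp add: total_square_def forests_card[OF V] rooted_forests_def)
next
  case (step k)
  let ?N = "real (card V)" and ?k = "real k"
  have k: "?k > 0" "card V > 0" "?N > 0" using step by auto
  have "real (card V - k) * total_square V k \<le> ?N * (?k + 2) * total_square V (Suc k)"
    using step by (intro total_square_Suc[OF V]) auto
  also have "\<dots> \<le> ?N * (?k + 2) * (rooted_forests (card V) (Suc k) * (?N * (?N * (?N + 1)) / ((?k + 1) * (?k + 2))))"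
    using step.IH by (intro mult_left_mono) (auto simp: algebra_simps)
  also have "\<dots> = (?N * ?k * rooted_forests (card V) (Suc k)) * (?N * (?N * (?N + 1)) / (?k * (?k + 1)))"
    using k by (simp add: divide_simps)
  also have "?N * ?k * rooted_forests (card V) (Suc k) = real (card V - k) * rooted_forests (card V) k"
    using rooted_forests_Suc[of k "card V"] step by simp
  finally have "real (card V - k) * total_square V k \<le> real (card V - k) *
    (rooted_forests (card V) k * (?N * (?N * (?N + 1)) / (?k * (?k + 1))))" by (simp only: mult.assoc)
  moreover have "0 < real (card V - k)" using step by simp
  ultimately show ?case using mult_le_cancel_left_pos by blast
qed

lemma burn_mean_le:
  assumes k: "0 < k" "k < N"
  shows "(\<Sum>s\<le>N. burn_prob N k s * real s) \<le> 2 * (real N)\<^sup>2 / (real k)\<^sup>2"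
proof -
  define V where "V = {..<N}"
  have V: "finite V" "card V = N" by (auto simp: V_def)
  let ?W = "rooted_forests N k" and ?N = "real N" and ?k = "real k"
  have W: "?W > 0" using rooted_forests_pos k by simp
  have "(\<Sum>F\<in>forests V k. forest_weight V F * (\<Sum>e\<in>F. real (card (tree_of_edge F e)))) =
      real (N - k) * ?W * (\<Sum>s\<le>N. burn_prob N k s * real s)"
    unfolding V(2)[symmetric]
  proof (rule sum_burn_weight[OF V(1)])
    fix S assume "S \<subseteq> V"
    then show "(\<Sum>G\<in>forests (V - S) (k - 1). forest_weight (V - S) G * real (card S)) =
        rooted_forests (card V - card S) (k - 1) * real (card S)"
      using total_weight_eq[of "V - S" "k - 1"] V(1)
      by (simp add: total_weight_def card_Diff_finite sum_distrib_right[symmetric])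
  qed (use assms V in auto)
  moreover have "(\<Sum>F\<in>forests V k. forest_weight V F * (\<Sum>e\<in>F. real (card (tree_of_edge F e)))) =
      total_square V k - ?N * ?W"
  proof -
    have "(\<Sum>e\<in>F. real (card (tree_of_edge F e))) = square_weight V F - ?N" if F: "F \<in> forests V k" for F
    proof -
      have FV: "F \<subseteq> edges_on V" using F by (simp add: forests_def)
      have "(\<Sum>e\<in>F. real (card (tree_of_edge F e))) = (\<Sum>S\<in>trees V F. real (card S - 1) * real (card S))"
        by (rule sum_edges_by_tree[OF V(1) F])
      also have "\<dots> = (\<Sum>S\<in>trees V F. (real (card S))\<^sup>2 - real (card S) * 1)"
      proof (rule sum.cong[OF refl])
        fix S assume "S \<in> trees V F"
        then have "card S > 0" using component_card_pos[OF V(1) FV] by (auto simp: trees_def)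
        then show "real (card S - 1) * real (card S) = (real (card S))\<^sup>2 - real (card S) * 1"
          by (simp add: of_nat_diff power2_eq_square algebra_simps)
      qed
      also have "\<dots> = square_weight V F - (\<Sum>S\<in>trees V F. real (card S) * 1)"
        by (simp add: sum_subtractf square_weight_def)
      also have "(\<Sum>S\<in>trees V F. real (card S) * 1) = (\<Sum>v\<in>V. 1)"
        by (rule sum_by_component[OF V(1) FV, symmetric])
      finally show ?thesis using V by simp
    qed
    then have "(\<Sum>F\<in>forests V k. forest_weight V F * (\<Sum>e\<in>F. real (card (tree_of_edge F e)))) =
        (\<Sum>F\<in>forests V k. forest_weight V F * square_weight V F - forest_weight V F * ?N)"
      by (intro sum.cong) (auto simp: right_diff_distrib)
    then show ?thesis using total_weight_eq[OF V(1), of k] V(2)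
      by (simp add: sum_subtractf total_square_def total_weight_def sum_distrib_right[symmetric])
  qed
  moreover have "total_square V k \<le> ?W * (?N * (?N * (?N + 1)) / (?k * (?k + 1)))"
    using total_square_le[OF V(1) k(1)] k V(2) by simp
  ultimately have "?W * ((?N - ?k) * (\<Sum>s\<le>N. burn_prob N k s * real s)) \<le>
      ?W * (?N * (?N * (?N + 1)) / (?k * (?k + 1)) - ?N)"
    using k by (simp add: of_nat_diff algebra_simps)
  then have "(?N - ?k) * (\<Sum>s\<le>N. burn_prob N k s * real s) \<le> ?N * (?N * (?N + 1)) / (?k * (?k + 1)) - ?N"
    using W by simp
  \<comment> \<open>Subtracting \<open>N\<close> makes the factor \<open>N - k\<close> appear, which
    cancels the number of edges; without it the bound would blow up as \<open>k\<close> approaches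
    \<open>N\<close>.\<close>
  also have "\<dots> = (?N - ?k) * (?N * (?N + ?k + 1) / (?k * (?k + 1)))"
    using k by (simp add: divide_simps) (simp add: algebra_simps)
  finally have "(\<Sum>s\<le>N. burn_prob N k s * real s) \<le> ?N * (?N + ?k + 1) / (?k * (?k + 1))"
    by (rule mult_left_le_imp_le) (use k in simp)
  also have "\<dots> \<le> ?N * (2 * ?N) / (?k * ?k)"
    using k by (intro frac_le mult_left_mono) (auto simp: of_nat_less_iff)
  finally show ?thesis by (simp add: power2_eq_square mult_ac)
qed

section \<open>The law of the burnt sizes\<close>

text \<open>A walk is shortened while it grows: if the next vertex was visited before, the path is
  cut at that visit.\<close>

lemma component_path:
  assumes "v \<in> component F u"
  shows "\<exists>vs. vs \<noteq> [] \<and> distinct vs \<and> hd vs = u \<and> last vs = v \<and>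
    (\<forall>i. Suc i < length vs \<longrightarrow> {vs ! i, vs ! Suc i} \<in> F)"
proof -
  have "(u, v) \<in> (adj F)\<^sup>*" using assms by (simp add: component_def)
  then show ?thesis
  proof (induction rule: rtrancl_induct)
    case base
    show ?case by (rule exI[of _ "[u]"]) simp
  next
    case (step v w)
    then obtain vs where vs: "vs \<noteq> []" "distinct vs" "hd vs = u" "last vs = v"
      "\<And>i. Suc i < length vs \<Longrightarrow> {vs ! i, vs ! Suc i} \<in> F" by blast
    show ?case
    proof (cases "w \<in> set vs")
      case True
      then obtain xs ys where xy: "vs = xs @ w # ys" by (auto simp: in_set_conv_decomp)
      have "{(xs @ [w]) ! i, (xs @ [w]) ! Suc i} \<in> F" if "Suc i < length (xs @ [w])" for i
      proof -
        have "(xs @ [w]) ! i = vs ! i" "(xs @ [w]) ! Suc i = vs ! Suc i"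
          using that by (auto simp: xy nth_append)
        then show ?thesis using vs(5)[of i] that by (simp add: xy)
      qed
      then show ?thesis using vs(1-3) by (intro exI[of _ "xs @ [w]"]) (auto simp: xy hd_append)
    next
      case False
      have "{(vs @ [w]) ! i, (vs @ [w]) ! Suc i} \<in> F" if "Suc i < length (vs @ [w])" for i
      proof (cases "Suc i < length vs")
        case True
        then show ?thesis using vs(5)[of i] by (simp add: nth_append)
      next
        case False
        then have i: "i = length vs - 1" "i < length vs" using that vs(1) by auto
        then have "vs ! i = v" using vs(1,4) by (simp add: last_conv_nth)
        then show ?thesis using i step(2) by (auto simp: nth_append adj_def)
      qed
      then show ?thesis using vs(1-3) False by (intro exI[of _ "vs @ [w]"]) auto
    qed
  qed
qed

text \<open>If an edge is not a bridge, a path between its ends that avoids it is closed by it to a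
  cycle. Conversely, the edge closing a cycle is not a bridge.\<close>

lemma forest_iff_acyclic:
  assumes E: "E \<subseteq> edges_on V"
  shows "forest E \<longleftrightarrow> (\<nexists>vs. is_cycle E vs)"
proof
  assume "\<nexists>vs. is_cycle E vs"
  show "forest E"
    unfolding forest_def
  proof (intro allI impI notI)
    fix u v assume uv: "{u, v} \<in> E" "v \<in> component (E - {{u, v}}) u"
    from component_path[OF uv(2)] obtain vs where vs: "vs \<noteq> []" "distinct vs" "hd vs = u" "last vs = v"
      "\<And>i. Suc i < length vs \<Longrightarrow> {vs ! i, vs ! Suc i} \<in> E - {{u, v}}" by blast
    have ends: "vs ! 0 = u" "vs ! (length vs - 1) = v"
      using vs(1,3,4) by (auto simp: hd_conv_nth last_conv_nth)
    have "u \<noteq> v" using uv(1) E by (auto simp: edges_on_def)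
    then have "length vs \<noteq> 1" using ends by auto
    moreover have "length vs \<noteq> 2" using vs(5)[of 0] ends by auto
    ultimately have len: "length vs \<ge> 3" using vs(1) by (cases vs; cases "tl vs"; cases "tl (tl vs)") auto
    have "{vs ! i, vs ! (Suc i mod length vs)} \<in> E" if "i < length vs" for i
    proof (cases "Suc i < length vs")
      case True
      then show ?thesis using vs(5)[of i] by simp
    next
      case False
      then have "i = length vs - 1" "Suc i = length vs" using that by auto
      then show ?thesis using ends uv(1) by (simp add: insert_commute)
    qed
    then have "is_cycle E vs" using len vs(2) by (simp add: is_cycle_def)
    then show False using \<open>\<nexists>vs. is_cycle E vs\<close> by blast
  qed
next
  assume forest: "forest E"
  show "\<nexists>vs. is_cycle E vs"
  proof
    assume "\<exists>vs. is_cycle E vs"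
    then obtain vs where len: "length vs \<ge> 3" and dist: "distinct vs"
      and cyc: "\<And>i. i < length vs \<Longrightarrow> {vs ! i, vs ! (Suc i mod length vs)} \<in> E"
      by (auto simp: is_cycle_def)
    define m where "m = length vs - 1"
    have m: "Suc m = length vs" "2 \<le> m" using len by (auto simp: m_def)
    have nonempty: "vs \<noteq> []" using len by auto
    let ?e = "{vs ! m, vs ! 0}"
    have e: "?e \<in> E" using cyc[of m] m by simp
    have "vs ! i \<in> component (E - {?e}) (vs ! 0)" if "i \<le> m" for i
      using that
    proof (induction i)
      case (Suc i)
      have "{vs ! i, vs ! Suc i} \<in> E" using cyc[of i] Suc m by simp
      \<comment> \<open>Here the length of at least 3 enters: for two vertices the closing edge
        would coincide with the edge of the path.\<close>
      moreover have "{vs ! i, vs ! Suc i} \<noteq> ?e"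
        using nth_eq_iff_index_eq[OF dist, of i m] nth_eq_iff_index_eq[OF dist, of i 0]
          nth_eq_iff_index_eq[OF dist, of "Suc i" m] m Suc.prems nonempty
          by (cases i) (auto simp: doubleton_eq_iff)
      ultimately have "vs ! Suc i \<in> component (E - {?e}) (vs ! i)" by (intro component_edge) simp
      then show ?case using Suc component_eq by (metis Suc_leD)
    qed simp
    from this[of m] have "vs ! m \<in> component (E - {{vs ! 0, vs ! m}}) (vs ! 0)" by (simp add: insert_commute)
    then show False using forest_remove[OF forest, of "vs ! 0" "vs ! m"] e by (simp add: insert_commute)
  qed
qed

text \<open>The condition \<open>1 \<le> n\<close> excludes the empty vertex set, on which the empty
  graph is connected but has no component.\<close>

lemma cayley_trees_eq:
  assumes "1 \<le> n"
  shows "cayley_trees n = forests {1..n} 1"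
proof -
  have "(\<forall>u\<in>{1..n}. \<forall>v\<in>{1..n}. (u, v) \<in> (adj E)\<^sup>*) \<longleftrightarrow> card (trees {1..n} E) = 1"
    if "E \<subseteq> edges_on {1..n}" for E
  proof
    assume conn: "\<forall>u\<in>{1..n}. \<forall>v\<in>{1..n}. (u, v) \<in> (adj E)\<^sup>*"
    have "component E v = component E 1" if "v \<in> {1..n}" for v
      using conn that assms by (intro component_eq) (auto simp: component_def)
    then have "trees {1..n} E = (\<lambda>_. component E 1) ` {1..n}" unfolding trees_def by (rule image_cong[OF refl])
    also have "\<dots> = {component E 1}" using assms by auto
    finally have "trees {1..n} E = {component E 1}" .
    then show "card (trees {1..n} E) = 1" by simp
  next
    assume "card (trees {1..n} E) = 1"
    then obtain C where "trees {1..n} E = {C}" by (auto simp: card_1_singleton_iff)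
    then have "component E u = component E v" if "u \<in> {1..n}" "v \<in> {1..n}" for u v
      using that unfolding trees_def by blast
    then show "\<forall>u\<in>{1..n}. \<forall>v\<in>{1..n}. (u, v) \<in> (adj E)\<^sup>*"
      using component_refl by (force simp: component_def)
  qed
  then show ?thesis
    using forest_iff_acyclic[of _ "{1..n}"] unfolding cayley_trees_def forests_def edges_on_def by blast
qed

lemma edge_in_component:
  assumes "f \<in> F" "F \<subseteq> edges_on V" "finite V" "x \<in> f"
  shows "f \<subseteq> component F x"
proof -
  obtain a b where "f = {a, b}" using assms edges_on_cases[of V f] by blast
  then show ?thesis using assms component_edge[of a b F] component_edge[of b a F] by (auto simp: insert_commute)
qed

section \<open>The dynamics as a recursion on flammable edges\<close>

text \<open>The state is reduced to the flammable edges: fireproofing deletes one edge, a fire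
  deletes the edges of one tree and outputs its size at once. Burnt vertices stay as isolated ones,
  where no later fire starts.\<close>

fun burn_sizes :: "real \<Rightarrow> nat set set \<Rightarrow> nat set list \<Rightarrow> nat list pmf" where
  "burn_sizes p F [] = return_pmf []"
| "burn_sizes p F (e # es) = (if e \<notin> F then burn_sizes p F es else
     bind_pmf (bernoulli_pmf p) (\<lambda>fire.
       if fire then map_pmf ((#) (card (tree_of_edge F e))) (burn_sizes p (F - Pow (tree_of_edge F e)) es)
       else burn_sizes p (F - {e}) es))"

text \<open>Spreading from edge to edge through common vertices reaches the same edges as walking
  from vertex to vertex.\<close>

lemma neighbouring_closure:
  assumes V: "finite V" and L: "L \<subseteq> edges_on V" and e: "e \<in> L"
  shows "(neighbouring L)\<^sup>* `` {e} = L \<inter> Pow (tree_of_edge L e)"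
proof (intro equalityI subsetI)
  obtain u where u: "u \<in> e" "u \<in> V" using e L edges_on_cases[OF V, of e] by blast
  have tree: "tree_of_edge L e = component L u" by (rule tree_of_edge_eq[OF e L V u(1)])
  have edge: "f \<subseteq> component L x" if "f \<in> L" "x \<in> f" for f x
    by (rule edge_in_component[OF that(1) L V that(2)])
  {
    fix f assume "f \<in> (neighbouring L)\<^sup>* `` {e}"
    then have "(e, f) \<in> (neighbouring L)\<^sup>*" by simp
    then show "f \<in> L \<inter> Pow (tree_of_edge L e)"
    proof (induction rule: rtrancl_induct)
      case base
      show ?case using e edge[OF e u(1)] tree by simp
    next
      case (step y z)
      then obtain w where w: "w \<in> y" "w \<in> z" "z \<in> L" by (auto simp: neighbouring_def)
      then have "w \<in> component L u" using step.IH tree by auto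
      then show ?case using edge[OF w(3,2)] w component_eq tree by simp
    qed
  next
    fix f assume f: "f \<in> L \<inter> Pow (tree_of_edge L e)"
    then obtain x where x: "x \<in> f" using L edges_on_cases[OF V, of f] by blast
    then have "(u, x) \<in> (adj L)\<^sup>*" using f tree by (auto simp: component_def)
    then have "\<forall>g\<in>L. x \<in> g \<longrightarrow> (e, g) \<in> (neighbouring L)\<^sup>*"
    proof (induction rule: rtrancl_induct)
      case base
      show ?case using e u(1) by (auto simp: neighbouring_def)
    next
      case (step y z)
      have "{y, z} \<in> L" using step by (simp add: adj_def)
      then have yz: "(e, {y, z}) \<in> (neighbouring L)\<^sup>*" using step by simp
      show ?case
      proof (intro ballI impI)
        fix g assume "g \<in> L" "z \<in> g"
        then have "({y, z}, g) \<in> neighbouring L" using \<open>{y, z} \<in> L\<close> by (auto simp: neighbouring_def)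
        with yz show "(e, g) \<in> (neighbouring L)\<^sup>*" by auto
      qed
    qed
    then show "f \<in> (neighbouring L)\<^sup>* `` {e}" using f x by auto
  }
qed

lemma component_separate:
  assumes "F \<subseteq> edges_on V" "G \<subseteq> edges_on V" "\<And>f g. f \<in> F \<Longrightarrow> g \<in> G \<Longrightarrow> f \<inter> g = {}" "f \<in> F" "v \<in> f"
  shows "component (F \<union> G) v = component F v"
proof (rule component_Un)
  show "F \<subseteq> edges_on (\<Union>F)" "G \<subseteq> edges_on (\<Union>G)" using assms by (auto simp: edges_on_def)
  show "\<Union>F \<inter> \<Union>G = {}" "v \<in> \<Union>F" using assms(3-5) by auto
qed

text \<open>Reads the sizes off the burnt edges only, so that it is meaningful in intermediate
  states; in \<open>burnt_subtrees\<close> the edges still flammable would count as remaining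
  ones.\<close>

definition burnt_sizes :: "fire_state \<Rightarrow> nat list" where
  "burnt_sizes s = map (\<lambda>i. card (tree_of_edge (burnt s) i)) (ignited s)"

text \<open>By the last clause of \<open>fire_invariant\<close>, burnt and flammable edges share no
  vertex. So a new fire leaves the earlier burnt trees unchanged, and its own burnt tree is its tree
  in the flammable forest.\<close>

lemma set_on_fire_sizes:
  assumes V: "finite V" and E: "E \<subseteq> edges_on V" and inv: "fire_invariant E s" and e: "e \<in> flammable E s"
  shows "burnt_sizes (set_on_fire E e s) = burnt_sizes s @ [card (tree_of_edge (flammable E s) e)]"
    and "flammable E (set_on_fire E e s) = flammable E s - Pow (tree_of_edge (flammable E s) e)"
proof -
  let ?L = "flammable E s" and ?B = "burnt s"
  let ?C = "?L \<inter> Pow (tree_of_edge ?L e)"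
  have L: "?L \<subseteq> edges_on V" using E by (auto simp: flammable_def)
  have B: "?B \<subseteq> edges_on V" using inv E by (auto simp: fire_invariant_def)
  have C: "(neighbouring ?L)\<^sup>* `` {e} = ?C" by (rule neighbouring_closure[OF V L e])
  have s': "burnt (set_on_fire E e s) = ?B \<union> ?C" "ignited (set_on_fire E e s) = ignited s @ [e]"
    "fireproof (set_on_fire E e s) = fireproof s"
    using C by (simp_all add: set_on_fire_def)
  show "flammable E (set_on_fire E e s) = ?L - Pow (tree_of_edge ?L e)"
    unfolding flammable_def s' by (auto simp: flammable_def)
  have sep: "b \<inter> f = {}" if "b \<in> ?B" "f \<in> ?L" for b f
    using inv that by (auto simp: fire_invariant_def)
  have old: "tree_of_edge (?B \<union> ?C) i = tree_of_edge ?B i" if "i \<in> set (ignited s)" for i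
  proof -
    have "i \<in> ?B" using inv that by (auto simp: fire_invariant_def)
    have CL: "?C \<subseteq> edges_on V" using L by auto
    have "component (?B \<union> ?C) v = component ?B v" if "v \<in> i" for v
      by (rule component_separate[OF B CL _ \<open>i \<in> ?B\<close> that]) (use sep in blast)
    then show ?thesis unfolding tree_of_edge_def[of _ i] by (intro SUP_cong refl)
  qed
  have new: "tree_of_edge (?B \<union> ?C) e = tree_of_edge ?L e"
  proof -
    have "component (?C \<union> ?B) v = component ?L v" if "v \<in> e" for v
    proof -
      have tree: "tree_of_edge ?L e = component ?L v" by (rule tree_of_edge_eq[OF e L V that])
      have eC: "e \<in> ?C" using C by auto
      have dis: "f \<inter> g = {}" if "f \<in> ?C" "g \<in> ?L - ?C" for f g
      proof (rule ccontr)
        assume "f \<inter> g \<noteq> {}"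
        then obtain w where w: "w \<in> f" "w \<in> g" by auto
        then have "w \<in> component ?L v" using that tree by auto
        moreover have "g \<subseteq> component ?L w"
          using edge_in_component[of g ?L V w] that L V w by auto
        ultimately show False using that tree component_eq[of w ?L v] by auto
      qed
      have CL: "?C \<subseteq> edges_on V" "?L - ?C \<subseteq> edges_on V" using L by auto
      have "component (?C \<union> ?B) v = component ?C v"
        by (rule component_separate[OF CL(1) B _ eC that]) (use sep in blast)
      also have "\<dots> = component (?C \<union> (?L - ?C)) v"
        by (rule component_separate[OF CL dis eC that, symmetric])
      also have "?C \<union> (?L - ?C) = ?L" by auto
      finally show ?thesis .
    qed
    then show ?thesis unfolding tree_of_edge_def by (simp add: Un_commute)
  qed
  show "burnt_sizes (set_on_fire E e s) = burnt_sizes s @ [card (tree_of_edge ?L e)]"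
    unfolding burnt_sizes_def s' using old new by simp
qed

text \<open>An edge still to be examined is flammable or burnt, hence both recursions skip the same
  edges; the sizes already burnt form a prefix of the result.\<close>

lemma fire_dynamics_sizes:
  assumes V: "finite V" and "E \<subseteq> edges_on V" "fire_invariant E s" "distinct es"
    "set es \<subseteq> E" "flammable E s \<subseteq> set es" "set es \<inter> fireproof s = {}"
  shows "map_pmf burnt_sizes (fire_dynamics p E es s) = map_pmf ((@) (burnt_sizes s)) (burn_sizes p (flammable E s) es)"
  using assms(2-)
proof (induction es arbitrary: s)
  case Nil
  then show ?case by simp
next
  case (Cons e es)
  let ?L = "flammable E s"
  show ?case
  proof (cases "e \<in> burnt s")
    case True
    then have "?L \<subseteq> set es" "e \<notin> ?L" using Cons.prems(5) by (auto simp: flammable_def)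
    then show ?thesis using Cons True by simp
  next
    case False
    with Cons.prems have e: "e \<in> ?L" by (auto simp: flammable_def)
    let ?f = "set_on_fire E e s" and ?m = "make_fireproof e s"
    let ?T = "tree_of_edge ?L e"
    have inv: "fire_invariant E ?f" "fire_invariant E ?m"
      using fire_invariant_set_on_fire fire_invariant_make_fireproof Cons.prems(2) e by auto
    have fl: "flammable E ?f = ?L - Pow ?T" "flammable E ?m = ?L - {e}"
      using set_on_fire_sizes(2)[OF V Cons.prems(1,2) e] by (auto simp: flammable_def make_fireproof_def)
    have sz: "burnt_sizes ?f = burnt_sizes s @ [card ?T]" "burnt_sizes ?m = burnt_sizes s"
      using set_on_fire_sizes(1)[OF V Cons.prems(1,2) e] by (auto simp: burnt_sizes_def make_fireproof_def)
    have eT: "e \<subseteq> ?T" by (auto simp: tree_of_edge_def)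
    have fp: "fireproof ?f = fireproof s" "fireproof ?m = insert e (fireproof s)"
      by (auto simp: set_on_fire_def make_fireproof_def)
    have es: "distinct es" "e \<notin> set es" "set es \<subseteq> E" "?L \<subseteq> insert e (set es)"
      "set es \<inter> fireproof s = {}" using Cons.prems by auto
    have 1: "map_pmf burnt_sizes (fire_dynamics p E es ?f) = map_pmf ((@) (burnt_sizes ?f)) (burn_sizes p (?L - Pow ?T) es)"
      unfolding fl[symmetric] using es eT
      by (intro Cons.IH Cons.prems(1) inv) (auto simp: fl fp)
    have 2: "map_pmf burnt_sizes (fire_dynamics p E es ?m) = map_pmf ((@) (burnt_sizes ?m)) (burn_sizes p (?L - {e}) es)"
      unfolding fl[symmetric] using es
      by (intro Cons.IH Cons.prems(1) inv) (auto simp: fl fp)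
    have app: "(@) (burnt_sizes s @ [c]) = (\<lambda>x. burnt_sizes s @ c # x)" for c by auto
    show ?thesis
      using False e 1 2
      by (auto simp: app map_bind_pmf sz map_pmf_comp if_distrib[of "fire_dynamics p E es"] o_def intro!: bind_pmf_cong)
  qed
qed


text \<open>At the end, an edge is burnt or fireproof, and a fireproof edge with a burnt end is
  discarded. So all remaining edges at a burnt vertex are burnt.\<close>

lemma burnt_subtrees_sizes:
  assumes E: "E \<subseteq> edges_on V" and inv: "fire_invariant E s" and fl: "flammable E s = {}"
  shows "map card (burnt_subtrees E s) = burnt_sizes s"
proof -
  let ?B = "burnt s" and ?R = "remaining_edges E s"
  have B: "?B \<subseteq> E" "fireproof s \<inter> ?B = {}" "set (ignited s) \<subseteq> ?B"
    using inv by (auto simp: fire_invariant_def)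
  have EB: "E - fireproof s = ?B" using fl B by (auto simp: flammable_def)
  have burnt_vertex: "\<not> fireproof_vertex E s v" if "b \<in> ?B" "v \<in> b" for b v
    using EB that by (auto simp: fireproof_vertex_def)
  have BR: "?B \<subseteq> ?R" "?R \<subseteq> edges_on V" using B E by (auto simp: remaining_edges_def)
  have RB: "f \<in> ?B" if "f \<in> ?R" "v \<in> f" "b \<in> ?B" "v \<in> b" for f v b
    using that EB burnt_vertex by (auto simp: remaining_edges_def)
  have "component ?R v = component ?B v" if "i \<in> ?B" "v \<in> i" for i v
  proof -
    have "component (?B \<union> (?R - ?B)) v = component ?B v"
      by (rule component_separate[of ?B V "?R - ?B", OF _ _ _ that]) (use BR RB in blast)+
    moreover have "?B \<union> (?R - ?B) = ?R" using BR by auto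
    ultimately show ?thesis by simp
  qed
  then have "(adj ?R)\<^sup>* `` i = tree_of_edge ?B i" if "i \<in> ?B" for i
    using that by (auto simp: tree_of_edge_def component_def)
  then show ?thesis using B(3) by (auto simp: burnt_subtrees_def burnt_sizes_def)
qed

lemma burnt_subtree_sizes_eq:
  assumes "1 \<le> n"
  shows "burnt_subtree_sizes n p = bind_pmf (pmf_of_set (forests {1..n} 1))
    (\<lambda>E. bind_pmf (pmf_of_set (permutations_of_set E)) (burn_sizes p E))"
  unfolding burnt_subtree_sizes_def cayley_trees_eq[OF assms]
proof (intro bind_pmf_cong refl)
  fix E es assume E: "E \<in> set_pmf (pmf_of_set (forests {1..n} 1))"
    and es: "es \<in> set_pmf (pmf_of_set (permutations_of_set E))"
  have "E \<in> forests {1..n} 1"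
    using E set_pmf_of_set[of "forests {1..n} 1"] finite_forests[of "{1..n}" 1]
      cayley_trees_nonempty[of n] cayley_trees_eq[OF assms] by auto
  then have EV: "E \<subseteq> edges_on {1..n}" by (simp add: forests_def)
  then have "finite E" using finite_edges_on finite_subset by blast
  then have "es \<in> permutations_of_set E" using es by simp
  then have es: "set es = E" "distinct es" by (auto dest: permutations_of_setD)
  have init: "flammable E initial_state = E" "fireproof initial_state = {}" "burnt_sizes initial_state = []"
    by (auto simp: flammable_def initial_state_def burnt_sizes_def)
  have "map_pmf (\<lambda>s. map card (burnt_subtrees E s)) (fire_dynamics p E es initial_state) =
      map_pmf burnt_sizes (fire_dynamics p E es initial_state)"
  proof (rule map_pmf_cong[OF refl])
    fix s assume "s \<in> set_pmf (fire_dynamics p E es initial_state)"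
    from fire_dynamics_final[OF this fire_invariant_initial] es init
    have "fire_invariant E s" "flammable E s = {}" by auto
    then show "map card (burnt_subtrees E s) = burnt_sizes s" by (rule burnt_subtrees_sizes[OF EV])
  qed
  also have "\<dots> = map_pmf ((@) (burnt_sizes initial_state)) (burn_sizes p (flammable E initial_state) es)"
    by (rule fire_dynamics_sizes[OF finite_atLeastAtMost EV fire_invariant_initial]) (use es init in auto)
  also have "\<dots> = burn_sizes p E es"
  proof -
    have "(@) [] = (\<lambda>x :: nat list. x)" by auto
    then show ?thesis by (simp add: init)
  qed
  finally show "map_pmf (\<lambda>s. map card (burnt_subtrees E s)) (fire_dynamics p E es initial_state) = burn_sizes p E es" .
qed

section \<open>Averaging over the order of the edges\<close>

text \<open>\<open>A\<close> holds the edges not yet examined and \<open>F\<close> the flammable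
  ones. They are kept apart because edges burnt by propagation still occupy places in the random
  order.\<close>

definition burn_sizes_pmf :: "real \<Rightarrow> nat set set \<Rightarrow> nat set set \<Rightarrow> nat list \<Rightarrow> real" where
  "burn_sizes_pmf p A F xs = pmf (bind_pmf (pmf_of_set (permutations_of_set A)) (burn_sizes p F)) xs"

context
  fixes p :: real
  assumes p: "0 \<le> p" "p \<le> 1"
begin

lemma pmf_bernoulli_bind:
  "pmf (bind_pmf (bernoulli_pmf p) f) x = p * pmf (f True) x + (1 - p) * pmf (f False) x"
  using p by (simp add: pmf_bind)

lemma pmf_map_Cons: "pmf (map_pmf ((#) c) P) xs = (case xs of [] \<Rightarrow> 0 | s # ys \<Rightarrow> of_bool (s = c) * pmf P ys)"
proof (cases xs)
  case Nil
  then have "xs \<notin> set_pmf (map_pmf ((#) c) P)" by auto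
  then have "pmf (map_pmf ((#) c) P) xs = 0" by (simp only: set_pmf_iff not_not)
  then show ?thesis using Nil by simp
next
  case (Cons s ys)
  show ?thesis
  proof (cases "s = c")
    case True
    then show ?thesis using Cons pmf_map_inj'[of "(#) c" P ys] by simp
  next
    case False
    then have "xs \<notin> set_pmf (map_pmf ((#) c) P)" using Cons by auto
    then have "pmf (map_pmf ((#) c) P) xs = 0" by (simp only: set_pmf_iff not_not)
    then show ?thesis using Cons False by simp
  qed
qed

lemma bind_map_Cons: "bind_pmf M (\<lambda>es. map_pmf ((#) c) (f es)) = map_pmf ((#) c) (bind_pmf M f)"
  by (simp add: map_bind_pmf)

definition step_pmf :: "(nat set set \<Rightarrow> nat list \<Rightarrow> real) \<Rightarrow> nat set set \<Rightarrow> nat list \<Rightarrow> nat set \<Rightarrow> real" where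
  "step_pmf R F xs e = p * (case xs of [] \<Rightarrow> 0 | s # ys \<Rightarrow> of_bool (s = card (tree_of_edge F e)) * R (F - Pow (tree_of_edge F e)) ys)
     + (1 - p) * R (F - {e}) xs"

lemma burn_sizes_pmf_step:
  assumes A: "finite A" "A \<noteq> {}"
  shows "burn_sizes_pmf p A F xs = (\<Sum>e\<in>A. if e \<in> F then step_pmf (burn_sizes_pmf p (A - {e})) F xs e
      else burn_sizes_pmf p (A - {e}) F xs) / card A"
proof -
  have body: "pmf (bind_pmf (pmf_of_set (permutations_of_set (A - {e}))) (\<lambda>es. burn_sizes p F (e # es))) xs =
      (if e \<in> F then step_pmf (burn_sizes_pmf p (A - {e})) F xs e else burn_sizes_pmf p (A - {e}) F xs)" for e
  proof (cases "e \<in> F")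
    case True
    let ?M = "pmf_of_set (permutations_of_set (A - {e}))" and ?T = "tree_of_edge F e"
    have "bind_pmf ?M (\<lambda>es. burn_sizes p F (e # es)) = bind_pmf ?M (\<lambda>es. bind_pmf (bernoulli_pmf p) (\<lambda>fire.
       if fire then map_pmf ((#) (card ?T)) (burn_sizes p (F - Pow ?T) es) else burn_sizes p (F - {e}) es))"
      using True by simp
    also have "\<dots> = bind_pmf (bernoulli_pmf p) (\<lambda>fire. bind_pmf ?M (\<lambda>es.
       if fire then map_pmf ((#) (card ?T)) (burn_sizes p (F - Pow ?T) es) else burn_sizes p (F - {e}) es))"
      by (rule bind_commute_pmf)
    also have "pmf \<dots> xs = p * pmf (map_pmf ((#) (card ?T)) (bind_pmf ?M (burn_sizes p (F - Pow ?T)))) xs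
        + (1 - p) * pmf (bind_pmf ?M (burn_sizes p (F - {e}))) xs"
      by (simp add: pmf_bernoulli_bind bind_map_Cons)
    finally show ?thesis using True
      by (cases xs) (simp_all add: step_pmf_def pmf_map_Cons burn_sizes_pmf_def)
  qed (simp add: burn_sizes_pmf_def)
  have "burn_sizes_pmf p A F xs = pmf (bind_pmf (pmf_of_set A)
      (\<lambda>e. bind_pmf (pmf_of_set (permutations_of_set (A - {e}))) (\<lambda>es. burn_sizes p F (e # es)))) xs"
    unfolding burn_sizes_pmf_def random_permutation_of_set[OF A] by (simp add: bind_assoc_pmf bind_return_pmf)
  also have "\<dots> = (\<Sum>e\<in>A. pmf (bind_pmf (pmf_of_set (permutations_of_set (A - {e}))) (\<lambda>es. burn_sizes p F (e # es))) xs) / card A"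
    by (rule pmf_bind_pmf_of_set[OF A(2,1)])
  finally show ?thesis unfolding body .
qed

lemma burn_sizes_pmf_empty: "finite A \<Longrightarrow> burn_sizes_pmf p A {} xs = of_bool (xs = [])"
proof -
  have "burn_sizes p {} es = return_pmf []" for es by (induction es) auto
  then have "burn_sizes p {} = (\<lambda>_. return_pmf [])" by blast
  then show ?thesis by (simp add: burn_sizes_pmf_def indicator_def)
qed

text \<open>Deleting the edges that are skipped from a uniform order leaves a uniform order.\<close>

lemma burn_sizes_pmf_superset:
  assumes "finite A" "F \<subseteq> A"
  shows "burn_sizes_pmf p A F xs = burn_sizes_pmf p F F xs"
  using assms
proof (induction "card A" arbitrary: A F xs rule: less_induct)
  case less
  show ?case
  proof (cases "F = {}")
    case True
    then show ?thesis using less.prems by (simp add: burn_sizes_pmf_empty)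
  next
    case False
    have finF: "finite F" using less.prems finite_subset by blast
    have A: "A \<noteq> {}" using False less.prems by auto
    let ?R = "\<lambda>F. burn_sizes_pmf p F F"
    have smaller: "card (B - {e}) < card A" "finite (B - {e})" if "e \<in> B" "B \<subseteq> A" for e B
      using that less.prems(1) psubset_card_mono[of A "B - {e}"] finite_subset[of B A] by auto
    have step: "step_pmf (burn_sizes_pmf p (B - {e})) F xs e = step_pmf ?R F xs e"
      if e: "e \<in> F" and B: "F \<subseteq> B" "B \<subseteq> A" for e B
    proof -
      have eB: "e \<in> B" using e B by auto
      have "e \<in> Pow (tree_of_edge F e)" by (auto simp: tree_of_edge_def)
      then have sub: "F - Pow (tree_of_edge F e) \<subseteq> B - {e}" "F - {e} \<subseteq> B - {e}" using B by auto
      have "burn_sizes_pmf p (B - {e}) (F - Pow (tree_of_edge F e)) ys = ?R (F - Pow (tree_of_edge F e)) ys" for ys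
        by (rule less.hyps[OF smaller(1)[OF eB B(2)] smaller(2)[OF eB B(2)] sub(1)])
      moreover have "burn_sizes_pmf p (B - {e}) (F - {e}) ys = ?R (F - {e}) ys" for ys
        by (rule less.hyps[OF smaller(1)[OF eB B(2)] smaller(2)[OF eB B(2)] sub(2)])
      ultimately show ?thesis unfolding step_pmf_def by (auto split: list.split)
    qed
    have RF: "?R F xs = (\<Sum>e\<in>F. step_pmf ?R F xs e) / card F"
      unfolding burn_sizes_pmf_step[OF finF False, of F] using step less.prems by (simp cong: sum.cong)
    \<comment> \<open>A first edge in \<open>F\<close> acts as in an order of \<open>F\<close>
      alone, and any other first edge changes nothing. If \<open>v\<close> is the value for
      \<open>F\<close>, the average is
      \<open>(card F * v + (card A - card F) * v) / card A = v\<close>.\<close>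
    have "burn_sizes_pmf p A F xs = (\<Sum>e\<in>A. if e \<in> F then step_pmf ?R F xs e else ?R F xs) / card A"
    proof -
      have "burn_sizes_pmf p (A - {e}) F xs = ?R F xs" if "e \<in> A" "e \<notin> F" for e
        by (rule less.hyps[OF smaller(1)[OF that(1) order_refl] smaller(2)[OF that(1) order_refl]])
          (use that less.prems in auto)
      then show ?thesis
        unfolding burn_sizes_pmf_step[OF less.prems(1) A, of F] using step[OF _ less.prems(2) order_refl]
        by (intro arg_cong[where f = "\<lambda>x. x / card A"] sum.cong) auto
    qed
    also have "(\<Sum>e\<in>A. if e \<in> F then step_pmf ?R F xs e else ?R F xs) =
        (\<Sum>e\<in>F. step_pmf ?R F xs e) + (\<Sum>e\<in>A - F. ?R F xs)"
      using less.prems by (subst sum.If_cases) (auto simp: Int_absorb1 Diff_eq)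
    also have "(\<Sum>e\<in>F. step_pmf ?R F xs e) = card F * ?R F xs" using RF finF False by simp
    also have "(\<Sum>e\<in>A - F. ?R F xs) = (real (card A) - card F) * ?R F xs"
      using less.prems finF card_mono[OF less.prems] by (simp add: card_Diff_subset of_nat_diff)
    finally show ?thesis using A less.prems(1) by (simp add: algebra_simps add_divide_distrib[symmetric])
  qed
qed

abbreviation mean_pmf :: "nat set set \<Rightarrow> nat list \<Rightarrow> real" where
  "mean_pmf F \<equiv> burn_sizes_pmf p F F"

text \<open>The burnt edges waiting in the order can be forgotten after each step, so the next edge
  that matters is uniform in the current forest.\<close>

lemma mean_pmf_step:
  assumes "finite F" "F \<noteq> {}"
  shows "real (card F) * mean_pmf F xs = (\<Sum>e\<in>F. step_pmf mean_pmf F xs e)"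
proof -
  have "step_pmf (burn_sizes_pmf p (F - {e})) F xs e = step_pmf mean_pmf F xs e" if "e \<in> F" for e
  proof -
    have "e \<in> Pow (tree_of_edge F e)" by (auto simp: tree_of_edge_def)
    then have sub: "F - Pow (tree_of_edge F e) \<subseteq> F - {e}" by auto
    have fin: "finite (F - {e})" using assms by simp
    have "burn_sizes_pmf p (F - {e}) (F - Pow (tree_of_edge F e)) ys = mean_pmf (F - Pow (tree_of_edge F e)) ys" for ys
      by (rule burn_sizes_pmf_superset[OF fin sub])
    then show ?thesis unfolding step_pmf_def by (auto split: list.split)
  qed
  then show ?thesis
    using burn_sizes_pmf_step[OF assms, of F xs] assms by simp
qed

end

section \<open>The law of the burnt sizes as a Markov chain\<close>

text \<open>Here \<open>j\<close> is the number of trees when the next fire starts, after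
  \<open>j - k\<close> edges were made fireproof; the fire leads to \<open>N - s\<close> vertices
  and \<open>j - 1\<close> trees. The empty list means that all \<open>N - k\<close> remaining edges
  become fireproof.\<close>

fun burn_law :: "real \<Rightarrow> nat \<Rightarrow> nat \<Rightarrow> nat list \<Rightarrow> real" where
  "burn_law p N k [] = (1 - p) ^ (N - k)"
| "burn_law p N k (s # xs) =
     (\<Sum>j\<in>{k..<N}. (1 - p) ^ (j - k) * p * burn_prob N j s * burn_law p (N - s) (j - 1) xs)"

text \<open>The definition jumps from fire to fire, as the coupling does, whereas the dynamics on
  forests proceeds edge by edge; this translates between the two.\<close>

lemma burn_law_step:
  assumes "k < N"
  shows "burn_law p N k xs = (1 - p) * burn_law p N (Suc k) xs
    + p * (case xs of [] \<Rightarrow> 0 | s # ys \<Rightarrow> burn_prob N k s * burn_law p (N - s) (k - 1) ys)"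
proof (cases xs)
  case Nil
  then show ?thesis using assms by (simp add: Suc_diff_Suc power_Suc[symmetric] del: power_Suc)
next
  case (Cons s ys)
  have "(\<Sum>j\<in>{Suc k..<N}. (1 - p) ^ (j - k) * p * burn_prob N j s * burn_law p (N - s) (j - 1) ys) =
      (1 - p) * (\<Sum>j\<in>{Suc k..<N}. (1 - p) ^ (j - Suc k) * p * burn_prob N j s * burn_law p (N - s) (j - 1) ys)"
    unfolding sum_distrib_left
  proof (rule sum.cong[OF refl])
    fix j assume "j \<in> {Suc k..<N}"
    then have "j - k = Suc (j - Suc k)" by auto
    then show "(1 - p) ^ (j - k) * p * burn_prob N j s * burn_law p (N - s) (j - 1) ys =
        (1 - p) * ((1 - p) ^ (j - Suc k) * p * burn_prob N j s * burn_law p (N - s) (j - 1) ys)"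
      by simp
  qed
  then show ?thesis using assms Cons by (simp add: sum.atLeast_Suc_lessThan)
qed

text \<open>Both sides obey the same one-edge recursion: fireproofing by
  \<open>sum_forest_weight_joining\<close>, burning by \<open>sum_burn_weight\<close>. The induction
  is on the number \<open>card V - k\<close> of flammable edges, which falls by 1 in the first case
  and by \<open>s - 1\<close> in the second.\<close>

lemma sum_forests_burn_sizes:
  assumes p: "0 \<le> p" "p \<le> 1" and "finite V" "k \<le> card V" "k = 0 \<Longrightarrow> V = {}"
  shows "(\<Sum>F\<in>forests V k. forest_weight V F * burn_sizes_pmf p F F xs) = rooted_forests (card V) k * burn_law p (card V) k xs"
  using assms(3-)
proof (induction "card V - k" arbitrary: V k xs rule: less_induct)
  case less
  note V = less.prems(1)
  let ?N = "card V" and ?R = "\<lambda>F. burn_sizes_pmf p F F"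
  show ?case
  proof (cases "k = ?N")
    case True
    have "forest_weight V {} = 1" by (simp add: forest_weight_def trees_empty[OF V] prod.reindex)
    then have "(\<Sum>F\<in>forests V k. forest_weight V F * ?R F xs) = of_bool (xs = [])"
      by (simp add: True forests_card[OF V] burn_sizes_pmf_empty[OF p])
    moreover have "rooted_forests ?N k = 1" using True by (simp add: rooted_forests_def)
    moreover have "burn_law p ?N k xs = of_bool (xs = [])" using True by (cases xs) auto
    ultimately show ?thesis by simp
  next
    case False
    then have k: "0 < k" "k < ?N" using less.prems by (auto intro: gr0I)
    let ?m = "real (?N - k)" and ?W = "rooted_forests ?N k"
    have m: "?m > 0" using k by simp
    have "?m * (\<Sum>F\<in>forests V k. forest_weight V F * ?R F xs) =
        (\<Sum>F\<in>forests V k. forest_weight V F * (\<Sum>e\<in>F. step_pmf p ?R F xs e))"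
      unfolding sum_distrib_left[of ?m]
    proof (rule sum.cong[OF refl])
      fix F assume F: "F \<in> forests V k"
      have card: "card F = ?N - k" using card_forests[OF V F] by simp
      then have "finite F" "F \<noteq> {}" using k card_ge_0_finite[of F] by auto
      from mean_pmf_step[OF p this, of xs] show "?m * (forest_weight V F * ?R F xs) = forest_weight V F * (\<Sum>e\<in>F. step_pmf p ?R F xs e)"
        using card by simp
    qed
    also have "\<dots> = p * (\<Sum>F\<in>forests V k. forest_weight V F * (\<Sum>e\<in>F. (case xs of [] \<Rightarrow> 0 | s # ys \<Rightarrow>
          of_bool (s = card (tree_of_edge F e)) * ?R (F - Pow (tree_of_edge F e)) ys)))
        + (1 - p) * (\<Sum>F\<in>forests V k. \<Sum>e\<in>F. forest_weight V F * ?R (F - {e}) xs)"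
      unfolding step_pmf_def[OF p]
      by (simp only: sum_distrib_left sum.distrib distrib_left mult.left_commute)
    also have "(\<Sum>F\<in>forests V k. \<Sum>e\<in>F. forest_weight V F * ?R (F - {e}) xs) = ?m * ?W * burn_law p ?N (Suc k) xs"
    proof -
      have "(\<Sum>F\<in>forests V k. \<Sum>e\<in>F. forest_weight V F * ?R (F - {e}) xs) =
          (\<Sum>F\<in>forests V (Suc k). \<Sum>e\<in>joining V F. forest_weight V (insert e F) * ?R (insert e F - {e}) xs)"
        by (rule sum_edge_removal[OF V])
      also have "\<dots> = (\<Sum>F\<in>forests V (Suc k). (\<Sum>e\<in>joining V F. forest_weight V (insert e F)) * ?R F xs)"
        unfolding sum_distrib_right
      proof (intro sum.cong refl)
        fix F e assume "e \<in> joining V F"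
        then have "e \<notin> F" using component_edge by (auto simp: joining_def)
        then show "forest_weight V (insert e F) * ?R (insert e F - {e}) xs = forest_weight V (insert e F) * ?R F xs"
          by simp
      qed
      also have "\<dots> = (\<Sum>F\<in>forests V (Suc k). real ?N * k * (forest_weight V F * ?R F xs))"
        by (intro sum.cong refl) (simp add: sum_forest_weight_joining[OF V])
      also have "\<dots> = real ?N * k * (\<Sum>F\<in>forests V (Suc k). forest_weight V F * ?R F xs)"
        by (rule sum_distrib_left[symmetric])
      also have "(\<Sum>F\<in>forests V (Suc k). forest_weight V F * ?R F xs) = rooted_forests ?N (Suc k) * burn_law p ?N (Suc k) xs"
        by (rule less.hyps) (use k V in auto)
      finally show ?thesis using rooted_forests_Suc[OF k] by simp
    qed
    also have "(\<Sum>F\<in>forests V k. forest_weight V F * (\<Sum>e\<in>F. (case xs of [] \<Rightarrow> 0 | s # ys \<Rightarrow>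
          of_bool (s = card (tree_of_edge F e)) * ?R (F - Pow (tree_of_edge F e)) ys))) =
        ?m * ?W * (case xs of [] \<Rightarrow> 0 | s # ys \<Rightarrow> burn_prob ?N k s * burn_law p (?N - s) (k - 1) ys)"
    proof (cases xs)
      case (Cons s ys)
      have "(\<Sum>F\<in>forests V k. forest_weight V F * (\<Sum>e\<in>F. of_bool (s = card (tree_of_edge F e)) * ?R (F - Pow (tree_of_edge F e)) ys)) =
          ?m * ?W * (\<Sum>t\<le>?N. burn_prob ?N k t * (of_bool (s = t) * burn_law p (?N - s) (k - 1) ys))"
      proof (rule sum_burn_weight[OF V k])
        fix S assume S: "S \<subseteq> V" "2 \<le> card S"
        show "(\<Sum>G\<in>forests (V - S) (k - 1). forest_weight (V - S) G * (of_bool (s = card S) * ?R G ys)) =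
            rooted_forests (?N - card S) (k - 1) * (of_bool (s = card S) * burn_law p (?N - s) (k - 1) ys)"
        proof (cases "s = card S")
          case True
          have card: "card (V - S) = ?N - s" using card_Diff_finite[OF V S(1)] True by simp
          have fin: "finite (V - S)" using V by simp
          have "(\<Sum>G\<in>forests (V - S) (k - 1). forest_weight (V - S) G * ?R G ys) =
              rooted_forests (card (V - S)) (k - 1) * burn_law p (card (V - S)) (k - 1) ys"
          \<comment> \<open>Outside the range of the induction hypothesis there is no forest with
            these parameters and the closed form is 0 too.\<close>
          proof (cases "k - 1 \<le> card (V - S) \<and> (k - 1 = 0 \<longrightarrow> V - S = {})")
            case True
            then show ?thesis using k S V \<open>s = card S\<close> card card_mono[OF V S(1)]
              by (intro less.hyps) auto
          next
            case False
            then have "forests (V - S) (k - 1) = {} \<and> rooted_forests (card (V - S)) (k - 1) = 0"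
              using forests_0[OF fin] forests_eq_empty[OF fin] fin by (auto simp: rooted_forests_def)
            then show ?thesis by simp
          qed
          then show ?thesis using True card by simp
        qed simp
      qed
      also have "(\<Sum>t\<le>?N. burn_prob ?N k t * (of_bool (s = t) * burn_law p (?N - s) (k - 1) ys)) =
          (\<Sum>t\<in>{..?N}. if t = s then burn_prob ?N k s * burn_law p (?N - s) (k - 1) ys else 0)"
        by (rule sum.cong) auto
      also have "\<dots> = burn_prob ?N k s * burn_law p (?N - s) (k - 1) ys"
        by (auto simp: burn_prob_eq_0)
      finally show ?thesis using Cons by simp
    qed simp
    finally have "?m * (\<Sum>F\<in>forests V k. forest_weight V F * ?R F xs) = ?m * (?W * burn_law p ?N k xs)"
      unfolding burn_law_step[OF k(2)] by (simp add: algebra_simps)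
    then show ?thesis using m by simp
  qed
qed

text \<open>On a single tree the weight is the constant \<open>n\<close>, so the weighted law at
  \<open>k = 1\<close> is that of a uniform tree.\<close>

theorem pmf_burnt_subtree_sizes:
  assumes p: "0 \<le> p" "p \<le> 1" and n: "1 \<le> n"
  shows "pmf (burnt_subtree_sizes n p) xs = burn_law p n 1 xs"
proof -
  let ?V = "{1..n}"
  let ?T = "forests ?V 1"
  have T: "finite ?T" "?T \<noteq> {}"
    using finite_forests[of ?V 1] cayley_trees_nonempty[of n] cayley_trees_eq[OF n] by auto
  have w: "forest_weight ?V F = n" if "F \<in> ?T" for F
    using trees_singleton(1)[of F ?V] that by (simp add: forest_weight_def)
  have "real n * real (card ?T) = total_weight ?V 1" using w by (simp add: total_weight_def)
  then have card: "real n * real (card ?T) = rooted_forests n 1" using total_weight_eq[of ?V 1] by simp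
  have "pmf (burnt_subtree_sizes n p) xs = (\<Sum>F\<in>?T. burn_sizes_pmf p F F xs) / card ?T"
    unfolding burnt_subtree_sizes_eq[OF n] burn_sizes_pmf_def by (rule pmf_bind_pmf_of_set[OF T(2,1)])
  moreover have "real n * (\<Sum>F\<in>?T. burn_sizes_pmf p F F xs) = rooted_forests n 1 * burn_law p n 1 xs"
  proof -
    have "real n * (\<Sum>F\<in>?T. burn_sizes_pmf p F F xs) = (\<Sum>F\<in>?T. forest_weight ?V F * burn_sizes_pmf p F F xs)"
      unfolding sum_distrib_left by (intro sum.cong refl) (simp only: w)
    also have "\<dots> = rooted_forests (card ?V) 1 * burn_law p (card ?V) 1 xs"
      by (rule sum_forests_burn_sizes[OF p]) (use n in auto)
    finally show ?thesis by simp
  qed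
  moreover have "real (card ?T) > 0" using T by (simp add: card_gt_0_iff)
  ultimately show ?thesis using n unfolding card[symmetric] by (simp add: field_simps)
qed

section \<open>The local limit of the burnt size\<close>

definition stirling_ratio :: "nat \<Rightarrow> real" where
  "stirling_ratio n = fact n * exp (real n) / (real n ^ n * sqrt (real n))"

text \<open>The partial Wallis products are expressed by the central binomial coefficient, in which
  Stirling's constant survives.\<close>

lemma wallis_product:
  "(\<Prod>k=1..n. (4 * real k ^ 2) / (4 * real k ^ 2 - 1)) = (4 ^ n * (fact n)\<^sup>2 / fact (2 * n))\<^sup>2 / (2 * real n + 1)"
proof (induction n)
  case (Suc n)
  let ?w = "4 ^ n * (fact n)\<^sup>2 / fact (2 * n) :: real"
  have w: "4 ^ Suc n * (fact (Suc n))\<^sup>2 / fact (2 * Suc n) = ?w * (2 * (real n + 1) / (2 * real n + 1))"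
  proof -
    have *: "4 * x * (m * f)\<^sup>2 / (2 * m * c * g) = x * f\<^sup>2 / g * (2 * m / c)"
      if "m \<noteq> 0" "c \<noteq> 0" "g \<noteq> 0" for x m f c g :: real
      using that by (simp add: power2_eq_square field_simps)
    have "fact (2 * Suc n) = 2 * (real n + 1) * (2 * real n + 1) * fact (2 * n)"
      "fact (Suc n) = (real n + 1) * fact n" "4 ^ Suc n = 4 * (4 ^ n :: real)"
      by (simp_all add: algebra_simps)
    then show ?thesis using *[of "real n + 1" "2 * real n + 1" "fact (2 * n)" "4 ^ n" "fact n"]
      by (simp only:) simp
  qed
  have "(\<Prod>k=1..Suc n. (4 * real k ^ 2) / (4 * real k ^ 2 - 1)) =
      ?w\<^sup>2 / (2 * real n + 1) * ((4 * (real n + 1) ^ 2) / (4 * (real n + 1) ^ 2 - 1))"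
    using Suc by (simp add: add_ac)
  also have "4 * (real n + 1) ^ 2 - 1 = (2 * real n + 1) * (2 * real n + 3)"
    by (simp add: algebra_simps power2_eq_square)
  also have "?w\<^sup>2 / (2 * real n + 1) * ((4 * (real n + 1) ^ 2) / ((2 * real n + 1) * (2 * real n + 3))) =
      (?w * (2 * (real n + 1) / (2 * real n + 1)))\<^sup>2 / (2 * real (Suc n) + 1)"
    by (simp add: power_mult_distrib power_divide power2_eq_square) (simp add: algebra_simps)
  finally show ?case unfolding w .
qed simp

lemma stirling_ratio_pos: "0 < n \<Longrightarrow> 0 < stirling_ratio n"
  by (simp add: stirling_ratio_def)

lemma ln_stirling_ratio:
  "0 < n \<Longrightarrow> ln (stirling_ratio n) = ln (fact n) + real n - (real n + 1/2) * ln (real n)"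
  by (simp add: stirling_ratio_def ln_mult ln_div ln_realpow ln_sqrt algebra_simps)

text \<open>The increments of the logarithm are of order \<open>1 / n^2\<close>, hence
  summable.\<close>

lemma stirling_ratio_convergent: "\<exists>c>0. stirling_ratio \<longlonglongrightarrow> c"
proof -
  define D where "D n = ln (stirling_ratio (Suc n))" for n
  have diff: "D n - D (Suc n) = (real n + 3/2) * ln (1 + 1 / (real n + 1)) - 1" for n
  proof -
    have f1: "ln (fact (Suc (Suc n)) :: real) = ln (real n + 2) + ln (fact (Suc n))"
      by (subst fact_Suc) (simp add: ln_mult add_ac del: fact_Suc)
    have "1 + 1 / (real n + 1) = (real n + 2) / (real n + 1)" by (simp add: field_simps)
    then have f2: "ln (1 + 1 / (real n + 1)) = ln (real n + 2) - ln (real n + 1)"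
      by (simp add: ln_div)
    show ?thesis
      unfolding D_def f2 by (simp add: ln_stirling_ratio f1 algebra_simps del: fact_Suc)
  qed
  have "(\<lambda>n. (real n + 3/2) * ln (1 + 1 / (real n + 1)) - 1) \<in> O(\<lambda>n. inverse (real n ^ 2))"
    by real_asymp
  moreover have "summable (\<lambda>n. norm (inverse (real n ^ 2)))"
    using inverse_power_summable[of 2, where 'a = real] by simp
  ultimately have "summable (\<lambda>n. D n - D (Suc n))"
    unfolding diff by (rule summable_comparison_test_bigo[rotated])
  then have "(\<lambda>n. \<Sum>i<n. D i - D (Suc i)) \<longlonglongrightarrow> (\<Sum>n. D n - D (Suc n))" by (rule summable_LIMSEQ)
  then have "(\<lambda>n. D 0 - D n) \<longlonglongrightarrow> (\<Sum>n. D n - D (Suc n))" unfolding sum_lessThan_telescope' .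
  then have "(\<lambda>n. D 0 - (D 0 - D n)) \<longlonglongrightarrow> D 0 - (\<Sum>n. D n - D (Suc n))" by (intro tendsto_intros)
  then have "(\<lambda>n. exp (D n)) \<longlonglongrightarrow> exp (D 0 - (\<Sum>n. D n - D (Suc n)))" by (intro tendsto_exp) simp
  moreover have "exp (D n) = stirling_ratio (Suc n)" for n
    using stirling_ratio_pos[of "Suc n"] by (simp add: D_def)
  ultimately have "(\<lambda>n. stirling_ratio (Suc n)) \<longlonglongrightarrow> exp (D 0 - (\<Sum>n. D n - D (Suc n)))" by simp
  then have "stirling_ratio \<longlonglongrightarrow> exp (D 0 - (\<Sum>n. D n - D (Suc n)))" by (rule LIMSEQ_imp_Suc)
  then show ?thesis by (intro exI conjI) auto
qed

text \<open>If \<open>c\<close> is the limit, the square of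
  \<open>stirling_ratio n ^ 2 / stirling_ratio (2 * n)\<close> tends to \<open>c^2\<close>. It is
  also a Wallis product times a factor tending to 4, so \<open>c^2 = 2 * pi\<close>.\<close>

lemma stirling: "stirling_ratio \<longlonglongrightarrow> sqrt (2 * pi)"
proof -
  obtain c where c: "c > 0" "stirling_ratio \<longlonglongrightarrow> c" using stirling_ratio_convergent by blast
  have "filterlim (\<lambda>n :: nat. 2 * n) sequentially sequentially"
    by (rule filterlim_subseq) (simp add: strict_mono_def)
  from filterlim_compose[OF c(2) this] have c2: "(\<lambda>n. stirling_ratio (2 * n)) \<longlonglongrightarrow> c" .
  have a: "(\<lambda>n. ((stirling_ratio n)\<^sup>2 / stirling_ratio (2 * n))\<^sup>2) \<longlonglongrightarrow> (c\<^sup>2 / c)\<^sup>2"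
    using c by (intro tendsto_intros c c2) auto
  have b: "(\<lambda>n. (\<Prod>k=1..n. (4 * real k ^ 2) / (4 * real k ^ 2 - 1)) * ((2 * real n + 1) * 2 / real n)) \<longlonglongrightarrow> pi / 2 * 4"
    by (intro tendsto_mult wallis) real_asymp
  have ev: "eventually (\<lambda>n. ((stirling_ratio n)\<^sup>2 / stirling_ratio (2 * n))\<^sup>2 =
      (\<Prod>k=1..n. (4 * real k ^ 2) / (4 * real k ^ 2 - 1)) * ((2 * real n + 1) * 2 / real n)) sequentially"
    using eventually_gt_at_top[of 0]
  proof eventually_elim
    case (elim n)
    have "(stirling_ratio n)\<^sup>2 / stirling_ratio (2 * n) = 4 ^ n * (fact n)\<^sup>2 / fact (2 * n) * (sqrt 2 * sqrt n / n)"
    proof -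
      have *: "(f * e / (p * q))\<^sup>2 / (g * e\<^sup>2 / (x * p\<^sup>2 * (r * q))) = x * f\<^sup>2 / g * (r * q / q\<^sup>2)"
        if "e \<noteq> 0" "p \<noteq> 0" "q \<noteq> 0" "g \<noteq> 0" for e f g p q r x :: real
        using that by (simp add: field_simps power2_eq_square)
      have "exp (real (2 * n)) = (exp (real n))\<^sup>2" "real (2 * n) ^ (2 * n) = 4 ^ n * (real n ^ n)\<^sup>2"
        "sqrt (real (2 * n)) = sqrt 2 * sqrt n" "real n = (sqrt (real n))\<^sup>2"
        by (simp_all add: exp_double power_mult_distrib power_mult real_sqrt_mult power_even_eq[symmetric])
      then show ?thesis
        using *[of "exp (real n)" "real n ^ n" "sqrt n" "fact (2 * n)" "fact n" "4 ^ n" "sqrt 2"] elim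
        by (simp add: stirling_ratio_def)
    qed
    then have "((stirling_ratio n)\<^sup>2 / stirling_ratio (2 * n))\<^sup>2 = (4 ^ n * (fact n)\<^sup>2 / fact (2 * n))\<^sup>2 * (2 / real n)"
      using elim by (simp add: power_mult_distrib power_divide) (simp add: power2_eq_square field_simps)
    moreover have "w / c * (c * 2 / r) = w * (2 / r)" if "c \<noteq> 0" for w c r :: real using that by simp
    moreover have "2 * real n + 1 \<noteq> 0" by linarith
    ultimately show ?case unfolding wallis_product by (simp only: not_False_eq_True)
  qed
  have "(\<lambda>n. ((stirling_ratio n)\<^sup>2 / stirling_ratio (2 * n))\<^sup>2) \<longlonglongrightarrow> pi / 2 * 4"
    by (rule Lim_transform_eventually[OF b eventually_mono[OF ev]]) simp
  then have "(c\<^sup>2 / c)\<^sup>2 = pi / 2 * 4" using LIMSEQ_unique a by blast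
  then have "c\<^sup>2 = 2 * pi" using c(1) by (simp add: power2_eq_square)
  then have "c = sqrt (2 * pi)" using c(1) by (metis real_sqrt_unique less_imp_le)
  then show ?thesis using c(2) by simp
qed

text \<open>
  After Stirling's formula, the factors of \<open>burn_prob\<close> of exponential size combine to the exponential of
  an increment of this function, which the mean value theorem controls.
\<close>

definition rate :: "real \<Rightarrow> real \<Rightarrow> real" where
  "rate k x = (x - k) * ln (1 - k / x)"

lemma fact_stirling: "0 < n \<Longrightarrow> fact n = stirling_ratio n * (real n ^ n * sqrt (real n)) / exp (real n)"
  by (simp add: stirling_ratio_def)

text \<open>An exact identity. With \<open>b = N - s - k\<close>, the factorials cancel down to
  those of \<open>s\<close>, \<open>s + b\<close> and \<open>b\<close>. Replacing these by
  \<open>stirling_ratio\<close>, the factors \<open>exp s\<close> cancel and the remaining powers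
  form the exponential of \<open>rate\<close>.\<close>

lemma burn_prob_stirling:
  assumes "2 \<le> k" "2 \<le> s" "s + k < N"
  shows "burn_prob N k s = (real s - 1) / real s * ((real k - 1) * real N / ((real N - real k) * (real N - real s - real k + 1)))
    / (stirling_ratio s * sqrt (real s)) * (stirling_ratio (N - k) / stirling_ratio (N - s - k))
    * sqrt ((real N - real k) / (real N - real s - real k)) * exp (rate k N - rate k (real N - real s))"
proof -
  define b where "b = N - s - k"
  obtain k' where k': "k = Suc (Suc k')" using assms by (metis add_2_eq_Suc le_Suc_ex)
  obtain s' where s': "s = Suc (Suc s')" using assms by (metis add_2_eq_Suc le_Suc_ex)
  have N: "N = s + k + b" "0 < b" using assms by (auto simp: b_def)
  let ?r = "real"
  have binom: "real (n choose j) = fact n / (fact j * fact (n - j))" if "j \<le> n" for n j :: nat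
    using binomial_fact[OF that, where 'a = real] .
  have 1: "real (N choose s) = fact N / (fact s * fact (k + b))" using binom[of s N] by (simp add: N)
  have 2: "rooted_forests s 1 = ?r s ^ (s - 1)" using assms by (simp add: rooted_forests_def)
  have 3: "rooted_forests (N - s) (k - 1) = fact (k + b - 1) / (fact (k - 2) * fact (b + 1)) * ?r (k + b) ^ (b + 1)"
    using binom[of "k - 2" "k + b - 1"] by (simp add: rooted_forests_def N k')
  have 4: "rooted_forests N k = fact (N - 1) / (fact (k - 1) * fact (s + b)) * ?r N ^ (s + b)"
    using binom[of "k - 1" "N - 1"] by (simp add: rooted_forests_def N k')
  have f: "fact N = ?r N * fact (N - 1)" "fact (k + b) = ?r (k + b) * fact (k + b - 1)"
    "fact (k - 1) = (?r k - 1) * fact (k - 2)" "fact (b + 1) = (?r b + 1) * (fact b :: real)"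
    using N by (simp_all add: k' fact_reduce)
  have ss: "?r s ^ (s - 1) = ?r s ^ s / ?r s" by (simp add: s')
  have "burn_prob N k s = (?r s - 1) / ?r s * ((?r k - 1) * ?r N / (?r (s + b) * (?r b + 1))) * (?r s ^ s / fact s)
      * (fact (s + b) / fact b) * (?r (k + b) ^ b / ?r N ^ (s + b))"
    unfolding burn_prob_def 1 2 3 4 f ss using N assms by (simp add: divide_simps)
  also have "?r s ^ s / fact s = exp (?r s) / (stirling_ratio s * sqrt (?r s))"
    using assms by (simp add: fact_stirling)
  also have "fact (s + b) / fact b = (stirling_ratio (s + b) / stirling_ratio b) * sqrt (?r (s + b) / ?r b)
      * (?r (s + b) ^ (s + b) / ?r b ^ b) / exp (?r s)"
    using N stirling_ratio_pos[of b] by (simp add: fact_stirling[of b] fact_stirling[of "s + b"] exp_add real_sqrt_divide mult_ac)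
  finally have *: "burn_prob N k s = (?r s - 1) / ?r s * ((?r k - 1) * ?r N / (?r (s + b) * (?r b + 1)))
      / (stirling_ratio s * sqrt (?r s)) * (stirling_ratio (s + b) / stirling_ratio b) * sqrt (?r (s + b) / ?r b)
      * (?r (s + b) ^ (s + b) / ?r b ^ b * (?r (k + b) ^ b / ?r N ^ (s + b)))"
    by simp
  have "exp (rate k N) = (?r (s + b) / ?r N) ^ (s + b)"
  proof -
    have "1 - ?r k / ?r N = ?r (s + b) / ?r N" using N by (simp add: field_simps)
    moreover have "?r N - ?r k = ?r (s + b)" using N by simp
    moreover have "0 < ?r (s + b) / ?r N" using N by simp
    ultimately show ?thesis unfolding rate_def by (simp only: exp_of_nat_mult exp_ln)
  qed
  moreover have "exp (rate k (?r N - ?r s)) = (?r b / ?r (k + b)) ^ b"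
  proof -
    have "1 - ?r k / (?r N - ?r s) = ?r b / ?r (k + b)" using N by (simp add: field_simps)
    moreover have "?r N - ?r s - ?r k = ?r b" using N by simp
    moreover have "0 < ?r b / ?r (k + b)" using N by simp
    ultimately show ?thesis unfolding rate_def by (simp only: exp_of_nat_mult exp_ln)
  qed
  ultimately have e: "exp (rate k N - rate k (?r N - ?r s)) =
      ?r (s + b) ^ (s + b) / ?r b ^ b * (?r (k + b) ^ b / ?r N ^ (s + b))"
    by (simp add: exp_diff power_divide)
  have eqs: "N - k = s + b" "N - s - k = b" "?r N - ?r k = ?r (s + b)" "?r N - ?r s - ?r k = ?r b" using N by auto
  show ?thesis unfolding e eqs by (rule *)
qed

section \<open>The local limit\<close>

text \<open>The derivative of \<open>rate k\<close> at \<open>x\<close> is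
  \<open>ln (1 - k / x) + k / x\<close>, about \<open>- (k / x)^2 / 2\<close> for small
  \<open>k / x\<close>. By the mean value theorem the increment is \<open>s\<close> times this at a
  point \<open>z\<close> with \<open>z / N\<close> tending to 1.\<close>

lemma rate_tendsto:
  fixes N k s :: "nat \<Rightarrow> real"
  assumes N: "\<And>n. 0 < k n" "\<And>n. 0 < s n"
    and "eventually (\<lambda>n. s n + k n < N n) sequentially"
    and lim: "(\<lambda>n. k n / N n) \<longlonglongrightarrow> 0" "(\<lambda>n. s n / N n) \<longlonglongrightarrow> 0"
    and t: "(\<lambda>n. s n * (k n)\<^sup>2 / (N n)\<^sup>2) \<longlonglongrightarrow> t"
  shows "(\<lambda>n. rate (k n) (N n) - rate (k n) (N n - s n)) \<longlonglongrightarrow> - t / 2"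
proof -
  have ex: "\<exists>z. N n - s n < z \<and> z < N n \<and> rate (k n) (N n) - rate (k n) (N n - s n) =
      s n * (ln (1 - k n / z) + k n / z)" if "s n + k n < N n" for n
  proof -
    have "\<exists>z>N n - s n. z < N n \<and> rate (k n) (N n) - rate (k n) (N n - s n) =
        (N n - (N n - s n)) * (ln (1 - k n / z) + k n / z)"
    proof (rule MVT2)
      fix x assume "N n - s n \<le> x" "x \<le> N n"
      then have "k n < x" "0 < x" using that N[of n] by linarith+
      then have "0 < 1 - k n / x" by (simp add: field_simps)
      then have "(rate (k n) has_real_derivative ((x - k n) * (k n / x\<^sup>2 / (1 - k n / x)) + ln (1 - k n / x))) (at x)"
        using \<open>0 < x\<close> unfolding rate_def
        by (auto intro!: derivative_eq_intros simp: power2_eq_square mult_ac)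
      moreover have "(x - k n) * (k n / x\<^sup>2 / (1 - k n / x)) = k n / x"
        using \<open>k n < x\<close> \<open>0 < x\<close> by (simp add: divide_simps power2_eq_square)
      ultimately show "(rate (k n) has_real_derivative (ln (1 - k n / x) + k n / x)) (at x)" by (simp add: add.commute)
    qed (use N[of n] in auto)
    then show ?thesis by auto
  qed
  define z where "z n = (SOME z. N n - s n < z \<and> z < N n \<and> rate (k n) (N n) - rate (k n) (N n - s n) =
      s n * (ln (1 - k n / z) + k n / z))" for n
  have z: "eventually (\<lambda>n. N n - s n < z n \<and> z n < N n \<and> k n < z n \<and> 0 < z n \<and> rate (k n) (N n) - rate (k n) (N n - s n) =
      s n * (ln (1 - k n / z n) + k n / z n)) sequentially"
    using assms(3)
  proof eventually_elim
    case (elim n)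
    from someI_ex[OF ex[OF elim]] elim N[of n] show ?case unfolding z_def[symmetric] by linarith
  qed
  have zN: "(\<lambda>n. z n / N n) \<longlonglongrightarrow> 1"
  proof (rule tendsto_sandwich)
    show "(\<lambda>n. 1 - s n / N n) \<longlonglongrightarrow> 1" using tendsto_diff[OF tendsto_const lim(2), of 1] by simp
    show "eventually (\<lambda>n. 1 - s n / N n \<le> z n / N n) sequentially"
      using z
    proof eventually_elim
      case (elim n)
      then have "(N n - s n) / N n \<le> z n / N n" by (intro divide_right_mono) auto
      then show ?case using elim by (simp add: diff_divide_distrib)
    qed
    show "eventually (\<lambda>n. z n / N n \<le> 1) sequentially"
      using z by eventually_elim simp
  qed simp
  have "(\<lambda>n. (k n / N n) / (z n / N n)) \<longlonglongrightarrow> 0 / 1" by (intro tendsto_divide lim zN) simp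
  then have "(\<lambda>n. (k n / N n) / (z n / N n)) \<longlonglongrightarrow> 0" by simp
  moreover have "eventually (\<lambda>n. (k n / N n) / (z n / N n) = k n / z n) sequentially"
    using z by eventually_elim simp
  ultimately have y: "(\<lambda>n. k n / z n) \<longlonglongrightarrow> 0" by (rule Lim_transform_eventually)
  have "filterlim (\<lambda>n. k n / z n) (at_right 0) sequentially"
    unfolding filterlim_at
  proof (intro conjI y)
    show "eventually (\<lambda>n. k n / z n \<in> {0<..} \<and> k n / z n \<noteq> 0) sequentially"
      using z
    proof eventually_elim
      case (elim n)
      then have "0 < k n / z n" using N(1)[of n] by simp
      then show ?case by (metis greaterThan_iff less_irrefl)
    qed
  qed
  moreover have "((\<lambda>y :: real. (ln (1 - y) + y) / y\<^sup>2) \<longlongrightarrow> -1/2) (at_right 0)" by real_asymp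
  ultimately have l: "(\<lambda>n. (ln (1 - k n / z n) + k n / z n) / (k n / z n)\<^sup>2) \<longlonglongrightarrow> -1/2"
    using filterlim_compose by blast
  have "(\<lambda>n. (s n * (k n)\<^sup>2 / (N n)\<^sup>2) / (z n / N n)\<^sup>2 * ((ln (1 - k n / z n) + k n / z n) / (k n / z n)\<^sup>2)) \<longlonglongrightarrow> t / 1\<^sup>2 * (-1/2)"
    by (intro tendsto_intros t zN l) simp
  moreover have "eventually (\<lambda>n. (s n * (k n)\<^sup>2 / (N n)\<^sup>2) / (z n / N n)\<^sup>2 * ((ln (1 - k n / z n) + k n / z n) / (k n / z n)\<^sup>2)
      = rate (k n) (N n) - rate (k n) (N n - s n)) sequentially"
    using z
  proof eventually_elim
    case (elim n)
    then have "N n > 0" "z n > 0" "k n > 0" using N[of n] by auto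
    then have "(s n * (k n)\<^sup>2 / (N n)\<^sup>2) / (z n / N n)\<^sup>2 * (l / (k n / z n)\<^sup>2) = s n * l" for l
      by (simp add: field_simps power2_eq_square)
    then show ?case using elim by simp
  qed
  ultimately show ?thesis by (simp add: Lim_transform_eventually)
qed

text \<open>Burnt sizes live on the scale \<open>(N / k)^2\<close>: \<open>ratio\<close> makes it
  diverge and \<open>square\<close> makes it negligible against \<open>N\<close>.\<close>

locale regime =
  fixes N k :: "nat \<Rightarrow> nat"
  assumes k_at_top: "filterlim k at_top sequentially"
    and ratio: "(\<lambda>n. real (k n) / real (N n)) \<longlonglongrightarrow> 0"
    and square: "(\<lambda>n. real (N n) / (real (k n))\<^sup>2) \<longlonglongrightarrow> 0"
    and N_pos: "eventually (\<lambda>n. 0 < N n) sequentially"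
begin

lemma real_k_at_top: "filterlim (\<lambda>n. real (k n)) at_top sequentially"
  by (rule filterlim_compose[OF filterlim_real_sequentially k_at_top])

lemma k_ge: "eventually (\<lambda>n. c \<le> k n) sequentially"
  using k_at_top by (auto simp: filterlim_at_top)

lemma scale_at_top: "filterlim (\<lambda>n. real (N n) / real (k n)) at_top sequentially"
proof -
  have "eventually (\<lambda>n. 0 < real (k n) / real (N n)) sequentially"
    using N_pos k_ge[of 1] by eventually_elim simp
  from filterlim_inverse_at_top[OF ratio this] show ?thesis by (simp add: inverse_eq_divide)
qed

lemma burn_prob_local_limit:
  fixes s :: "nat \<Rightarrow> nat"
  assumes t: "t > 0" and s: "(\<lambda>n. real (s n) * (real (k n))\<^sup>2 / (real (N n))\<^sup>2) \<longlonglongrightarrow> t"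
  shows "(\<lambda>n. (real (N n) / real (k n))\<^sup>2 * burn_prob (N n) (k n) (s n)) \<longlonglongrightarrow> exp (- t / 2) / sqrt (2 * pi * t)"
proof -
  let ?N = "\<lambda>n. real (N n)" and ?k = "\<lambda>n. real (k n)" and ?s = "\<lambda>n. real (s n)"
  have ev: "eventually (\<lambda>n. 0 < N n \<and> 2 \<le> k n) sequentially"
    using N_pos k_ge[of 2] by eventually_elim simp
  have "filterlim (\<lambda>n. (?N n / ?k n)\<^sup>2) at_top sequentially"
    by (rule filterlim_pow_at_top[OF _ scale_at_top]) simp
  then have "filterlim (\<lambda>n. (?s n * (?k n)\<^sup>2 / (?N n)\<^sup>2) * (?N n / ?k n)\<^sup>2) at_top sequentially"
    by (rule filterlim_tendsto_pos_mult_at_top[OF s t])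
  then have s_top: "filterlim ?s at_top sequentially"
    by (rule filterlim_cong[THEN iffD1, OF refl refl, rotated])
      (use ev in eventually_elim, simp add: field_simps power2_eq_square)
  then have s_nat: "filterlim s at_top sequentially"
    by (simp add: filterlim_sequentially_iff_filterlim_real)
  have "(\<lambda>n. (?s n * (?k n)\<^sup>2 / (?N n)\<^sup>2) * (?N n / (?k n)\<^sup>2)) \<longlonglongrightarrow> t * 0"
    by (intro tendsto_mult s square)
  moreover have "eventually (\<lambda>n. (?s n * (?k n)\<^sup>2 / (?N n)\<^sup>2) * (?N n / (?k n)\<^sup>2) = ?s n / ?N n) sequentially"
    using ev by eventually_elim (simp add: field_simps power2_eq_square)
  ultimately have sN: "(\<lambda>n. ?s n / ?N n) \<longlonglongrightarrow> 0" by (simp add: Lim_transform_eventually)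
  have inv: "(\<lambda>n. 1 / ?s n) \<longlonglongrightarrow> 0" "(\<lambda>n. 1 / ?k n) \<longlonglongrightarrow> 0"
    using tendsto_inverse_0_at_top[OF s_top] tendsto_inverse_0_at_top[OF real_k_at_top]
    by (simp_all add: inverse_eq_divide)
  have "(\<lambda>n. (1 / ?k n) * (?k n / ?N n)) \<longlonglongrightarrow> 0 * 0" by (intro tendsto_mult inv ratio)
  moreover have "eventually (\<lambda>n. (1 / ?k n) * (?k n / ?N n) = 1 / ?N n) sequentially"
    using ev by eventually_elim simp
  ultimately have invN: "(\<lambda>n. 1 / ?N n) \<longlonglongrightarrow> 0" by (simp add: Lim_transform_eventually)
  have "(\<lambda>n. ?s n / ?N n + ?k n / ?N n) \<longlonglongrightarrow> 0 + 0" by (intro tendsto_add sN ratio)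
  then have "eventually (\<lambda>n. ?s n / ?N n + ?k n / ?N n < 1/2) sequentially"
    by (rule order_tendstoD) simp
  then have evb: "eventually (\<lambda>n. 0 < N n \<and> 2 \<le> k n \<and> 2 \<le> s n \<and> s n + k n < N n \<and> N n < 2 * (N n - s n - k n)) sequentially"
    using ev filterlim_at_top[THEN iffD1, OF s_nat, rule_format, of 2]
  proof eventually_elim
    case (elim n)
    then have "2 * (?s n + ?k n) < ?N n" by (simp add: field_simps)
    then have "real (2 * (s n + k n)) < real (N n)" by simp
    then have "2 * (s n + k n) < N n" by (simp only: of_nat_less_iff)
    then show ?case using elim by auto
  qed
  have b_top: "filterlim (\<lambda>n. N n - s n - k n) at_top sequentially" "filterlim (\<lambda>n. N n - k n) at_top sequentially"
  proof -
    have half: "eventually (\<lambda>n. ?k n / ?N n < 1/2) sequentially" by (rule order_tendstoD(2)[OF ratio]) simp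
    have s_le: "eventually (\<lambda>n. k n \<le> N n - k n) sequentially"
      using half ev
      by eventually_elim (simp add: field_simps)
    show 2: "filterlim (\<lambda>n. N n - k n) at_top sequentially"
      by (rule filterlim_at_top_mono[OF k_at_top s_le])
    have "eventually (\<lambda>n. k n \<le> N n - s n - k n) sequentially"
      using half evb
      by eventually_elim (simp add: field_simps)
    then show "filterlim (\<lambda>n. N n - s n - k n) at_top sequentially"
      by (rule filterlim_at_top_mono[OF k_at_top])
  qed
  have S: "(\<lambda>n. stirling_ratio (N n - k n)) \<longlonglongrightarrow> sqrt (2 * pi)"
    "(\<lambda>n. stirling_ratio (N n - s n - k n)) \<longlonglongrightarrow> sqrt (2 * pi)" "(\<lambda>n. stirling_ratio (s n)) \<longlonglongrightarrow> sqrt (2 * pi)"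
    by (rule filterlim_compose[OF stirling] b_top s_nat)+
  have rate: "(\<lambda>n. rate (?k n) (?N n) - rate (?k n) (?N n - ?s n)) \<longlonglongrightarrow> - t / 2"
  proof -
    \<comment> \<open>\<open>rate_tendsto\<close> asks for positivity at every index, while
      \<open>k n\<close> and \<open>s n\<close> are positive only eventually; the value 1/2 replaces
      nothing but zeros.\<close>
    define k' where "k' n = max (1/2) (?k n)" for n
    define s' where "s' n = max (1/2) (?s n)" for n
    have eq: "eventually (\<lambda>n. k' n = ?k n \<and> s' n = ?s n) sequentially"
      using evb by eventually_elim (auto simp: k'_def s'_def)
    have "(\<lambda>n. rate (k' n) (?N n) - rate (k' n) (?N n - s' n)) \<longlonglongrightarrow> - t / 2"
    proof (rule rate_tendsto)
      show "eventually (\<lambda>n. s' n + k' n < ?N n) sequentially" using eq evb by eventually_elim auto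
      show "(\<lambda>n. k' n / ?N n) \<longlonglongrightarrow> 0" by (rule Lim_transform_eventually[OF ratio]) (use eq in eventually_elim, simp)
      show "(\<lambda>n. s' n / ?N n) \<longlonglongrightarrow> 0" by (rule Lim_transform_eventually[OF sN]) (use eq in eventually_elim, simp)
      show "(\<lambda>n. s' n * (k' n)\<^sup>2 / (?N n)\<^sup>2) \<longlonglongrightarrow> t"
        by (rule Lim_transform_eventually[OF s]) (use eq in eventually_elim, simp)
    qed (auto simp: k'_def s'_def)
    then show ?thesis by (rule Lim_transform_eventually) (use eq in eventually_elim, simp)
  qed
  \<comment> \<open>All quantities are divided by \<open>N\<close>, \<open>k\<close> or
    \<open>s\<close>, so that each factor has its own limit; the factor \<open>(N / k)^2\<close>
    leaves the square root of \<open>s * k^2 / N^2\<close>, which tends to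
    \<open>sqrt t\<close>.\<close>
  have "(\<lambda>n. (1 - 1 / ?s n) * (1 - 1 / ?k n) * (1 / ((1 - ?k n / ?N n) * (1 - ?s n / ?N n - ?k n / ?N n + 1 / ?N n)))
      * (1 / sqrt (?s n * (?k n)\<^sup>2 / (?N n)\<^sup>2)) * (1 / stirling_ratio (s n))
      * (stirling_ratio (N n - k n) / stirling_ratio (N n - s n - k n))
      * sqrt ((1 - ?k n / ?N n) / (1 - ?s n / ?N n - ?k n / ?N n)) * exp (rate (?k n) (?N n) - rate (?k n) (?N n - ?s n)))
    \<longlonglongrightarrow> (1 - 0) * (1 - 0) * (1 / ((1 - 0) * (1 - 0 - 0 + 0))) * (1 / sqrt t) * (1 / sqrt (2 * pi))
      * (sqrt (2 * pi) / sqrt (2 * pi)) * sqrt ((1 - 0) / (1 - 0 - 0)) * exp (- t / 2)"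
    using t by (intro tendsto_intros inv ratio sN invN s S rate) auto
  moreover have "(1 - 0) * (1 - 0) * (1 / ((1 - 0) * (1 - 0 - 0 + 0))) * (1 / sqrt t) * (1 / sqrt (2 * pi))
      * (sqrt (2 * pi) / sqrt (2 * pi)) * sqrt ((1 - 0) / (1 - 0 - 0)) * exp (- t / 2) = exp (- t / 2) / sqrt (2 * pi * t)"
    by (simp add: real_sqrt_mult)
  moreover have "eventually (\<lambda>n. (1 - 1 / ?s n) * (1 - 1 / ?k n) * (1 / ((1 - ?k n / ?N n) * (1 - ?s n / ?N n - ?k n / ?N n + 1 / ?N n)))
      * (1 / sqrt (?s n * (?k n)\<^sup>2 / (?N n)\<^sup>2)) * (1 / stirling_ratio (s n))
      * (stirling_ratio (N n - k n) / stirling_ratio (N n - s n - k n))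
      * sqrt ((1 - ?k n / ?N n) / (1 - ?s n / ?N n - ?k n / ?N n)) * exp (rate (?k n) (?N n) - rate (?k n) (?N n - ?s n))
      = (?N n / ?k n)\<^sup>2 * burn_prob (N n) (k n) (s n)) sequentially"
    using evb
  proof eventually_elim
    case (elim n)
    let ?a = "?N n - ?k n" and ?b = "?N n - ?s n - ?k n"
    have pos: "?N n > 0" "?k n > 0" "?s n > 0" "?a > 0" "?b > 0" using elim by auto
    have 1: "1 - ?k n / ?N n = ?a / ?N n" "1 - ?s n / ?N n - ?k n / ?N n = ?b / ?N n"
      "?b / ?N n + 1 / ?N n = (?b + 1) / ?N n"
      "1 - 1 / ?s n = (?s n - 1) / ?s n" "1 - 1 / ?k n = (?k n - 1) / ?k n"
      using pos by (simp_all add: field_simps)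
    note 13 = 1(3)
    have 2: "sqrt (?s n * (?k n)\<^sup>2 / (?N n)\<^sup>2) = sqrt (?s n) * ?k n / ?N n"
      using pos by (simp add: real_sqrt_mult real_sqrt_divide)
    have 3: "burn_prob (N n) (k n) (s n) = (?s n - 1) / ?s n * ((?k n - 1) * ?N n / (?a * (?b + 1)))
      / (stirling_ratio (s n) * sqrt (?s n)) * (stirling_ratio (N n - k n) / stirling_ratio (N n - s n - k n))
      * sqrt (?a / ?b) * exp (rate (?k n) (?N n) - rate (?k n) (?N n - ?s n))"
      using burn_prob_stirling[of "k n" "s n" "N n"] elim by simp
    have 4: "(?a / ?N n) / (?b / ?N n) = ?a / ?b" using pos by simp
    have 5: "(?s n - 1) / ?s n * ((?k n - 1) / ?k n) * (1 / (?a / ?N n * ((?b + 1) / ?N n))) * (1 / (sqrt (?s n) * ?k n / ?N n)) =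
      (?N n / ?k n)\<^sup>2 * ((?s n - 1) / ?s n * ((?k n - 1) * ?N n / (?a * (?b + 1))) / sqrt (?s n))"
      using pos by (simp add: power2_eq_square mult_ac)
    show ?case unfolding 1(1,2,4,5) unfolding 13 unfolding 2 3 4 unfolding 5 by (simp add: mult_ac)
  qed
  ultimately show ?thesis by (simp add: Lim_transform_eventually)
qed

end

section \<open>The square of a Gaussian variable\<close>

text \<open>The chi-squared density with one degree of freedom.\<close>

definition sq_density :: "real \<Rightarrow> real" where
  "sq_density t = (if 0 < t then exp (- t / 2) / sqrt (2 * pi * t) else 0)"

definition sq_cdf :: "real \<Rightarrow> real" where
  "sq_cdf y = measure (density lborel std_normal_density) {x. x\<^sup>2 \<le> y}"

lemma sq_density_measurable [measurable]: "sq_density \<in> borel_measurable borel"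
  unfolding sq_density_def by measurable

lemma sq_density_nonneg: "0 \<le> sq_density t"
  by (simp add: sq_density_def)

lemma prob_space_std_normal: "prob_space (density lborel std_normal_density)"
  by (rule prob_space_normal_density) simp

lemma sq_cdf_range: "0 \<le> sq_cdf y" "sq_cdf y \<le> 1"
  using prob_space.prob_le_1[OF prob_space_std_normal] by (auto simp: sq_cdf_def)

text \<open>The substitution of \<open>x^2\<close> gives twice the Gaussian density on the positive
  half-line, of which one half is reflected to the negative one.\<close>

lemma nn_integral_sq_density_Icc:
  assumes "0 \<le> y"
  shows "(\<integral>\<^sup>+x. sq_density x * indicator {0..y} x \<partial>lborel) = ennreal (sq_cdf y)"
proof -
  let ?a = "sqrt y" and ?\<phi> = std_normal_density
  have neg: "(\<integral>\<^sup>+x. ennreal (?\<phi> x) * indicator {0<..?a} x \<partial>lborel) = (\<integral>\<^sup>+x. ennreal (?\<phi> x) * indicator {-?a..<0} x \<partial>lborel)"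
    by (subst nn_integral_real_affine[where c = "-1" and t = 0])
      (auto simp: std_normal_density_def indicator_def intro!: nn_integral_cong)
  have "(\<integral>\<^sup>+x. sq_density x * indicator {0\<^sup>2..?a\<^sup>2} x \<partial>lborel) =
      (\<integral>\<^sup>+x. sq_density (x\<^sup>2) * (2 * x) * indicator {0..?a} x \<partial>lborel)"
    by (rule nn_integral_substitution)
      (use assms in \<open>auto intro!: derivative_eq_intros continuous_intros simp: set_borel_measurable_def\<close>)
  also have "\<dots> = (\<integral>\<^sup>+x. ennreal (?\<phi> x) * indicator {0<..?a} x + ennreal (?\<phi> x) * indicator {0<..?a} x \<partial>lborel)"
  proof (rule nn_integral_cong)
    fix x :: real
    have "sq_density (x\<^sup>2) * (2 * x) = 2 * ?\<phi> x" if "0 < x"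
      using that by (simp add: sq_density_def std_normal_density_def real_sqrt_mult)
    then show "ennreal (sq_density (x\<^sup>2) * (2 * x) * indicator {0..?a} x) =
        ennreal (?\<phi> x) * indicator {0<..?a} x + ennreal (?\<phi> x) * indicator {0<..?a} x"
      by (cases "x = 0") (auto simp: indicator_def sq_density_def simp flip: ennreal_plus)
  qed
  also have "\<dots> = (\<integral>\<^sup>+x. ennreal (?\<phi> x) * indicator {0<..?a} x \<partial>lborel) + (\<integral>\<^sup>+x. ennreal (?\<phi> x) * indicator {0<..?a} x \<partial>lborel)"
    by (rule nn_integral_add) auto
  also have "\<dots> = (\<integral>\<^sup>+x. ennreal (?\<phi> x) * indicator {-?a..<0} x \<partial>lborel) + (\<integral>\<^sup>+x. ennreal (?\<phi> x) * indicator {0<..?a} x \<partial>lborel)"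
    by (rule arg_cong2[OF neg refl])
  also have "\<dots> =
      (\<integral>\<^sup>+x. ennreal (?\<phi> x) * indicator {-?a..<0} x + ennreal (?\<phi> x) * indicator {0<..?a} x \<partial>lborel)"
    by (rule nn_integral_add[symmetric]) auto
  also have "\<dots> = (\<integral>\<^sup>+x. ennreal (?\<phi> x) * indicator {x. x\<^sup>2 \<le> y} x \<partial>lborel)"
  proof (rule nn_integral_cong_AE)
    have sq: "x\<^sup>2 \<le> y \<longleftrightarrow> - ?a \<le> x \<and> x \<le> ?a" for x
      using assms by (metis abs_le_iff minus_le_iff real_sqrt_abs real_sqrt_le_iff)
    show "AE x in lborel. ennreal (?\<phi> x) * indicator {-?a..<0} x + ennreal (?\<phi> x) * indicator {0<..?a} x =
        ennreal (?\<phi> x) * indicator {x. x\<^sup>2 \<le> y} x"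
      using AE_lborel_singleton[of 0] by eventually_elim (use assms in \<open>auto simp: indicator_def sq\<close>)
  qed
  also have "\<dots> = emeasure (density lborel ?\<phi>) {x. x\<^sup>2 \<le> y}"
    by (rule emeasure_density[symmetric]) auto
  also have "\<dots> = ennreal (sq_cdf y)"
    unfolding sq_cdf_def by (rule finite_measure.emeasure_eq_measure)
      (rule prob_space.finite_measure[OF prob_space_std_normal])
  finally show ?thesis using assms by simp
qed

lemma sq_cdf_at_top: "(\<lambda>n. sq_cdf (real n)) \<longlonglongrightarrow> 1"
proof -
  interpret N: prob_space "density lborel std_normal_density" by (rule prob_space_std_normal)
  have "(\<Union>n. {x :: real. x\<^sup>2 \<le> real n}) = UNIV" using real_arch_simple by auto
  moreover have "(\<lambda>n. sq_cdf (real n)) \<longlonglongrightarrow> measure (density lborel std_normal_density) (\<Union>n. {x. x\<^sup>2 \<le> real n})"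
    unfolding sq_cdf_def by (rule N.finite_Lim_measure_incseq) (auto simp: incseq_def)
  ultimately show ?thesis using N.prob_space by simp
qed

lemma nn_integral_sq_density: "(\<integral>\<^sup>+x. sq_density x \<partial>lborel) = 1"
proof -
  have "(\<lambda>n. \<integral>\<^sup>+x. sq_density x * indicator {0..real n} x \<partial>lborel) \<longlonglongrightarrow> (\<integral>\<^sup>+x. sq_density x \<partial>lborel)"
  proof (rule nn_integral_LIMSEQ)
    show "incseq (\<lambda>n x. ennreal (sq_density x * indicator {0..real n} x))"
      by (auto simp: incseq_def le_fun_def indicator_def sq_density_nonneg)
    fix x :: real
    obtain m where m: "x \<le> real m" using real_arch_simple by blast
    have "eventually (\<lambda>n. ennreal (sq_density x * indicator {0..real n} x) = ennreal (sq_density x)) sequentially"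
      using eventually_ge_at_top[of m]
      by eventually_elim (use m in \<open>auto simp: indicator_def sq_density_def\<close>)
    then show "(\<lambda>n. ennreal (sq_density x * indicator {0..real n} x)) \<longlonglongrightarrow> ennreal (sq_density x)"
      by (rule tendsto_eventually)
  qed auto
  moreover have "(\<lambda>n. \<integral>\<^sup>+x. sq_density x * indicator {0..real n} x \<partial>lborel) \<longlonglongrightarrow> ennreal 1"
    unfolding nn_integral_sq_density_Icc[OF of_nat_0_le_iff] by (intro tendsto_ennrealI sq_cdf_at_top)
  ultimately show ?thesis using LIMSEQ_unique by fastforce
qed

lemma integrable_sq_density: "integrable lborel sq_density"
  by (rule integrableI_nonneg) (auto simp: sq_density_nonneg nn_integral_sq_density)

lemma sq_cdf_eq:
  assumes "0 \<le> y"
  shows "sq_cdf y = (\<integral>x. sq_density x * indicator {..y} x \<partial>lborel)"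
proof -
  have "(\<integral>x. sq_density x * indicator {0..y} x \<partial>lborel) = sq_cdf y"
    using nn_integral_sq_density_Icc[OF assms] sq_cdf_range
    by (intro integral_eq_nn_integral[THEN trans]) (auto simp: sq_density_nonneg)
  moreover have "(\<lambda>x. sq_density x * indicator {0..y} x) = (\<lambda>x. sq_density x * indicator {..y} x)"
    by (auto simp: sq_density_def indicator_def)
  ultimately show ?thesis by simp
qed

lemma sq_cdf_tendsto:
  assumes "\<And>n. 0 \<le> Y n" "Y \<longlonglongrightarrow> y"
  shows "(\<lambda>n. sq_cdf (Y n)) \<longlonglongrightarrow> sq_cdf y"
proof -
  have "0 \<le> y" using assms by (auto intro: LIMSEQ_le_const)
  have "(\<lambda>n. \<integral>x. sq_density x * indicator {..Y n} x \<partial>lborel) \<longlonglongrightarrow> (\<integral>x. sq_density x * indicator {..y} x \<partial>lborel)"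
  proof (rule integral_dominated_convergence[OF _ _ integrable_sq_density])
    show "AE x in lborel. (\<lambda>n. sq_density x * indicator {..Y n} x) \<longlonglongrightarrow> sq_density x * indicator {..y} x"
      using AE_lborel_singleton[of y]
    proof eventually_elim
      case (elim x)
      have "eventually (\<lambda>n. sq_density x * indicator {..Y n} x = sq_density x * indicator {..y} x) sequentially"
      proof (cases "x < y")
        case True
        show ?thesis
          by (rule eventually_mono[OF order_tendstoD(1)[OF assms(2) True]]) (use True in \<open>auto simp: indicator_def\<close>)
      next
        case False
        then have "y < x" using elim by simp
        then show ?thesis
          by (intro eventually_mono[OF order_tendstoD(2)[OF assms(2)]]) (auto simp: indicator_def)
      qed
      then show ?case by (rule tendsto_eventually)
    qed
  qed (auto simp: sq_density_nonneg indicator_def)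
  then show ?thesis using sq_cdf_eq assms \<open>0 \<le> y\<close> by simp
qed

text \<open>The density is positive on an interval of positive length. Strictness is what makes
  convergence of distribution functions pass to quantiles.\<close>

lemma sq_cdf_strict_mono:
  assumes "0 \<le> x" "x < y"
  shows "sq_cdf x < sq_cdf y"
proof -
  have int: "integrable lborel (\<lambda>t. sq_density t * indicator A t)" if "A \<in> sets borel" for A
    using that by (intro integrable_real_mult_indicator integrable_sq_density) auto
  have "sq_cdf y - sq_cdf x = (\<integral>t. sq_density t * indicator {..y} t - sq_density t * indicator {..x} t \<partial>lborel)"
    using assms by (subst Bochner_Integration.integral_diff) (auto simp: sq_cdf_eq int)
  also have "\<dots> = (\<integral>t. sq_density t * indicator {x<..y} t \<partial>lborel)"
    using assms by (intro Bochner_Integration.integral_cong) (auto simp: indicator_def)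
  also have "\<dots> > 0"
  proof -
    have "(\<integral>t. sq_density t * indicator {x<..y} t \<partial>lborel) \<noteq> 0"
    proof
      assume "(\<integral>t. sq_density t * indicator {x<..y} t \<partial>lborel) = 0"
      then have "AE t in lborel. sq_density t * indicator {x<..y} t = 0"
        by (subst (asm) integral_nonneg_eq_0_iff_AE) (auto simp: int sq_density_nonneg)
      then have "AE t in lborel. t \<notin> {x<..y}"
        by eventually_elim (use assms in \<open>auto simp: indicator_def sq_density_def split: if_splits\<close>)
      then have "emeasure lborel {x<..y} = 0"
        by (subst (asm) AE_iff_measurable[where N = "{x<..y}"]) auto
      then show False using assms by simp
    qed
    moreover have "(\<integral>t. sq_density t * indicator {x<..y} t \<partial>lborel) \<ge> 0"
      by (simp add: sq_density_nonneg)
    ultimately show ?thesis by simp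
  qed
  finally show ?thesis by simp
qed

lemma sq_cdf_0: "sq_cdf 0 = 0"
proof -
  have "(\<lambda>n. sq_density n * indicator {..0} n) = (\<lambda>_. 0)" by (auto simp: sq_density_def indicator_def)
  then show ?thesis by (simp add: sq_cdf_eq)
qed

lemma sq_cdf_less_1: "sq_cdf y < 1"
proof -
  have "sq_cdf y \<le> sq_cdf (max y 0)"
    unfolding sq_cdf_def using prob_space.finite_measure[OF prob_space_std_normal]
    by (intro finite_measure.finite_measure_mono) auto
  also have "\<dots> < sq_cdf (max y 0 + 1)" by (rule sq_cdf_strict_mono) auto
  also have "\<dots> \<le> 1" by (rule sq_cdf_range)
  finally show ?thesis .
qed

lemma sq_cdf_surj:
  assumes "0 \<le> u" "u < 1"
  obtains y where "0 \<le> y" "sq_cdf y = u"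
proof -
  have cont: "continuous_on {0..} sq_cdf"
    unfolding continuous_on_sequentially using sq_cdf_tendsto by (auto simp: o_def)
  have "eventually (\<lambda>n. u < sq_cdf (real n)) sequentially"
    by (rule order_tendstoD(1)[OF sq_cdf_at_top assms(2)])
  then obtain n where n: "u < sq_cdf (real n)" by (auto simp: eventually_sequentially)
  have "\<exists>y\<ge>0. y \<le> real n \<and> sq_cdf y = u"
    by (rule IVT') (use n assms sq_cdf_0 in \<open>auto intro: continuous_on_subset[OF cont]\<close>)
  then show ?thesis using that by blast
qed

section \<open>From the local limit to distribution functions\<close>

context regime
begin

definition scale :: "nat \<Rightarrow> real" where "scale n = (real (N n) / real (k n))\<^sup>2"

lemma scale_sq_at_top: "filterlim scale at_top sequentially"
  unfolding scale_def by (rule filterlim_pow_at_top[OF _ scale_at_top]) simp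

lemma scaled_floor_tendsto:
  assumes "0 \<le> t"
  shows "(\<lambda>n. real (nat \<lfloor>scale n * t\<rfloor>) / scale n) \<longlonglongrightarrow> t"
proof (rule tendsto_sandwich)
  have pos: "eventually (\<lambda>n. 0 < scale n) sequentially"
    using scale_sq_at_top by (auto simp: filterlim_at_top_dense)
  show "eventually (\<lambda>n. t - 1 / scale n \<le> real (nat \<lfloor>scale n * t\<rfloor>) / scale n) sequentially"
    using pos
  proof eventually_elim
    case (elim n)
    then have "scale n * t - 1 \<le> real (nat \<lfloor>scale n * t\<rfloor>)" using assms by linarith
    then have "(scale n * t - 1) / scale n \<le> real (nat \<lfloor>scale n * t\<rfloor>) / scale n"
      using elim by (intro divide_right_mono) auto
    then show ?case using elim by (simp add: diff_divide_distrib)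
  qed
  show "eventually (\<lambda>n. real (nat \<lfloor>scale n * t\<rfloor>) / scale n \<le> t) sequentially"
    using pos
  proof eventually_elim
    case (elim n)
    then have "real (nat \<lfloor>scale n * t\<rfloor>) \<le> scale n * t" using assms by simp
    then show ?case using elim by (simp add: field_simps)
  qed
  have "(\<lambda>n. t - inverse (scale n)) \<longlonglongrightarrow> t - 0"
    by (intro tendsto_intros tendsto_inverse_0_at_top scale_sq_at_top)
  then show "(\<lambda>n. t - 1 / scale n) \<longlonglongrightarrow> t" by (simp add: inverse_eq_divide)
qed simp

definition regular :: "nat \<Rightarrow> bool" where
  "regular n \<longleftrightarrow> 0 < k n \<and> k n < N n"

lemma eventually_regular: "eventually regular sequentially"
proof -
  have "eventually (\<lambda>n. real (k n) / real (N n) < 1) sequentially"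
    by (rule order_tendstoD(2)[OF ratio]) simp
  then show ?thesis using N_pos k_ge[of 1]
    by eventually_elim (auto simp: regular_def)
qed

text \<open>Each atom is spread evenly over a cell of width \<open>1 / scale n\<close>, so that the
  local limit becomes pointwise convergence of densities.\<close>

definition step_density :: "nat \<Rightarrow> real \<Rightarrow> real" where
  "step_density n t = (if regular n then
     \<Sum>s\<le>N n. scale n * burn_prob (N n) (k n) s * indicator {real s / scale n..<(real s + 1) / scale n} t else 0)"

lemma scale_pos: "regular n \<Longrightarrow> 0 < scale n"
  by (simp add: regular_def scale_def)

lemma step_density_measurable [measurable]: "step_density n \<in> borel_measurable borel"
  unfolding step_density_def by measurable

lemma step_density_nonneg: "0 \<le> step_density n t"
  by (auto simp: step_density_def scale_def burn_prob_nonneg intro!: sum_nonneg)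

lemma cell_iff:
  assumes "0 < c"
  shows "t \<in> {real s / c..<(real s + 1) / c} \<longleftrightarrow> 0 \<le> t \<and> s = nat \<lfloor>c * t\<rfloor>"
proof -
  have "t \<in> {real s / c..<(real s + 1) / c} \<longleftrightarrow> real s \<le> c * t \<and> c * t < real s + 1"
    using assms by (simp add: pos_divide_le_eq pos_less_divide_eq mult.commute)
  also have "\<dots> \<longleftrightarrow> 0 \<le> c * t \<and> s = nat \<lfloor>c * t\<rfloor>"
    by (auto; linarith)
  also have "0 \<le> c * t \<longleftrightarrow> 0 \<le> t" using assms by (simp add: zero_le_mult_iff)
  finally show ?thesis .
qed

lemma step_density_eq:
  assumes "regular n" "0 \<le> t"
  shows "step_density n t = scale n * burn_prob (N n) (k n) (nat \<lfloor>scale n * t\<rfloor>)"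
proof -
  let ?m = "nat \<lfloor>scale n * t\<rfloor>"
  have "step_density n t = (\<Sum>s\<in>{..N n}. if s = ?m then scale n * burn_prob (N n) (k n) ?m else 0)"
    unfolding step_density_def using assms cell_iff[OF scale_pos[OF assms(1)], of t]
    by (auto intro!: sum.cong simp: indicator_def)
  then show ?thesis by (auto simp: burn_prob_eq_0)
qed

text \<open>Cutting at the right end of cell \<open>m\<close> makes the integral equal to a partial
  sum, without boundary term.\<close>

lemma step_density_integral:
  assumes "regular n"
  shows "integrable lborel (\<lambda>t. step_density n t * indicator {..<(real m + 1) / scale n} t)"
    and "(\<integral>t. step_density n t * indicator {..<(real m + 1) / scale n} t \<partial>lborel) = (\<Sum>s\<le>m. burn_prob (N n) (k n) s)"
proof -
  note pos = scale_pos[OF assms]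
  let ?b = "burn_prob (N n) (k n)" and ?c = "scale n"
  let ?cell = "\<lambda>s. {real s / ?c..<(real s + 1) / ?c}"
  have eq: "step_density n t * indicator {..<(real m + 1) / ?c} t =
      (\<Sum>s\<le>N n. (?c * ?b s * of_bool (s \<le> m)) * indicator (?cell s) t)" for t
  proof -
    have "indicator (?cell s) t * indicator {..<(real m + 1) / ?c} t = of_bool (s \<le> m) * (indicator (?cell s) t :: real)" for s
    proof (cases "t \<in> ?cell s")
      case True
      then have "real s \<le> ?c * t" "?c * t < real s + 1"
        using pos by (auto simp: pos_divide_le_eq pos_less_divide_eq mult.commute)
      then have "?c * t < real m + 1 \<longleftrightarrow> s \<le> m" by linarith
      moreover have "t < (real m + 1) / ?c \<longleftrightarrow> ?c * t < real m + 1"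
        using pos by (simp add: pos_less_divide_eq mult.commute)
      ultimately show ?thesis using True by (simp add: indicator_def)
    qed simp
    then show ?thesis using assms
      by (auto simp: step_density_def sum_distrib_right mult.assoc intro!: sum.cong)
  qed
  have cell: "emeasure lborel (?cell s) = ennreal (1 / ?c)" for s
    using pos by (subst emeasure_lborel_Ico) (auto simp: divide_right_mono diff_divide_distrib[symmetric])
  then have int: "integrable lborel (\<lambda>t. a * indicator (?cell s) t :: real)" for a s
    by (intro integrable_mult_right integrable_real_indicator) auto
  show "integrable lborel (\<lambda>t. step_density n t * indicator {..<(real m + 1) / ?c} t)"
    unfolding eq by (intro Bochner_Integration.integrable_sum int)
  have "(\<integral>t. step_density n t * indicator {..<(real m + 1) / ?c} t \<partial>lborel) =
      (\<Sum>s\<le>N n. \<integral>t. (?c * ?b s * of_bool (s \<le> m)) * indicator (?cell s) t \<partial>lborel)"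
    unfolding eq by (rule Bochner_Integration.integral_sum) (rule int)
  also have "\<dots> = (\<Sum>s\<le>N n. ?b s * of_bool (s \<le> m))"
    using pos cell by (intro sum.cong refl) (simp add: measure_def)
  also have "\<dots> = (\<Sum>s\<le>N n. if s \<in> {..m} then ?b s else 0)" by (intro sum.cong) auto
  also have "\<dots> = (\<Sum>s\<in>{..N n} \<inter> {..m}. ?b s)" by (rule sum.inter_restrict[symmetric]) simp
  also have "\<dots> = (\<Sum>s\<le>m. ?b s)"
    by (rule sum.mono_neutral_left) (auto, metis burn_prob_eq_0 not_le)
  finally show "(\<integral>t. step_density n t * indicator {..<(real m + 1) / ?c} t \<partial>lborel) = (\<Sum>s\<le>m. ?b s)" .
qed

lemma nn_integral_step_density: "(\<integral>\<^sup>+t. step_density n t \<partial>lborel) \<le> 1"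
proof (cases "regular n")
  case True
  have "step_density n t * indicator {..<(real (N n) + 1) / scale n} t = step_density n t" for t
  proof (cases "t < (real (N n) + 1) / scale n")
    case False
    then have "real (N n) + 1 \<le> scale n * t" using scale_pos[OF True] by (simp add: not_less pos_divide_le_eq mult.commute)
    then have "0 \<le> scale n * t" "N n < nat \<lfloor>scale n * t\<rfloor>" by linarith+
    moreover from this(1) have "0 \<le> t" using scale_pos[OF True] by (simp add: zero_le_mult_iff)
    ultimately show ?thesis using step_density_eq[OF True] by (simp add: burn_prob_eq_0)
  qed simp
  with step_density_integral[OF True, of "N n"]
  have "integrable lborel (step_density n)" "(\<integral>t. step_density n t \<partial>lborel) = 1"
    using sum_burn_prob[of "k n" "N n"] True by (auto simp: regular_def)
  then show ?thesis using nn_integral_eq_integral[of lborel "step_density n"] step_density_nonneg by simp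
qed (simp add: step_density_def)

lemma step_density_tendsto:
  assumes "t \<noteq> 0"
  shows "(\<lambda>n. step_density n t) \<longlonglongrightarrow> sq_density t"
proof (cases "0 < t")
  case True
  have "(\<lambda>n. real (nat \<lfloor>scale n * t\<rfloor>) * (real (k n))\<^sup>2 / (real (N n))\<^sup>2) \<longlonglongrightarrow> t"
    using scaled_floor_tendsto[of t] True by (simp add: scale_def power_divide)
  from burn_prob_local_limit[OF True this]
  have "(\<lambda>n. scale n * burn_prob (N n) (k n) (nat \<lfloor>scale n * t\<rfloor>)) \<longlonglongrightarrow> sq_density t"
    using True by (simp add: scale_def sq_density_def)
  then show ?thesis
    by (rule Lim_transform_eventually)
      (use eventually_regular in eventually_elim, use True in \<open>simp add: step_density_eq\<close>)
next
  case False
  then have "t < 0" using assms by simp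
  have "step_density n t = 0" for n
  proof (cases "regular n")
    case True
    have "indicator {real s / scale n..<(real s + 1) / scale n} t = (0 :: real)" for s
      using cell_iff[OF scale_pos[OF True], of t s] \<open>t < 0\<close> unfolding indicator_def by auto
    then show ?thesis by (simp add: step_density_def)
  qed (simp add: step_density_def)
  then show ?thesis using False by (simp add: sq_density_def)
qed

text \<open>Scheffe's lemma: pointwise convergence of densities whose mass does not exceed that of
  the limit yields convergence in \<open>L1\<close>, hence closeness of integrals over any
  half-line.\<close>

lemma burn_cdf_tendsto:
  assumes "0 \<le> y"
  shows "(\<lambda>n. \<Sum>s\<le>nat \<lfloor>scale n * y\<rfloor>. burn_prob (N n) (k n) s) \<longlonglongrightarrow> sq_cdf y"
proof -
  let ?m = "\<lambda>n. nat \<lfloor>scale n * y\<rfloor>"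
  \<comment> \<open>The right end of the cell containing \<open>y\<close>, at distance at most
    \<open>1 / scale n\<close> from \<open>y\<close>.\<close>
  define Y where "Y n = (real (?m n) + 1) / scale n" for n
  define d where "d n = (\<integral>\<^sup>+t. norm (step_density n t - sq_density t) \<partial>lborel)" for n
  have "d \<longlonglongrightarrow> 0"
    unfolding d_def
  proof (rule Scheffe_lemma2[OF _ integrable_sq_density])
    show "AE t in lborel. (\<lambda>n. step_density n t) \<longlonglongrightarrow> sq_density t"
      using AE_lborel_singleton[of 0] by eventually_elim (rule step_density_tendsto)
    show "(\<integral>\<^sup>+t. norm (step_density n t) \<partial>lborel) \<le> (\<integral>\<^sup>+t. norm (sq_density t) \<partial>lborel)" for n
      using nn_integral_step_density[of n] nn_integral_sq_density by (simp add: step_density_nonneg sq_density_nonneg)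
  qed auto
  have "(\<lambda>n. (\<Sum>s\<le>?m n. burn_prob (N n) (k n) s) - sq_cdf (Y n)) \<longlonglongrightarrow> 0"
  proof (rule Lim_null_comparison)
    show "(\<lambda>n. enn2real (d n)) \<longlonglongrightarrow> 0" using tendsto_enn2real[of d 0 sequentially] \<open>d \<longlonglongrightarrow> 0\<close> by simp
    have dfin: "eventually (\<lambda>n. d n < \<infinity>) sequentially"
      by (rule order_tendstoD(2)[OF \<open>d \<longlonglongrightarrow> 0\<close>]) simp
    show "eventually (\<lambda>n. norm ((\<Sum>s\<le>?m n. burn_prob (N n) (k n) s) - sq_cdf (Y n)) \<le> enn2real (d n)) sequentially"
      using dfin eventually_regular
    proof eventually_elim
      case (elim n)
      let ?I = "indicator {..<Y n} :: real \<Rightarrow> real"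
      have Y: "0 \<le> Y n" using scale_pos[OF elim(2)] by (simp add: Y_def)
      have int: "integrable lborel (\<lambda>t. sq_density t * ?I t)"
        by (intro integrable_real_mult_indicator integrable_sq_density) auto
      note st = step_density_integral[OF elim(2), of "?m n", folded Y_def]
      have "sq_cdf (Y n) = (\<integral>t. sq_density t * ?I t \<partial>lborel)"
        unfolding sq_cdf_eq[OF Y]
        by (rule integral_cong_AE) (use AE_lborel_singleton[of "Y n"] in \<open>auto elim!: eventually_mono simp: indicator_def\<close>)
      then have "(\<Sum>s\<le>?m n. burn_prob (N n) (k n) s) - sq_cdf (Y n) =
          (\<integral>t. step_density n t * ?I t - sq_density t * ?I t \<partial>lborel)"
        using st int by simp
      moreover have "ennreal (norm (\<integral>t. step_density n t * ?I t - sq_density t * ?I t \<partial>lborel)) \<le>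
          (\<integral>\<^sup>+t. norm (step_density n t * ?I t - sq_density t * ?I t) \<partial>lborel)"
        by (rule integral_norm_bound_ennreal) (intro Bochner_Integration.integrable_diff st int)
      moreover have "\<dots> \<le> d n"
        unfolding d_def by (rule nn_integral_mono) (auto simp: indicator_def)
      ultimately have "ennreal (norm ((\<Sum>s\<le>?m n. burn_prob (N n) (k n) s) - sq_cdf (Y n))) \<le> d n"
        by simp
      then show ?case using elim(1) by (metis enn2real_ennreal enn2real_mono infinity_ennreal_def norm_ge_zero)
    qed
  qed
  moreover have "(\<lambda>n. sq_cdf (Y n)) \<longlonglongrightarrow> sq_cdf y"
  proof (rule sq_cdf_tendsto)
    show "0 \<le> Y n" for n by (simp add: Y_def scale_def)
    have "(\<lambda>n. real (?m n) / scale n + inverse (scale n)) \<longlonglongrightarrow> y + 0"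
      by (intro tendsto_add scaled_floor_tendsto assms tendsto_inverse_0_at_top scale_sq_at_top)
    then show "Y \<longlonglongrightarrow> y" by (simp add: Y_def[abs_def] add_divide_distrib inverse_eq_divide)
  qed
  ultimately show ?thesis using tendsto_add by fastforce
qed

end

section \<open>Coupling\<close>

definition burn_quantile :: "nat \<Rightarrow> nat \<Rightarrow> real \<Rightarrow> nat" where
  "burn_quantile N k u = (LEAST s. u \<le> (\<Sum>i\<le>s. burn_prob N k i))"

lemma burn_cdf_mono: "s \<le> t \<Longrightarrow> (\<Sum>i\<le>s. burn_prob N k i) \<le> (\<Sum>i\<le>t. burn_prob N k i)"
  by (rule sum_mono2) (auto simp: burn_prob_nonneg)

lemma burn_cdf_le_1:
  assumes "0 < k" "k < N"
  shows "(\<Sum>i\<le>s. burn_prob N k i) \<le> 1"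
proof -
  have "(\<Sum>i\<le>s. burn_prob N k i) \<le> (\<Sum>i\<le>max s N. burn_prob N k i)" by (rule burn_cdf_mono) simp
  also have "\<dots> = (\<Sum>i\<le>N. burn_prob N k i)"
    by (rule sum.mono_neutral_right) (auto simp: burn_prob_eq_0)
  finally show ?thesis using sum_burn_prob[OF assms] by simp
qed

lemma burn_quantile_le_iff:
  assumes "0 < k" "k < N" "u \<le> 1"
  shows "burn_quantile N k u \<le> s \<longleftrightarrow> u \<le> (\<Sum>i\<le>s. burn_prob N k i)"
proof
  assume "u \<le> (\<Sum>i\<le>s. burn_prob N k i)"
  then show "burn_quantile N k u \<le> s" unfolding burn_quantile_def by (rule Least_le)
next
  assume le: "burn_quantile N k u \<le> s"
  have "u \<le> (\<Sum>i\<le>N. burn_prob N k i)" using sum_burn_prob[OF assms(1,2)] assms(3) by simp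
  then have "u \<le> (\<Sum>i\<le>burn_quantile N k u. burn_prob N k i)" unfolding burn_quantile_def by (rule LeastI)
  then show "u \<le> (\<Sum>i\<le>s. burn_prob N k i)" using burn_cdf_mono[OF le, of N k] by simp
qed

lemma burn_quantile_eq_iff:
  assumes "0 < k" "k < N" "u \<le> 1"
  shows "burn_quantile N k u = s \<longleftrightarrow>
    u \<le> (\<Sum>i\<le>s. burn_prob N k i) \<and> (s = 0 \<or> \<not> u \<le> (\<Sum>i\<le>s - 1. burn_prob N k i))"
  unfolding burn_quantile_le_iff[OF assms, symmetric] by (cases s) auto

lemma burn_quantile_le:
  assumes "0 < k" "k < N" "u \<le> 1"
  shows "burn_quantile N k u \<le> N"
  using burn_quantile_le_iff[OF assms, of N] sum_burn_prob[OF assms(1,2)] assms(3) by simp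

text \<open>Mass at least \<open>1 - u\<close> sits at sizes not below the quantile, so quantile
  times \<open>1 - u\<close> is at most the mean.\<close>

lemma burn_quantile_mean:
  assumes "0 < k" "k < N" "u < 1"
  shows "real (burn_quantile N k u) \<le> 2 * (real N)\<^sup>2 / ((real k)\<^sup>2 * (1 - u))"
proof (cases "burn_quantile N k u")
  case (Suc s)
  let ?q = "burn_prob N k"
  have QN: "Suc s \<le> N" using burn_quantile_le[of k N u] assms Suc by simp
  have "\<not> burn_quantile N k u \<le> s" using Suc by simp
  then have lt: "(\<Sum>i\<le>s. ?q i) < u" using burn_quantile_le_iff[of k N u s] assms by simp
  have "{..N} = {..s} \<union> {Suc s..N}" using QN by auto
  then have "(\<Sum>i\<le>N. ?q i) = (\<Sum>i\<le>s. ?q i) + (\<Sum>i\<in>{Suc s..N}. ?q i)"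
    by (metis finite_atMost finite_atLeastAtMost sum.union_disjoint ivl_disj_int_one(8) disjoint_iff atMost_iff atLeastAtMost_iff not_less_eq_eq)
  then have "1 - u \<le> (\<Sum>i\<in>{Suc s..N}. ?q i)" using lt sum_burn_prob[OF assms(1,2)] by simp
  then have "real (Suc s) * (1 - u) \<le> real (Suc s) * (\<Sum>i\<in>{Suc s..N}. ?q i)" by (intro mult_left_mono) auto
  also have "\<dots> \<le> (\<Sum>i\<in>{Suc s..N}. ?q i * real i)"
    unfolding sum_distrib_left
  proof (rule sum_mono)
    fix i assume "i \<in> {Suc s..N}"
    then have "real (Suc s) * ?q i \<le> real i * ?q i" by (intro mult_right_mono burn_prob_nonneg) simp
    then show "real (Suc s) * ?q i \<le> ?q i * real i" by (simp only: mult.commute)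
  qed
  also have "\<dots> \<le> (\<Sum>i\<le>N. ?q i * real i)" by (rule sum_mono2) (auto simp: burn_prob_nonneg)
  also have "\<dots> \<le> 2 * (real N)\<^sup>2 / (real k)\<^sup>2" by (rule burn_mean_le[OF assms(1,2)])
  finally show ?thesis using assms unfolding Suc
    by (simp add: pos_le_divide_eq mult.assoc[symmetric] mult.commute[of "(real k)\<^sup>2"])
qed (use assms in simp)

text \<open>
  The list of burnt sizes from the state with \<open>N\<close> vertices and \<open>k\<close> trees on, when \<open>i\<close> fires have already
  occurred; the first argument is the fuel of the recursion. The case \<open>k + g i = 0\<close> is excluded because
  \<open>burn_quantile\<close> is unspecified there.
\<close>

fun coupled :: "nat \<Rightarrow> nat \<Rightarrow> nat \<Rightarrow> nat \<Rightarrow> (nat \<Rightarrow> nat) \<Rightarrow> (nat \<Rightarrow> real) \<Rightarrow> nat list" where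
  "coupled 0 i N k g u = []"
| "coupled (Suc f) i N k g u = (if N \<le> k + g i \<or> k + g i = 0 then [] else
     burn_quantile N (k + g i) (u i) #
       coupled f (Suc i) (N - burn_quantile N (k + g i) (u i)) (k + g i - 1) g u)"

section \<open>The law of the coupled list\<close>

text \<open>\<open>G i\<close> prescribes the number of edges made fireproof just before fire
  \<open>i\<close>, counted from 0, and \<open>U i\<close> the level of the quantile that fire
  burns. Independence is stated for rectangles, the only events that the recursion produces.\<close>

locale coupling = prob_space M for M :: "'w measure" +
  fixes G :: "nat \<Rightarrow> 'w \<Rightarrow> nat" and U :: "nat \<Rightarrow> 'w \<Rightarrow> real" and p :: real
  assumes p: "0 < p" "p < 1"
    and G_meas [measurable]: "\<And>i. G i \<in> M \<rightarrow>\<^sub>M count_space UNIV"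
    and U_meas [measurable]: "\<And>i. U i \<in> borel_measurable M"
    and U_less_1: "\<And>i \<omega>. U i \<omega> < 1"
    and G_law: "\<And>i a. prob {\<omega>\<in>space M. a \<le> G i \<omega>} = (1 - p) ^ a"
    and U_law: "\<And>i t. 0 \<le> t \<Longrightarrow> t \<le> 1 \<Longrightarrow> prob {\<omega>\<in>space M. U i \<omega> \<le> t} = t"
    and indep: "\<And>A B i. (\<And>j. B j \<in> sets borel) \<Longrightarrow> prob {\<omega>\<in>space M. \<forall>j<i. G j \<omega> \<in> A j \<and> U j \<omega> \<in> B j} =
      (\<Prod>j<i. prob {\<omega>\<in>space M. G j \<omega> \<in> A j} * prob {\<omega>\<in>space M. U j \<omega> \<in> B j})"
begin

abbreviation coupled_list :: "nat \<Rightarrow> nat \<Rightarrow> nat \<Rightarrow> nat \<Rightarrow> 'w \<Rightarrow> nat list" where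
  "coupled_list f i N k \<omega> \<equiv> coupled f i N k (\<lambda>i. G i \<omega>) (\<lambda>i. U i \<omega>)"

lemma burn_quantile_measurable:
  assumes "0 < k" "k < N"
  shows "(\<lambda>\<omega>. burn_quantile N k (U i \<omega>)) \<in> M \<rightarrow>\<^sub>M count_space UNIV"
proof (rule measurable_count_space_eq2_countable[THEN iffD2, rule_format], safe)
  fix s :: nat
  let ?F = "\<lambda>s. \<Sum>j\<le>s. burn_prob N k j"
  have eq: "(\<lambda>\<omega>. burn_quantile N k (U i \<omega>)) -` {s} \<inter> space M =
      {\<omega>\<in>space M. U i \<omega> \<le> ?F s \<and> (s = 0 \<or> \<not> U i \<omega> \<le> ?F (s - 1))}"
    unfolding burn_quantile_eq_iff[OF assms less_imp_le[OF U_less_1], symmetric] by auto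
  show "(\<lambda>\<omega>. burn_quantile N k (U i \<omega>)) -` {s} \<inter> space M \<in> sets M"
    unfolding eq by measurable
qed auto

lemma burn_quantile_law:
  assumes "0 < k" "k < N"
  shows "prob {\<omega>\<in>space M. burn_quantile N k (U i \<omega>) = s} = burn_prob N k s"
proof -
  let ?F = "\<lambda>s. \<Sum>j\<le>s. burn_prob N k j"
  have le: "prob {\<omega>\<in>space M. burn_quantile N k (U i \<omega>) \<le> s} = ?F s" for s
    using U_law[of "?F s" i] burn_cdf_le_1[OF assms, of s]
    by (simp add: burn_quantile_le_iff[OF assms less_imp_le[OF U_less_1]] sum_nonneg burn_prob_nonneg)
  show ?thesis
  proof (cases s)
    case 0
    then show ?thesis using le[of 0] by simp
  next
    case (Suc t)
    have "{\<omega>\<in>space M. burn_quantile N k (U i \<omega>) = s} =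
        {\<omega>\<in>space M. burn_quantile N k (U i \<omega>) \<le> s} - {\<omega>\<in>space M. burn_quantile N k (U i \<omega>) \<le> t}"
      using Suc by auto
    moreover note [measurable] = burn_quantile_measurable[OF assms]
    have "prob ({\<omega>\<in>space M. burn_quantile N k (U i \<omega>) \<le> s} - {\<omega>\<in>space M. burn_quantile N k (U i \<omega>) \<le> t}) =
        ?F s - ?F t"
      unfolding le[symmetric] using Suc by (intro finite_measure_Diff) auto
    ultimately show ?thesis using Suc by simp
  qed
qed

lemma coupled_list_measurable [measurable]: "coupled_list f i N k \<in> M \<rightarrow>\<^sub>M count_space UNIV"
proof (induction f arbitrary: i N k)
  case (Suc f)
  have inner: "(\<lambda>\<omega>. if N \<le> j \<or> j = 0 then [] else burn_quantile N j (U i \<omega>) #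
      coupled_list f (Suc i) (N - burn_quantile N j (U i \<omega>)) (j - 1) \<omega>) \<in> M \<rightarrow>\<^sub>M count_space UNIV" for j
  proof (cases "N \<le> j \<or> j = 0")
    case False
    then have j: "0 < j" "j < N" by auto
    have "(\<lambda>\<omega>. s # coupled_list f (Suc i) (N - s) (j - 1) \<omega>) \<in> M \<rightarrow>\<^sub>M count_space UNIV" for s
      by (rule measurable_compose[OF Suc]) simp
    from measurable_compose_countable[OF this burn_quantile_measurable[OF j]] False show ?thesis by simp
  qed simp
  have "(\<lambda>\<omega>. k + G i \<omega>) \<in> M \<rightarrow>\<^sub>M count_space UNIV" by measurable
  from measurable_compose_countable[OF inner this] show ?case by (simp only: coupled.simps)
qed simp

definition cylinder :: "nat \<Rightarrow> (nat \<Rightarrow> nat set) \<Rightarrow> (nat \<Rightarrow> real set) \<Rightarrow> 'w set" where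
  "cylinder i A B = {\<omega>\<in>space M. \<forall>j<i. G j \<omega> \<in> A j \<and> U j \<omega> \<in> B j}"

lemma cylinder_Suc:
  assumes "\<And>j. B j \<in> sets borel"  "C \<in> sets borel"
  shows "prob (cylinder i A B \<inter> {\<omega>\<in>space M. G i \<omega> \<in> D \<and> U i \<omega> \<in> C}) =
    prob (cylinder i A B) * (prob {\<omega>\<in>space M. G i \<omega> \<in> D} * prob {\<omega>\<in>space M. U i \<omega> \<in> C})"
    and "cylinder i A B \<inter> {\<omega>\<in>space M. G i \<omega> \<in> D \<and> U i \<omega> \<in> C} = cylinder (Suc i) (A(i := D)) (B(i := C))"
proof -
  show eq: "cylinder i A B \<inter> {\<omega>\<in>space M. G i \<omega> \<in> D \<and> U i \<omega> \<in> C} = cylinder (Suc i) (A(i := D)) (B(i := C))"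
    by (auto simp: cylinder_def less_Suc_eq)
  have "(B(i := C)) j \<in> sets borel" for j using assms by simp
  then have "prob (cylinder (Suc i) (A(i := D)) (B(i := C))) =
      (\<Prod>j<Suc i. prob {\<omega>\<in>space M. G j \<omega> \<in> (A(i := D)) j} * prob {\<omega>\<in>space M. U j \<omega> \<in> (B(i := C)) j})"
    unfolding cylinder_def by (rule indep)
  moreover have "prob (cylinder i A B) = (\<Prod>j<i. prob {\<omega>\<in>space M. G j \<omega> \<in> A j} * prob {\<omega>\<in>space M. U j \<omega> \<in> B j})"
    unfolding cylinder_def by (rule indep[OF assms(1)])
  ultimately show "prob (cylinder i A B \<inter> {\<omega>\<in>space M. G i \<omega> \<in> D \<and> U i \<omega> \<in> C}) =
      prob (cylinder i A B) * (prob {\<omega>\<in>space M. G i \<omega> \<in> D} * prob {\<omega>\<in>space M. U i \<omega> \<in> C})"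
    unfolding eq by (simp add: prod.lessThan_Suc)
qed

lemma G_point: "prob {\<omega>\<in>space M. G i \<omega> = a} = (1 - p) ^ a * p"
proof -
  have m: "{\<omega>\<in>space M. b \<le> G i \<omega>} \<in> sets M" for b by measurable
  have "{\<omega>\<in>space M. G i \<omega> = a} = {\<omega>\<in>space M. a \<le> G i \<omega>} - {\<omega>\<in>space M. Suc a \<le> G i \<omega>}" by auto
  moreover have "prob ({\<omega>\<in>space M. a \<le> G i \<omega>} - {\<omega>\<in>space M. Suc a \<le> G i \<omega>}) =
      prob {\<omega>\<in>space M. a \<le> G i \<omega>} - prob {\<omega>\<in>space M. Suc a \<le> G i \<omega>}"
    by (rule finite_measure_Diff[OF m m]) auto
  ultimately show ?thesis unfolding G_law by (simp add: algebra_simps)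
qed

lemma cylinder_subset: "cylinder i A B \<subseteq> space M"
  unfolding cylinder_def by blast

lemma cylinder_sets:
  assumes "\<And>j. B j \<in> sets borel"
  shows "cylinder i A B \<in> sets M"
proof (induction i)
  case (Suc i)
  have "cylinder (Suc i) A B = cylinder i A B \<inter> (G i -` A i \<inter> space M) \<inter> (U i -` B i \<inter> space M)"
    by (auto simp: cylinder_def less_Suc_eq)
  then show ?case
    using Suc measurable_sets[OF G_meas, of "A i" i] measurable_sets[OF U_meas assms, of i i] by simp
qed (simp add: cylinder_def)

text \<open>The cylinder in the earlier variables is what lets the induction pass a fire: fixing
  \<open>G i\<close> and the quantile at level \<open>U i\<close> enlarges the cylinder by one
  coordinate. Fuel \<open>N\<close> suffices, since sizes below 2 have probability 0.\<close>

lemma coupled_list_law: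
  assumes "N \<le> f" "0 < k \<or> N = 0" "\<And>j. B j \<in> sets borel"
  shows "prob (cylinder i A B \<inter> {\<omega>\<in>space M. coupled_list f i N k \<omega> = xs}) = prob (cylinder i A B) * burn_law p N k xs"
  using assms
proof (induction f arbitrary: i N k xs A B)
  case 0
  have set: "cylinder i A B \<inter> {\<omega>\<in>space M. coupled_list 0 i N k \<omega> = xs} = (if xs = [] then cylinder i A B else {})"
    using cylinder_subset[of i A B] unfolding coupled.simps(1) by (cases xs) (simp_all add: Int_absorb2)
  have law: "burn_law p N k xs = of_bool (xs = [])" using "0.prems"(1) by (cases xs) simp_all
  show ?case unfolding set law by simp
next
  case (Suc f)
  note B = Suc.prems(3)
  show ?case
  proof (cases xs)
    case Nil
    have "{\<omega>\<in>space M. coupled_list (Suc f) i N k \<omega> = xs} = {\<omega>\<in>space M. G i \<omega> \<in> {a. N - k \<le> a} \<and> U i \<omega> \<in> UNIV}"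
      using Nil Suc.prems(2) by auto
    then show ?thesis using Nil cylinder_Suc(1)[OF B, where C = UNIV and i = i and A = A and D = "{a. N - k \<le> a}"] G_law[of "N - k" i]
      by (simp add: prob_space)
  next
    case (Cons s ys)
    let ?Q = "\<lambda>j. {\<omega>\<in>space M. burn_quantile N j (U i \<omega>) = s}"
    let ?E = "\<lambda>j. cylinder i A B \<inter> {\<omega>\<in>space M. G i \<omega> = j - k \<and> burn_quantile N j (U i \<omega>) = s} \<inter>
      {\<omega>\<in>space M. coupled_list f (Suc i) (N - s) (j - 1) \<omega> = ys}"
    have split: "cylinder i A B \<inter> {\<omega>\<in>space M. coupled_list (Suc f) i N k \<omega> = xs} = (\<Union>j\<in>{k..<N}. ?E j)"
    proof (intro equalityI subsetI)
      fix \<omega> assume w: "\<omega> \<in> cylinder i A B \<inter> {\<omega>\<in>space M. coupled_list (Suc f) i N k \<omega> = xs}"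
      then have "\<not> (N \<le> k + G i \<omega> \<or> k + G i \<omega> = 0)" using Cons by (auto split: if_splits)
      then have "\<omega> \<in> ?E (k + G i \<omega>)" "k + G i \<omega> \<in> {k..<N}" using w Cons by auto
      then show "\<omega> \<in> (\<Union>j\<in>{k..<N}. ?E j)" by blast
    next
      fix \<omega> assume "\<omega> \<in> (\<Union>j\<in>{k..<N}. ?E j)"
      then show "\<omega> \<in> cylinder i A B \<inter> {\<omega>\<in>space M. coupled_list (Suc f) i N k \<omega> = xs}"
        using Cons Suc.prems(2) by auto
    qed
    have E: "?E j \<in> sets M \<and> prob (?E j) = prob (cylinder i A B) * ((1 - p) ^ (j - k) * p * burn_prob N j s * burn_law p (N - s) (j - 1) ys)"
      if j: "j \<in> {k..<N}" for j
    proof -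
      have j0: "0 < j" "j < N" using j Suc.prems(2) by auto
      note [measurable] = burn_quantile_measurable[OF j0, of i]
      have "{\<omega>\<in>space M. G i \<omega> = j - k \<and> burn_quantile N j (U i \<omega>) = s} \<in> sets M"
        "{\<omega>\<in>space M. coupled_list f (Suc i) (N - s) (j - 1) \<omega> = ys} \<in> sets M"
        by measurable
      then have Em: "?E j \<in> sets M" by (intro sets.Int cylinder_sets B)
      \<comment> \<open>Together with \<open>C\<close>, the half-open interval of levels whose
        quantile is \<open>s\<close>; at \<open>s = 0\<close> it has no left end.\<close>
      define L where "L = (if s = 0 then {} else {..\<Sum>l\<le>s - 1. burn_prob N j l})"
      define C where "C = {..\<Sum>l\<le>s. burn_prob N j l} - L"
      have C: "C \<in> sets borel" by (auto simp: C_def L_def)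
      have UC: "U i \<omega> \<in> C \<longleftrightarrow> burn_quantile N j (U i \<omega>) = s" for \<omega>
        unfolding burn_quantile_eq_iff[OF j0 less_imp_le[OF U_less_1]] by (auto simp: C_def L_def)
      show ?thesis
      \<comment> \<open>Sizes of probability 0 are treated apart: for them the fuel may not suffice,
        or vertices may be left without any tree.\<close>
      proof (cases "burn_prob N j s = 0")
        case True
        have "prob (?E j) \<le> prob (?Q j)" by (rule finite_measure_mono) auto
        then have "prob (?E j) = 0" using burn_quantile_law[OF j0, of i s] True by (simp add: measure_le_0_iff)
        then show ?thesis using True Em by simp
      next
        case False
        then have "2 \<le> s" using burn_prob_eq_0[of s N j] by linarith
        then have "N - s \<le> f" using Suc.prems(1) by simp
        moreover have "0 < j - 1 \<or> N - s = 0"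
        proof (rule ccontr)
          assume "\<not> (0 < j - 1 \<or> N - s = 0)"
          then have "rooted_forests (N - s) (j - 1) = 0" by (simp add: rooted_forests_def)
          with False show False by (simp add: burn_prob_def)
        qed
        moreover have "(B(i := C)) l \<in> sets borel" for l using B C by simp
        ultimately have IH: "prob (cylinder (Suc i) (A(i := {j - k})) (B(i := C)) \<inter> {\<omega>\<in>space M. coupled_list f (Suc i) (N - s) (j - 1) \<omega> = ys}) =
            prob (cylinder (Suc i) (A(i := {j - k})) (B(i := C))) * burn_law p (N - s) (j - 1) ys"
          by (rule Suc.IH)
        have "cylinder i A B \<inter> {\<omega>\<in>space M. G i \<omega> = j - k \<and> burn_quantile N j (U i \<omega>) = s} =
            cylinder (Suc i) (A(i := {j - k})) (B(i := C))"
          unfolding cylinder_Suc(2)[OF B C, where i = i and A = A and D = "{j - k}", symmetric] UC by simp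
        moreover have "prob (cylinder (Suc i) (A(i := {j - k})) (B(i := C))) =
            prob (cylinder i A B) * ((1 - p) ^ (j - k) * p * burn_prob N j s)"
        proof -
          have "prob (cylinder (Suc i) (A(i := {j - k})) (B(i := C))) =
              prob (cylinder i A B) * (prob {\<omega>\<in>space M. G i \<omega> \<in> {j - k}} * prob {\<omega>\<in>space M. U i \<omega> \<in> C})"
            using cylinder_Suc(1)[where B = B and i = i and A = A and D = "{j - k}", OF B C]
            by (simp only: cylinder_Suc(2)[where B = B and i = i and A = A and D = "{j - k}", OF B C])
          then show ?thesis
            unfolding UC singleton_iff burn_quantile_law[OF j0] G_point by (simp only: mult.assoc)
        qed
        ultimately show ?thesis using IH Em by simp
      qed
    qed
    have "prob (\<Union>j\<in>{k..<N}. ?E j) = (\<Sum>j\<in>{k..<N}. prob (?E j))"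
    proof (rule finite_measure_finite_Union)
      show "disjoint_family_on ?E {k..<N}" by (auto simp: disjoint_family_on_def)
      show "?E ` {k..<N} \<subseteq> sets M" using E by blast
    qed simp
    also have "\<dots> = prob (cylinder i A B) * burn_law p N k xs"
      using E Cons by (simp add: sum_distrib_left)
    finally show ?thesis unfolding split .
  qed
qed

theorem distr_coupled_list:
  assumes "1 \<le> n"
  shows "distr M (count_space UNIV) (coupled_list n 0 n 1) = measure_pmf (burnt_subtree_sizes n p)"
proof (rule measure_eqI_countable[where A = UNIV])
  fix xs :: "nat list"
  have "emeasure (distr M (count_space UNIV) (coupled_list n 0 n 1)) {xs} = emeasure M {\<omega>\<in>space M. coupled_list n 0 n 1 \<omega> = xs}"
    by (subst emeasure_distr) (auto intro!: arg_cong[where f = "emeasure M"])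
  also have "\<dots> = ennreal (burn_law p n 1 xs)"
    using coupled_list_law[of n n 1 "\<lambda>_. UNIV" 0 "\<lambda>_. UNIV" xs] by (simp add: emeasure_eq_measure cylinder_def prob_space Int_absorb1)
  also have "\<dots> = emeasure (measure_pmf (burnt_subtree_sizes n p)) {xs}"
    using pmf_burnt_subtree_sizes[of p n xs] p assms by (simp add: emeasure_pmf_single)
  finally show "emeasure (distr M (count_space UNIV) (coupled_list n 0 n 1)) {xs} = emeasure (measure_pmf (burnt_subtree_sizes n p)) {xs}" .
qed auto

end

section \<open>Convergence and domination of the coupled sizes\<close>

text \<open>If \<open>a < y < b\<close>, then \<open>sq_cdf y\<close> lies strictly between
  \<open>sq_cdf a\<close> and \<open>sq_cdf b\<close> (for \<open>a \<ge> 0\<close>), so the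
  rescaled quantile at this level is eventually trapped between \<open>a\<close> and
  \<open>b\<close>.\<close>

lemma (in regime) burn_quantile_tendsto:
  assumes "0 \<le> y"
  shows "(\<lambda>n. real (burn_quantile (N n) (k n) (sq_cdf y)) / scale n) \<longlonglongrightarrow> y"
proof (rule order_tendstoI)
  fix a assume a: "a < y"
  show "eventually (\<lambda>n. a < real (burn_quantile (N n) (k n) (sq_cdf y)) / scale n) sequentially"
  proof (cases "a < 0")
    case True
    have "0 \<le> real (burn_quantile (N n) (k n) (sq_cdf y)) / scale n" for n by (simp add: scale_def)
    then show ?thesis using True by (intro always_eventually allI) (meson less_le_trans)
  next
    case False
    then have "sq_cdf a < sq_cdf y" using a by (intro sq_cdf_strict_mono) auto
    from order_tendstoD(2)[OF burn_cdf_tendsto this] False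
    have "eventually (\<lambda>n. (\<Sum>s\<le>nat \<lfloor>scale n * a\<rfloor>. burn_prob (N n) (k n) s) < sq_cdf y) sequentially" by simp
    then show ?thesis using eventually_regular
    proof eventually_elim
      case (elim n)
      then have "\<not> burn_quantile (N n) (k n) (sq_cdf y) \<le> nat \<lfloor>scale n * a\<rfloor>"
        using burn_quantile_le_iff[of "k n" "N n" "sq_cdf y"] sq_cdf_range by (auto simp: regular_def)
      then have "scale n * a < real (burn_quantile (N n) (k n) (sq_cdf y))" by linarith
      then show ?case using scale_pos[OF elim(2)] by (simp add: pos_less_divide_eq mult.commute)
    qed
  qed
next
  fix a assume "y < a"
  then obtain b where b: "y < b" "b < a" using dense by blast
  then have "sq_cdf y < sq_cdf b" using assms by (intro sq_cdf_strict_mono) auto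
  from order_tendstoD(1)[OF burn_cdf_tendsto this] b assms
  have "eventually (\<lambda>n. sq_cdf y < (\<Sum>s\<le>nat \<lfloor>scale n * b\<rfloor>. burn_prob (N n) (k n) s)) sequentially" by simp
  then show "eventually (\<lambda>n. real (burn_quantile (N n) (k n) (sq_cdf y)) / scale n < a) sequentially"
    using eventually_regular
  proof eventually_elim
    case (elim n)
    then have "burn_quantile (N n) (k n) (sq_cdf y) \<le> nat \<lfloor>scale n * b\<rfloor>"
      using burn_quantile_le_iff[of "k n" "N n" "sq_cdf y"] sq_cdf_range by (auto simp: regular_def)
    moreover have pos: "0 \<le> scale n * b" using scale_pos[OF elim(2)] b assms by simp
    ultimately have "real (burn_quantile (N n) (k n) (sq_cdf y)) \<le> scale n * b" by linarith
    also have "\<dots> < scale n * a" using scale_pos[OF elim(2)] b by simp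
    finally show ?case using scale_pos[OF elim(2)] by (simp add: pos_divide_less_eq mult.commute)
  qed
qed

definition coord :: "nat list \<Rightarrow> nat \<Rightarrow> real" where
  "coord xs i = (if i < length xs then real (xs ! i) else 0)"

lemma coord_Cons: "coord (x # xs) 0 = real x" "coord (x # xs) (Suc i) = coord xs i"
  by (auto simp: coord_def)

locale fire_regime =
  fixes p :: "nat \<Rightarrow> real"
  assumes p_range: "eventually (\<lambda>n. 0 < p n \<and> p n < 1) sequentially"
    and p_small: "(\<lambda>n. sqrt (real n) * p n) \<longlonglongrightarrow> 0"
    and p_large: "filterlim (\<lambda>n. real n * p n) at_top sequentially"
begin

lemma p_null: "p \<longlonglongrightarrow> 0"
proof (rule Lim_null_comparison[OF _ p_small])
  show "eventually (\<lambda>n. norm (p n) \<le> sqrt (real n) * p n) sequentially"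
    using p_range eventually_ge_at_top[of 1]
  proof eventually_elim
    case (elim n)
    then have "1 * p n \<le> sqrt (real n) * p n" by (intro mult_right_mono) auto
    then show ?case using elim by simp
  qed
qed

lemma p_at_right: "filterlim p (at_right 0) sequentially"
  unfolding filterlim_at using p_null p_range by (auto elim!: eventually_mono)

lemma p_rate: "(\<lambda>n. p n / - ln (1 - p n)) \<longlonglongrightarrow> 1"
proof -
  have "((\<lambda>x :: real. x / - ln (1 - x)) \<longlongrightarrow> 1) (at_right 0)" by real_asymp
  from filterlim_compose[OF this p_at_right] show ?thesis .
qed

text \<open>With \<open>\<kappa>\<close> about \<open>(x + e j) / p n\<close> trees at the fire,
  \<open>\<kappa> / N\<close> is of order \<open>1 / (n * p n)\<close> and
  \<open>N / \<kappa>^2\<close> of order \<open>n * (p n)^2\<close>; so the two limits assumed for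
  \<open>p\<close> put the fire into \<open>regime\<close>. The burnt size divided by
  \<open>n\<close> is again of order \<open>n * (p n)^2\<close>, hence the assumptions on
  \<open>N\<close> and \<open>k\<close> hold for the next fire.\<close>

lemma coupled_step:
  fixes e y :: "nat \<Rightarrow> real" and g :: "nat \<Rightarrow> nat \<Rightarrow> nat" and j :: nat
  assumes e: "\<And>i. 0 < e i" and y: "\<And>i. 0 \<le> y i" and g: "\<And>i. (\<lambda>n. p n * real (g n i)) \<longlonglongrightarrow> e i"
    and N: "(\<lambda>n. real (N n) / real n) \<longlonglongrightarrow> 1" and k: "(\<lambda>n. p n * real (k n)) \<longlonglongrightarrow> x" "0 \<le> x"
    and f: "filterlim f at_top sequentially"
  defines "s \<equiv> \<lambda>n. burn_quantile (N n) (k n + g n j) (sq_cdf (y j))"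
  shows "(\<lambda>n. real (s n) / (real n * p n)\<^sup>2) \<longlonglongrightarrow> y j / (x + e j)\<^sup>2"
    and "eventually (\<lambda>n. coupled (f n) j (N n) (k n) (g n) (\<lambda>i. sq_cdf (y i)) =
      s n # coupled (f n - 1) (Suc j) (N n - s n) (k n + g n j - 1) (g n) (\<lambda>i. sq_cdf (y i))) sequentially"
    and "(\<lambda>n. real (N n - s n) / real n) \<longlonglongrightarrow> 1" "(\<lambda>n. p n * real (k n + g n j - 1)) \<longlonglongrightarrow> x + e j"
proof -
  define \<kappa> where "\<kappa> n = k n + g n j" for n
  define c where "c = x + e j"
  have c: "0 < c" using k(2) e[of j] by (simp add: c_def)
  have lim: "(\<lambda>n. p n * real (\<kappa> n)) \<longlonglongrightarrow> c"
    using tendsto_add[OF k(1) g[of j]] by (simp add: \<kappa>_def c_def distrib_left)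
  have N1: "eventually (\<lambda>n. 0 < N n) sequentially"
  proof -
    have "eventually (\<lambda>n. 0 < real (N n) / real n) sequentially" by (rule order_tendstoD(1)[OF N]) simp
    then show ?thesis by eventually_elim (auto intro: gr0I)
  qed
  have \<kappa>1: "eventually (\<lambda>n. 0 < \<kappa> n) sequentially"
  proof -
    have "eventually (\<lambda>n. 0 < p n * real (\<kappa> n)) sequentially" by (rule order_tendstoD(1)[OF lim c])
    then show ?thesis by eventually_elim (auto intro: gr0I)
  qed
  have ev: "eventually (\<lambda>n. 0 < p n \<and> p n < 1 \<and> 0 < n \<and> 0 < N n \<and> 0 < \<kappa> n) sequentially"
    using p_range eventually_gt_at_top[of 0] N1 \<kappa>1 by eventually_elim simp
  have np: "(\<lambda>n. inverse (real n * p n)) \<longlonglongrightarrow> 0" by (rule tendsto_inverse_0_at_top[OF p_large])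
  interpret regime N \<kappa>
  proof
    have "filterlim (\<lambda>n. inverse (p n)) at_top sequentially"
      by (rule filterlim_inverse_at_top[OF p_null]) (use p_range in eventually_elim, simp)
    from filterlim_tendsto_pos_mult_at_top[OF lim c this]
    have "filterlim (\<lambda>n. real (\<kappa> n)) at_top sequentially"
      by (rule filterlim_cong[THEN iffD1, OF refl refl, rotated]) (use ev in eventually_elim, simp)
    then show "filterlim \<kappa> at_top sequentially" by (simp add: filterlim_sequentially_iff_filterlim_real)
    have "(\<lambda>n. (p n * real (\<kappa> n)) * inverse (real n * p n) / (real (N n) / real n)) \<longlonglongrightarrow> c * 0 / 1"
      by (intro tendsto_divide tendsto_mult lim np N) simp
    then have "(\<lambda>n. (p n * real (\<kappa> n)) * inverse (real n * p n) / (real (N n) / real n)) \<longlonglongrightarrow> 0" by simp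
    then show "(\<lambda>n. real (\<kappa> n) / real (N n)) \<longlonglongrightarrow> 0"
      by (rule Lim_transform_eventually) (use ev in eventually_elim, simp add: field_simps)
    have "(\<lambda>n. (real (N n) / real n) * (sqrt (real n) * p n)\<^sup>2 / (p n * real (\<kappa> n))\<^sup>2) \<longlonglongrightarrow> 1 * 0\<^sup>2 / c\<^sup>2"
      using c by (intro tendsto_intros N p_small lim) simp
    then have "(\<lambda>n. (real (N n) / real n) * (sqrt (real n) * p n)\<^sup>2 / (p n * real (\<kappa> n))\<^sup>2) \<longlonglongrightarrow> 0" by simp
    then show "(\<lambda>n. real (N n) / (real (\<kappa> n))\<^sup>2) \<longlonglongrightarrow> 0"
      by (rule Lim_transform_eventually) (use ev in eventually_elim, simp add: field_simps power2_eq_square)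
    show "eventually (\<lambda>n. 0 < N n) sequentially" by (rule N1)
  qed
  have "(\<lambda>n. (real (N n) / real n)\<^sup>2 / (p n * real (\<kappa> n))\<^sup>2) \<longlonglongrightarrow> 1\<^sup>2 / c\<^sup>2"
    using c by (intro tendsto_intros N lim) simp
  moreover have "eventually (\<lambda>n. (real (N n) / real n)\<^sup>2 / (p n * real (\<kappa> n))\<^sup>2 = scale n / (real n * p n)\<^sup>2) sequentially"
    using ev by eventually_elim (simp add: scale_def field_simps power2_eq_square)
  ultimately have sc: "(\<lambda>n. scale n / (real n * p n)\<^sup>2) \<longlonglongrightarrow> 1 / c\<^sup>2" by (simp add: Lim_transform_eventually)
  have "(\<lambda>n. (real (s n) / scale n) * (scale n / (real n * p n)\<^sup>2)) \<longlonglongrightarrow> y j * (1 / c\<^sup>2)"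
    unfolding s_def using burn_quantile_tendsto[OF y[of j]] sc unfolding \<kappa>_def by (intro tendsto_mult)
  then have "(\<lambda>n. (real (s n) / scale n) * (scale n / (real n * p n)\<^sup>2)) \<longlonglongrightarrow> y j / c\<^sup>2" by simp
  then show lim_s: "(\<lambda>n. real (s n) / (real n * p n)\<^sup>2) \<longlonglongrightarrow> y j / (x + e j)\<^sup>2"
    unfolding c_def
    by (rule Lim_transform_eventually) (use eventually_regular in eventually_elim, auto dest: scale_pos)
  have f1: "eventually (\<lambda>n. 1 \<le> f n) sequentially" using f by (simp add: filterlim_at_top)
  show "eventually (\<lambda>n. coupled (f n) j (N n) (k n) (g n) (\<lambda>i. sq_cdf (y i)) =
      s n # coupled (f n - 1) (Suc j) (N n - s n) (k n + g n j - 1) (g n) (\<lambda>i. sq_cdf (y i))) sequentially"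
    using f1 eventually_regular
  proof eventually_elim
    case (elim n)
    then obtain f' where "f n = Suc f'" by (cases "f n") auto
    then show ?case using elim(2) by (simp add: regular_def \<kappa>_def s_def)
  qed
  have "(\<lambda>n. real (N n) / real n - (real (s n) / (real n * p n)\<^sup>2) * (sqrt (real n) * p n)\<^sup>2) \<longlonglongrightarrow> 1 - (y j / (x + e j)\<^sup>2) * 0\<^sup>2"
    by (intro tendsto_intros N lim_s p_small)
  then have "(\<lambda>n. real (N n) / real n - (real (s n) / (real n * p n)\<^sup>2) * (sqrt (real n) * p n)\<^sup>2) \<longlonglongrightarrow> 1" by simp
  moreover have "eventually (\<lambda>n. real (N n) / real n - (real (s n) / (real n * p n)\<^sup>2) * (sqrt (real n) * p n)\<^sup>2 = real (N n - s n) / real n) sequentially"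
    using ev eventually_regular
  proof eventually_elim
    case (elim n)
    have "s n \<le> N n" unfolding s_def
      using burn_quantile_le[of "\<kappa> n" "N n" "sq_cdf (y j)"] elim(2) sq_cdf_range by (simp add: regular_def \<kappa>_def)
    then have "real (N n - s n) = real (N n) - real (s n)" by (rule of_nat_diff)
    moreover have "(real (s n) / (real n * p n)\<^sup>2) * (sqrt (real n) * p n)\<^sup>2 = real (s n) / real n"
      using elim(1) by (simp add: power_mult_distrib power2_eq_square)
    ultimately show ?case by (simp add: diff_divide_distrib)
  qed
  ultimately show "(\<lambda>n. real (N n - s n) / real n) \<longlonglongrightarrow> 1" by (rule Lim_transform_eventually)
  have "(\<lambda>n. p n * real (\<kappa> n) - p n) \<longlonglongrightarrow> c - 0" by (intro tendsto_diff lim p_null)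
  then have "(\<lambda>n. p n * real (\<kappa> n) - p n) \<longlonglongrightarrow> x + e j" by (simp add: c_def)
  then show "(\<lambda>n. p n * real (k n + g n j - 1)) \<longlonglongrightarrow> x + e j"
  proof (rule Lim_transform_eventually)
    show "eventually (\<lambda>n. p n * real (\<kappa> n) - p n = p n * real (k n + g n j - 1)) sequentially"
      using \<kappa>1
    proof eventually_elim
      case (elim n)
      then have "real (\<kappa> n - 1) = real (\<kappa> n) - 1" by (simp add: of_nat_diff)
      then show ?case by (simp add: \<kappa>_def algebra_simps)
    qed
  qed
qed

text \<open>Induction on the coordinate peels off the first fire, which is why \<open>N\<close>,
  \<open>k\<close>, the fuel, the limit \<open>x\<close> and the number \<open>j\<close> of past
  fires are all arbitrary.\<close>

lemma coupled_tendsto: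
  fixes e y :: "nat \<Rightarrow> real" and g :: "nat \<Rightarrow> nat \<Rightarrow> nat"
  assumes e: "\<And>i. 0 < e i" and y: "\<And>i. 0 \<le> y i" and g: "\<And>i. (\<lambda>n. p n * real (g n i)) \<longlonglongrightarrow> e i"
  assumes "(\<lambda>n. real (N n) / real n) \<longlonglongrightarrow> 1" "(\<lambda>n. p n * real (k n)) \<longlonglongrightarrow> x" "0 \<le> x" "filterlim f at_top sequentially"
  shows "(\<lambda>n. coord (coupled (f n) j (N n) (k n) (g n) (\<lambda>i. sq_cdf (y i))) i / (real n * p n)\<^sup>2)
    \<longlonglongrightarrow> y (j + i) / (x + (\<Sum>l=j..j + i. e l))\<^sup>2"
  using assms(4-)
proof (induction i arbitrary: N k f x j)
  case (0 N k f x j)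
  from coupled_step(1,2)[where e = e and y = y and g = g and j = j, OF e y g 0]
  have "(\<lambda>n. real (burn_quantile (N n) (k n + g n j) (sq_cdf (y j))) / (real n * p n)\<^sup>2) \<longlonglongrightarrow> y j / (x + e j)\<^sup>2"
    and ev: "eventually (\<lambda>n. coupled (f n) j (N n) (k n) (g n) (\<lambda>i. sq_cdf (y i)) =
      burn_quantile (N n) (k n + g n j) (sq_cdf (y j)) # coupled (f n - 1) (Suc j)
        (N n - burn_quantile (N n) (k n + g n j) (sq_cdf (y j))) (k n + g n j - 1) (g n) (\<lambda>i. sq_cdf (y i))) sequentially"
    by blast+
  from this(1) have "(\<lambda>n. coord (coupled (f n) j (N n) (k n) (g n) (\<lambda>i. sq_cdf (y i))) 0 / (real n * p n)\<^sup>2) \<longlonglongrightarrow> y j / (x + e j)\<^sup>2"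
    by (rule Lim_transform_eventually) (use ev in eventually_elim, simp add: coord_Cons)
  then show ?case by simp
next
  case (Suc i N k f x j)
  let ?s = "\<lambda>n. burn_quantile (N n) (k n + g n j) (sq_cdf (y j))"
  from coupled_step(2-4)[where e = e and y = y and g = g and j = j, OF e y g Suc.prems]
  have ev: "eventually (\<lambda>n. coupled (f n) j (N n) (k n) (g n) (\<lambda>i. sq_cdf (y i)) =
      ?s n # coupled (f n - 1) (Suc j) (N n - ?s n) (k n + g n j - 1) (g n) (\<lambda>i. sq_cdf (y i))) sequentially"
    and nxt: "(\<lambda>n. real (N n - ?s n) / real n) \<longlonglongrightarrow> 1" "(\<lambda>n. p n * real (k n + g n j - 1)) \<longlonglongrightarrow> x + e j"
    by blast+
  have f: "filterlim (\<lambda>n. f n - 1) at_top sequentially"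
    by (rule filterlim_compose[OF filterlim_minus_const_nat_at_top Suc.prems(4)])
  have "0 \<le> x + e j" using Suc.prems(3) e[of j] by simp
  from Suc.IH[OF nxt(1,2) this f]
  have "(\<lambda>n. coord (coupled (f n) j (N n) (k n) (g n) (\<lambda>i. sq_cdf (y i))) (Suc i) / (real n * p n)\<^sup>2)
      \<longlonglongrightarrow> y (Suc j + i) / (x + e j + (\<Sum>l=Suc j..Suc j + i. e l))\<^sup>2"
    by (rule Lim_transform_eventually) (use ev in eventually_elim, simp add: coord_Cons)
  moreover have "(\<Sum>l=j..j + Suc i. e l) = e j + (\<Sum>l=Suc j..Suc j + i. e l)"
    by (simp add: sum.atLeast_Suc_atMost)
  ultimately show ?case by (simp add: add.assoc)
qed

end

text \<open>The bound holds for each single run and every coordinate, without a limit. The witness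
  \<open>\<kappa>\<close> is the number of trees at the fire: all gaps so far have added to it and
  each of the \<open>i\<close> fires before has removed one tree. The number of vertices only
  decreases.\<close>

lemma coupled_bound:
  assumes "\<And>i. u i < 1" "i < length (coupled f j N k g u)"
  shows "\<exists>\<kappa>>0. real k + (\<Sum>l=j..j + i. real (g l)) - real i \<le> real \<kappa> \<and>
    real (coupled f j N k g u ! i) \<le> 2 * (real N)\<^sup>2 / ((real \<kappa>)\<^sup>2 * (1 - u (j + i)))"
  using assms(2)
proof (induction i arbitrary: f j N k)
  case 0
  then obtain f' where f: "f = Suc f'" by (cases f) auto
  with 0 have k: "0 < k + g j" "k + g j < N" by (auto split: if_splits)
  then show ?case using burn_quantile_mean[OF k assms(1)] f by (intro exI[of _ "k + g j"]) auto
next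
  case (Suc i)
  then obtain f' where f: "f = Suc f'" by (cases f) auto
  define s where "s = burn_quantile N (k + g j) (u j)"
  from f Suc.prems have k: "0 < k + g j" "k + g j < N" by (auto split: if_splits)
  then have eq: "coupled f j N k g u = s # coupled f' (Suc j) (N - s) (k + g j - 1) g u"
    by (simp add: f s_def)
  with Suc.prems have "i < length (coupled f' (Suc j) (N - s) (k + g j - 1) g u)" by simp
  from Suc.IH[OF this] obtain \<kappa> where \<kappa>: "0 < \<kappa>"
    "real (k + g j - 1) + (\<Sum>l=Suc j..Suc j + i. real (g l)) - real i \<le> real \<kappa>"
    "real (coupled f' (Suc j) (N - s) (k + g j - 1) g u ! i) \<le> 2 * (real (N - s))\<^sup>2 / ((real \<kappa>)\<^sup>2 * (1 - u (Suc j + i)))"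
    by blast
  have "2 * (real (N - s))\<^sup>2 / ((real \<kappa>)\<^sup>2 * (1 - u (Suc j + i))) \<le> 2 * (real N)\<^sup>2 / ((real \<kappa>)\<^sup>2 * (1 - u (Suc j + i)))"
    using assms(1)[of "Suc j + i"] by (intro divide_right_mono mult_left_mono power_mono) auto
  moreover have "(\<Sum>l=j..j + Suc i. real (g l)) = real (g j) + (\<Sum>l=Suc j..Suc j + i. real (g l))"
    by (simp add: sum.atLeast_Suc_atMost)
  moreover have "real (k + g j - 1) = real k + real (g j) - 1"
    using k(1) by (cases "k + g j") simp_all
  ultimately show ?case using \<kappa> unfolding eq by (intro exI[of _ \<kappa>]) auto
qed

text \<open>The domination passes to the limit \<open>y\<close>, so differences are dominated by
  \<open>2 * D\<close> and Tannery's theorem applies to the norm.\<close>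

lemma ell1_tendsto:
  assumes lim: "\<And>i. (\<lambda>n. c n * coord (xs n) i) \<longlonglongrightarrow> y i"
    and D: "summable D" and bound: "eventually (\<lambda>n. \<forall>i. \<bar>c n * coord (xs n) i\<bar> \<le> D i) sequentially"
  shows "summable (\<lambda>i. \<bar>y i\<bar>)"
    and "(\<lambda>n. c n *\<^sub>R ell1_of_list (map real (xs n))) \<longlonglongrightarrow> to_ell1 y"
proof -
  have yD: "\<bar>y i\<bar> \<le> D i" for i
  proof (rule tendsto_upperbound[OF tendsto_rabs[OF lim]])
    show "eventually (\<lambda>n. \<bar>c n * coord (xs n) i\<bar> \<le> D i) sequentially" using bound by eventually_elim blast
  qed simp
  show sum: "summable (\<lambda>i. \<bar>y i\<bar>)"
    by (rule summable_comparison_test'[OF D]) (simp add: yD)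
  have nth: "ell1_nth (c n *\<^sub>R ell1_of_list (map real (xs n)) - to_ell1 y) i = c n * coord (xs n) i - y i" for n i
    using sum by (simp add: minus_ell1.rep_eq scaleR_ell1.rep_eq ell1_nth_of_list coord_def to_ell1_def Abs_ell1_inverse)
  have "(\<lambda>n. \<Sum>i. \<bar>c n * coord (xs n) i - y i\<bar>) \<longlonglongrightarrow> (\<Sum>i. 0)"
  proof (rule tannerys_theorem[THEN conjunct2, THEN conjunct2])
    show "(\<lambda>n. \<bar>c n * coord (xs n) i - y i\<bar>) \<longlonglongrightarrow> 0" for i
      using lim[of i] by (simp add: LIM_zero tendsto_rabs_zero)
    show "eventually (\<lambda>(i, n). norm \<bar>c n * coord (xs n) i - y i\<bar> \<le> 2 * D i) (at_top \<times>\<^sub>F sequentially)"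
      unfolding eventually_prod_filter
    proof (intro exI conjI allI impI)
      show "eventually (\<lambda>_ :: nat. True) at_top" by simp
      show "eventually (\<lambda>n. \<forall>i. \<bar>c n * coord (xs n) i\<bar> \<le> D i) sequentially" by (rule bound)
      fix i n assume "\<forall>i. \<bar>c n * coord (xs n) i\<bar> \<le> D i"
      then have "\<bar>c n * coord (xs n) i\<bar> \<le> D i" by blast
      then show "case (i, n) of (i, n) \<Rightarrow> norm \<bar>c n * coord (xs n) i - y i\<bar> \<le> 2 * D i"
        using yD[of i] by simp
    qed
    show "summable (\<lambda>i. 2 * D i)" using D by (rule summable_mult)
  qed simp
  moreover have "norm (c n *\<^sub>R ell1_of_list (map real (xs n)) - to_ell1 y) = (\<Sum>i. \<bar>c n * coord (xs n) i - y i\<bar>)" for n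
    unfolding norm_ell1.rep_eq nth ..
  ultimately have "(\<lambda>n. norm (c n *\<^sub>R ell1_of_list (map real (xs n)) - to_ell1 y)) \<longlonglongrightarrow> 0" by simp
  then show "(\<lambda>n. c n *\<^sub>R ell1_of_list (map real (xs n))) \<longlonglongrightarrow> to_ell1 y"
    by (rule LIM_zero_cancel[OF tendsto_norm_zero_cancel])
qed

section \<open>Almost sure convergence\<close>

text \<open>The sum has finite expectation, hence is almost surely finite.\<close>

lemma AE_summable:
  fixes f :: "nat \<Rightarrow> 'a \<Rightarrow> real"
  assumes [measurable]: "\<And>i. f i \<in> borel_measurable M" and nonneg: "\<And>i x. 0 \<le> f i x"
    and le: "\<And>i. (\<integral>\<^sup>+x. f i x \<partial>M) \<le> ennreal (c i)" and c: "summable c" "\<And>i. 0 \<le> c i"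
  shows "AE x in M. summable (\<lambda>i. f i x)"
proof -
  have "(\<integral>\<^sup>+x. (\<Sum>i. ennreal (f i x)) \<partial>M) = (\<Sum>i. \<integral>\<^sup>+x. f i x \<partial>M)"
    by (rule nn_integral_suminf) simp
  also have "\<dots> \<le> (\<Sum>i. ennreal (c i))" by (intro suminf_le le) auto
  also have "\<dots> = ennreal (\<Sum>i. c i)" using c by (intro suminf_ennreal2) auto
  finally have "(\<integral>\<^sup>+x. (\<Sum>i. ennreal (f i x)) \<partial>M) \<le> ennreal (\<Sum>i. c i)" .
  from neq_top_trans[OF ennreal_neq_top this]
  have "AE x in M. (\<Sum>i. ennreal (f i x)) \<noteq> \<infinity>" by (intro nn_integral_noteq_infinite) auto
  then show ?thesis by eventually_elim (auto intro!: summable_suminf_not_top nonneg)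
qed

text \<open>Truncations depend continuously on the coordinates and converge in norm wherever the
  sequence is summable, an event described by bounds on partial sums. Elsewhere the value is the
  constant 0.\<close>

lemma to_ell1_measurable:
  fixes x :: "nat \<Rightarrow> 'a \<Rightarrow> real"
  assumes [measurable]: "\<And>i. x i \<in> borel_measurable M"
  shows "(\<lambda>\<omega>. to_ell1 (\<lambda>i. x i \<omega>)) \<in> M \<rightarrow>\<^sub>M borel"
proof -
  define trunc :: "nat \<Rightarrow> (nat \<Rightarrow> real) \<Rightarrow> ell1" where
    "trunc m a = (\<Sum>i<m. a i *\<^sub>R to_ell1 (\<lambda>j. of_bool (j = i)))" for m a
  have unit: "ell1_nth (to_ell1 (\<lambda>j. of_bool (j = i))) l = of_bool (l = i)" for i l
  proof -
    have "summable (\<lambda>j. \<bar>of_bool (j = i) :: real\<bar>)" by (rule summable_finite[of "{i}"]) auto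
    then show ?thesis by (simp add: to_ell1_def Abs_ell1_inverse)
  qed
  have nth_trunc: "ell1_nth (trunc m a) l = (if l < m then a l else 0)" for m a l
  proof (induction m)
    case (Suc m)
    then show ?case
      by (auto simp: trunc_def plus_ell1.rep_eq scaleR_ell1.rep_eq unit less_Suc_eq)
  qed (simp add: trunc_def zero_ell1.rep_eq)
  have trunc_lim: "(\<lambda>m. trunc m a) \<longlonglongrightarrow> to_ell1 a" if a: "summable (\<lambda>i. \<bar>a i\<bar>)" for a
  proof -
    have "norm (trunc m a - to_ell1 a) = (\<Sum>i. \<bar>a (i + m)\<bar>)" for m
    proof -
      let ?d = "\<lambda>i. \<bar>ell1_nth (trunc m a - to_ell1 a) i\<bar>"
      have d: "?d i = (if i < m then 0 else \<bar>a i\<bar>)" for i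
        using a by (simp add: minus_ell1.rep_eq nth_trunc to_ell1_def Abs_ell1_inverse)
      have "summable ?d" unfolding d by (rule summable_comparison_test'[OF a]) simp
      then have "(\<Sum>i. ?d i) = (\<Sum>i. ?d (i + m)) + (\<Sum>i<m. ?d i)" by (rule suminf_split_initial_segment)
      then show ?thesis unfolding norm_ell1.rep_eq by (simp add: d)
    qed
    moreover have "(\<lambda>m. \<Sum>i. \<bar>a (i + m)\<bar>) \<longlonglongrightarrow> 0" by (rule suminf_exist_split2[OF a])
    ultimately have "(\<lambda>m. norm (trunc m a - to_ell1 a)) \<longlonglongrightarrow> 0" by simp
    then show ?thesis by (rule LIM_zero_cancel[OF tendsto_norm_zero_cancel])
  qed
  have S: "{\<omega>\<in>space M. summable (\<lambda>i. \<bar>x i \<omega>\<bar>)} \<in> sets M"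
  proof -
    have "summable (\<lambda>i. \<bar>a i\<bar>) \<longleftrightarrow> (\<exists>K :: nat. \<forall>m. (\<Sum>i<m. \<bar>a i\<bar>) \<le> real K)" for a :: "nat \<Rightarrow> real"
    proof
      assume s: "summable (\<lambda>i. \<bar>a i\<bar>)"
      obtain K :: nat where "(\<Sum>i. \<bar>a i\<bar>) \<le> real K" using real_arch_simple by blast
      then have "(\<Sum>i<m. \<bar>a i\<bar>) \<le> real K" for m
        using sum_le_suminf[OF s, of "{..<m}"] by simp
      then show "\<exists>K :: nat. \<forall>m. (\<Sum>i<m. \<bar>a i\<bar>) \<le> real K" by blast
    next
      assume "\<exists>K :: nat. \<forall>m. (\<Sum>i<m. \<bar>a i\<bar>) \<le> real K"
      then obtain K :: nat where K: "(\<Sum>i<m. \<bar>a i\<bar>) \<le> real K" for m by blast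
      have "(\<Sum>i\<le>m. \<bar>a i\<bar>) \<le> real K" for m using K[of "Suc m"] by (simp only: lessThan_Suc_atMost)
      then show "summable (\<lambda>i. \<bar>a i\<bar>)" by (intro bounded_imp_summable) auto
    qed
    then show ?thesis by simp
  qed
  have seq: "(\<lambda>\<omega> i. x i \<omega>) \<in> M \<rightarrow>\<^sub>M (borel :: (nat \<Rightarrow> real) measure)"
    by (rule measurable_coordinatewise_then_product) simp
  show ?thesis
  proof (rule borel_measurable_LIMSEQ_metric)
    fix m
    have "continuous_on UNIV (trunc m)"
      unfolding trunc_def by (intro continuous_intros continuous_on_product_coordinates)
    then have "(\<lambda>\<omega>. trunc m (\<lambda>i. x i \<omega>)) \<in> M \<rightarrow>\<^sub>M borel"
      using seq by (intro measurable_compose[OF seq] borel_measurable_continuous_onI)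
    then show "(\<lambda>\<omega>. if \<omega> \<in> {\<omega>\<in>space M. summable (\<lambda>i. \<bar>x i \<omega>\<bar>)} then trunc m (\<lambda>i. x i \<omega>) else 0) \<in> M \<rightarrow>\<^sub>M borel"
      using S by (intro measurable_If_set) auto
  next
    fix \<omega> assume "\<omega> \<in> space M"
    then show "(\<lambda>m. if \<omega> \<in> {\<omega>\<in>space M. summable (\<lambda>i. \<bar>x i \<omega>\<bar>)} then trunc m (\<lambda>i. x i \<omega>) else 0)
        \<longlonglongrightarrow> to_ell1 (\<lambda>i. x i \<omega>)"
      using trunc_lim[of "\<lambda>i. x i \<omega>"] by (cases "summable (\<lambda>i. \<bar>x i \<omega>\<bar>)") (auto simp: to_ell1_def)
  qed
qed

text \<open>
  Maps an exponential variable with parameter 1 to a geometric one: the rounding is chosen such that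
  \<open>a \<le> gap q x\<close> amounts to a strict lower bound on \<open>x\<close>.
\<close>

definition gap :: "real \<Rightarrow> real \<Rightarrow> nat" where
  "gap q x = nat (\<lceil>x / - ln (1 - q)\<rceil> - 1)"

section \<open>Geometric times from exponential variables\<close>

lemma gap_measurable [measurable]: "gap q \<in> borel \<rightarrow>\<^sub>M count_space UNIV"
  unfolding gap_def by measurable

lemma gap_bounds:
  assumes "0 < q" "q < 1" "0 < x"
  shows "x / - ln (1 - q) - 1 \<le> real (gap q x)" "real (gap q x) \<le> x / - ln (1 - q)"
proof -
  have "0 < x / - ln (1 - q)" using assms by (intro divide_pos_pos) auto
  then show "x / - ln (1 - q) - 1 \<le> real (gap q x)" "real (gap q x) \<le> x / - ln (1 - q)"
    unfolding gap_def by linarith+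
qed

lemma le_gap_iff:
  assumes "0 < q" "q < 1"
  shows "a \<le> gap q x \<longleftrightarrow> a = 0 \<or> real a * - ln (1 - q) < x"
proof -
  have l: "0 < - ln (1 - q)" using assms by simp
  have "a \<le> gap q x \<longleftrightarrow> a = 0 \<or> real a < x / - ln (1 - q)"
    unfolding gap_def by linarith
  also have "real a < x / - ln (1 - q) \<longleftrightarrow> real a * - ln (1 - q) < x" using l by (rule pos_less_divide_eq)
  finally show ?thesis .
qed

lemma (in fire_regime) gap_tendsto:
  assumes "0 < x"
  shows "(\<lambda>n. p n * real (gap (p n) x)) \<longlonglongrightarrow> x"
proof (rule tendsto_sandwich)
  show "eventually (\<lambda>n. x * (p n / - ln (1 - p n)) - p n \<le> p n * real (gap (p n) x)) sequentially"
    using p_range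
  proof eventually_elim
    case (elim n)
    then have "p n * (x / - ln (1 - p n) - 1) \<le> p n * real (gap (p n) x)"
      using gap_bounds[of "p n" x] assms by (intro mult_left_mono) auto
    then show ?case by (simp add: right_diff_distrib mult_ac)
  qed
  show "eventually (\<lambda>n. p n * real (gap (p n) x) \<le> x * (p n / - ln (1 - p n))) sequentially"
    using p_range
  proof eventually_elim
    case (elim n)
    then have "p n * real (gap (p n) x) \<le> p n * (x / - ln (1 - p n))"
      using gap_bounds[of "p n" x] assms by (intro mult_left_mono) auto
    then show ?case by (simp add: mult_ac)
  qed
  show "(\<lambda>n. x * (p n / - ln (1 - p n)) - p n) \<longlonglongrightarrow> x"
    using tendsto_diff[OF tendsto_mult[OF tendsto_const p_rate] p_null, of x] by simp
  show "(\<lambda>n. x * (p n / - ln (1 - p n))) \<longlonglongrightarrow> x"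
    using tendsto_mult[OF tendsto_const p_rate, of x] by simp
qed

lemma mono_sq_cdf: "mono sq_cdf"
  unfolding sq_cdf_def using prob_space.finite_measure[OF prob_space_std_normal]
  by (intro monoI finite_measure.finite_measure_mono) auto

lemma sq_cdf_measurable [measurable]: "sq_cdf \<in> borel_measurable borel"
  by (rule borel_measurable_mono[OF mono_sq_cdf])

section \<open>Realization on the given probability space\<close>

locale exponential_normal = prob_space M for M :: "'w measure" +
  fixes e \<gamma> Z :: "nat \<Rightarrow> 'w \<Rightarrow> real"
  assumes e_dist: "\<And>i. distributed M lborel (e i) (exponential_density 1)"
    and e_indep: "indep_vars (\<lambda>_. borel) e UNIV"
    and \<gamma>: "\<And>i \<omega>. \<gamma> i \<omega> = (\<Sum>j\<le>i. e j \<omega>)"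
    and Z_dist: "\<And>i. distributed M lborel (Z i) std_normal_density"
    and Z_indep: "indep_vars (\<lambda>_. borel) Z UNIV"
    and \<gamma>_Z_indep: "indep_var (PiM UNIV (\<lambda>_. borel)) (\<lambda>\<omega> i. \<gamma> i \<omega>) (PiM UNIV (\<lambda>_. borel)) (\<lambda>\<omega> i. Z i \<omega>)"
begin

lemma e_measurable [measurable]: "e i \<in> borel_measurable M"
  using distributed_measurable[OF e_dist[of i]] by simp

lemma Z_measurable [measurable]: "Z i \<in> borel_measurable M"
  using distributed_measurable[OF Z_dist[of i]] by simp

lemma \<gamma>_measurable [measurable]: "\<gamma> i \<in> borel_measurable M"
  unfolding \<gamma>[abs_def] by measurable

definition U :: "nat \<Rightarrow> 'w \<Rightarrow> real" where
  "U i \<omega> = sq_cdf ((Z i \<omega>)\<^sup>2)"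

lemma U_measurable [measurable]: "U i \<in> borel_measurable M"
  unfolding U_def[abs_def] by measurable

text \<open>Independence is given between the sequences \<open>\<gamma>\<close> and
  \<open>Z\<close>, not between \<open>e\<close> and \<open>Z\<close>. But each \<open>e j\<close>
  is an increment of \<open>\<gamma>\<close>, so an event on finitely many \<open>e j\<close> is a
  measurable event \<open>S\<close> of the sequence \<open>\<gamma>\<close>.\<close>

lemma prob_e_Z:
  assumes A: "\<And>j. A j \<in> sets borel" and B: "\<And>j. B j \<in> sets borel"
  shows "prob {\<omega>\<in>space M. \<forall>j<i. e j \<omega> \<in> A j \<and> Z j \<omega> \<in> B j} =
    (\<Prod>j<i. prob {\<omega>\<in>space M. e j \<omega> \<in> A j} * prob {\<omega>\<in>space M. Z j \<omega> \<in> B j})"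
proof (cases "i = 0")
  case True
  then show ?thesis by (simp add: prob_space)
next
  case False
  define S :: "(nat \<Rightarrow> real) set" where
    "S = {x. \<forall>j<i. (if j = 0 then x 0 else x j - x (j - 1)) \<in> A j}"
  define T :: "(nat \<Rightarrow> real) set" where "T = {x. \<forall>j<i. x j \<in> B j}"
  let ?P = "PiM UNIV (\<lambda>_ :: nat. borel :: real measure)"
  have "S = (\<Inter>j\<in>{..<i}. (\<lambda>x. if j = 0 then x 0 else x j - x (j - 1)) -` A j \<inter> space ?P)"
    by (auto simp: S_def space_PiM)
  also have "\<dots> \<in> sets ?P"
  proof (rule sets.finite_INT)
    fix j
    have "(\<lambda>x. if j = 0 then x 0 else x j - x (j - 1)) \<in> borel_measurable ?P"
      by measurable
    from measurable_sets[OF this A[of j]]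
    show "(\<lambda>x. if j = 0 then x 0 else x j - x (j - 1)) -` A j \<inter> space ?P \<in> sets ?P" .
  qed (use False in auto)
  finally have S: "S \<in> sets ?P" .
  have "T = (\<Inter>j\<in>{..<i}. (\<lambda>x. x j) -` B j \<inter> space ?P)" by (auto simp: T_def space_PiM)
  also have "\<dots> \<in> sets ?P"
  proof (rule sets.finite_INT)
    fix j
    have "(\<lambda>x. x j) \<in> borel_measurable ?P" by measurable
    from measurable_sets[OF this B[of j]] show "(\<lambda>x. x j) -` B j \<inter> space ?P \<in> sets ?P" .
  qed (use False in auto)
  finally have T: "T \<in> sets ?P" .
  have inc: "(if j = 0 then \<gamma> 0 \<omega> else \<gamma> j \<omega> - \<gamma> (j - 1) \<omega>) = e j \<omega>" for j \<omega>
    by (cases j) (auto simp: \<gamma>)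
  have memS: "(\<lambda>i. \<gamma> i \<omega>) \<in> S \<longleftrightarrow> (\<forall>j<i. e j \<omega> \<in> A j)" for \<omega>
    by (simp only: S_def mem_Collect_eq inc)
  have "{\<omega>\<in>space M. \<forall>j<i. e j \<omega> \<in> A j \<and> Z j \<omega> \<in> B j} =
      (\<lambda>\<omega>. (\<lambda>i. \<gamma> i \<omega>, \<lambda>i. Z i \<omega>)) -` (S \<times> T) \<inter> space M"
    by (auto simp: memS T_def)
  then have "prob {\<omega>\<in>space M. \<forall>j<i. e j \<omega> \<in> A j \<and> Z j \<omega> \<in> B j} =
      prob ((\<lambda>\<omega> i. \<gamma> i \<omega>) -` S \<inter> space M) * prob ((\<lambda>\<omega> i. Z i \<omega>) -` T \<inter> space M)"
    using indep_varD[OF \<gamma>_Z_indep S T] by simp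
  also have "(\<lambda>\<omega> i. \<gamma> i \<omega>) -` S \<inter> space M = (\<Inter>j\<in>{..<i}. e j -` A j \<inter> space M)"
    using False by (auto simp: memS)
  also have "(\<lambda>\<omega> i. Z i \<omega>) -` T \<inter> space M = (\<Inter>j\<in>{..<i}. Z j -` B j \<inter> space M)"
    unfolding T_def using False by auto
  also have "prob (\<Inter>j\<in>{..<i}. e j -` A j \<inter> space M) = (\<Prod>j<i. prob (e j -` A j \<inter> space M))"
    by (rule indep_varsD[OF e_indep]) (use A False in auto)
  also have "prob (\<Inter>j\<in>{..<i}. Z j -` B j \<inter> space M) = (\<Prod>j<i. prob (Z j -` B j \<inter> space M))"
    by (rule indep_varsD[OF Z_indep]) (use B False in auto)
  finally show ?thesis
    by (simp add: prod.distrib vimage_def Int_def conj_commute)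
qed

text \<open>The probability integral transform. The level \<open>t = 1\<close> is treated apart
  because \<open>sq_cdf\<close> never attains it.\<close>

lemma U_law:
  assumes "0 \<le> t" "t \<le> 1"
  shows "prob {\<omega>\<in>space M. U i \<omega> \<le> t} = t"
proof (cases "t = 1")
  case True
  have "{\<omega>\<in>space M. U i \<omega> \<le> t} = space M" using sq_cdf_range True by (auto simp: U_def)
  then show ?thesis using True prob_space by simp
next
  case False
  then obtain y where y: "0 \<le> y" "sq_cdf y = t" using sq_cdf_surj[of t] assms by auto
  have "U i \<omega> \<le> t \<longleftrightarrow> (Z i \<omega>)\<^sup>2 \<le> y" for \<omega>
    using sq_cdf_strict_mono[OF y(1), of "(Z i \<omega>)\<^sup>2"] monoD[OF mono_sq_cdf, of "(Z i \<omega>)\<^sup>2" y] y(2)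
    unfolding U_def by (cases "(Z i \<omega>)\<^sup>2 \<le> y") auto
  then have "prob {\<omega>\<in>space M. U i \<omega> \<le> t} = measure (distr M lborel (Z i)) {z. z\<^sup>2 \<le> y}"
    by (subst measure_distr) (auto intro!: arg_cong[where f = prob])
  also have "\<dots> = sq_cdf y"
    unfolding distributed_distr_eq_density[OF Z_dist] sq_cdf_def ..
  finally show ?thesis using y by simp
qed

lemma U_range: "0 \<le> U i \<omega>" "U i \<omega> < 1"
  using sq_cdf_range sq_cdf_less_1 by (auto simp: U_def)

lemma coupling:
  assumes q: "0 < q" "q < 1"
  shows "coupling M (\<lambda>i \<omega>. gap q (e i \<omega>)) U q"
proof unfold_locales
  show "0 < q" "q < 1" by fact+
  show "(\<lambda>\<omega>. gap q (e i \<omega>)) \<in> M \<rightarrow>\<^sub>M count_space UNIV" for i by measurable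
  show "U i \<in> borel_measurable M" for i by measurable
  show "U i \<omega> < 1" for i \<omega> by (rule U_range)
  show "prob {\<omega>\<in>space M. U i \<omega> \<le> t} = t" if "0 \<le> t" "t \<le> 1" for i t using that by (rule U_law)
  show "prob {\<omega>\<in>space M. a \<le> gap q (e i \<omega>)} = (1 - q) ^ a" for i a
  proof (cases "a = 0")
    case False
    have "prob {\<omega>\<in>space M. a \<le> gap q (e i \<omega>)} = prob {\<omega>\<in>space M. real a * - ln (1 - q) < e i \<omega>}"
      using False by (simp add: le_gap_iff[OF q])
    also have "\<dots> = exp (- (real a * - ln (1 - q)) * 1)"
      by (rule exponential_distributedD_gt[OF e_dist]) (use q in \<open>auto simp: mult_le_0_iff\<close>)
    also have "\<dots> = (1 - q) ^ a" using q by (simp add: exp_of_nat_mult)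
    finally show ?thesis .
  qed (simp add: prob_space)
  fix A :: "nat \<Rightarrow> nat set" and B :: "nat \<Rightarrow> real set" and i
  assume B: "\<And>j. B j \<in> sets borel"
  have "gap q -` A j \<in> sets borel" for j using measurable_sets[OF gap_measurable, of "A j" q] by simp
  moreover have "(\<lambda>z. sq_cdf (z\<^sup>2)) -` B j \<in> sets borel" for j
  proof -
    have "(\<lambda>z. sq_cdf (z\<^sup>2)) \<in> borel_measurable borel" by measurable
    from measurable_sets[OF this B[of j]] show ?thesis by simp
  qed
  ultimately have "prob {\<omega>\<in>space M. \<forall>j<i. e j \<omega> \<in> gap q -` A j \<and> Z j \<omega> \<in> (\<lambda>z. sq_cdf (z\<^sup>2)) -` B j} =
    (\<Prod>j<i. prob {\<omega>\<in>space M. e j \<omega> \<in> gap q -` A j} * prob {\<omega>\<in>space M. Z j \<omega> \<in> (\<lambda>z. sq_cdf (z\<^sup>2)) -` B j})"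
    by (rule prob_e_Z)
  then show "prob {\<omega>\<in>space M. \<forall>j<i. gap q (e j \<omega>) \<in> A j \<and> U j \<omega> \<in> B j} =
      (\<Prod>j<i. prob {\<omega>\<in>space M. gap q (e j \<omega>) \<in> A j} * prob {\<omega>\<in>space M. U j \<omega> \<in> B j})"
    by (simp add: U_def)
qed

section \<open>Almost sure bounds on the sampling variables\<close>

lemma AE_e_pos: "AE \<omega> in M. \<forall>i. 0 < e i \<omega>"
  unfolding AE_all_countable
proof
  fix i
  have "prob {\<omega>\<in>space M. 0 < e i \<omega>} = 1"
    using exponential_distributedD_gt[OF e_dist[of i], of 0] by simp
  then show "AE \<omega> in M. 0 < e i \<omega>" by (subst prob_Collect_eq_1[symmetric]) auto
qed

lemma expectation_exp_e: "(\<integral>\<^sup>+\<omega>. exp (- e i \<omega>) \<partial>M) = ennreal (1 / 2)"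
proof -
  have "(\<integral>\<^sup>+\<omega>. exp (- e i \<omega>) \<partial>M) = (\<integral>\<^sup>+x. exponential_density 1 x * exp (- x) \<partial>lborel)"
    by (subst distributed_nn_integral[OF e_dist[of i], symmetric])
      (auto intro!: nn_integral_cong simp: ennreal_mult' exponential_density_def)
  also have "\<dots> = (\<integral>\<^sup>+x. ennreal (1 / 2 * exponential_density 2 x) \<partial>lborel)"
    by (intro nn_integral_cong) (auto simp: exponential_density_def exp_add[symmetric])
  also have "\<dots> = (\<integral>\<^sup>+x. ennreal (1 / 2) * exponential_density 2 x \<partial>lborel)"
    by (intro nn_integral_cong ennreal_mult') simp
  also have "\<dots> = ennreal (1 / 2) * emeasure (density lborel (exponential_density 2)) UNIV"
    by (subst nn_integral_cmult) (auto simp: emeasure_density)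
  also have "emeasure (density lborel (exponential_density 2)) UNIV = 1"
    using prob_space.emeasure_space_1[OF prob_space_exponential_density[of 2]] by simp
  finally show ?thesis by simp
qed

lemma expectation_exp_\<gamma>: "(\<integral>\<^sup>+\<omega>. exp (- \<gamma> i \<omega>) \<partial>M) = ennreal ((1 / 2) ^ Suc i)"
proof -
  have "indep_vars (\<lambda>_. borel) (\<lambda>j \<omega>. ennreal (exp (- e j \<omega>))) {..i}"
    by (rule indep_vars_compose2[OF indep_vars_subset[OF e_indep]]) auto
  then have "(\<integral>\<^sup>+\<omega>. (\<Prod>j\<in>{..i}. ennreal (exp (- e j \<omega>))) \<partial>M) = (\<Prod>j\<in>{..i}. \<integral>\<^sup>+\<omega>. exp (- e j \<omega>) \<partial>M)"
    by (intro indep_vars_nn_integral) auto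
  also have "\<dots> = ennreal ((1 / 2) ^ Suc i)"
    unfolding expectation_exp_e by (subst prod_ennreal) (simp_all del: power_Suc)
  finally show ?thesis
    by (simp add: \<gamma> prod_ennreal exp_sum sum_negf[symmetric])
qed

text \<open>A Chernoff bound in place of the law of large numbers:
  \<open>exp ((i + 1) / 2 - \<gamma> i)\<close> has mean
  \<open>(sqrt (exp 1) / 2) ^ (i + 1)\<close>. Its base is below 1, so the terms are almost surely
  summable and \<open>\<gamma> i \<ge> (i + 1) / 2\<close> from some index on.\<close>

lemma AE_\<gamma>_linear: "AE \<omega> in M. \<exists>c>0. \<forall>i. c * (real i + 1) \<le> \<gamma> i \<omega>"
proof -
  have "AE \<omega> in M. summable (\<lambda>i. exp ((real i + 1) / 2) * exp (- \<gamma> i \<omega>))"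
  proof (rule AE_summable)
    show "(\<integral>\<^sup>+\<omega>. exp ((real i + 1) / 2) * exp (- \<gamma> i \<omega>) \<partial>M) \<le> ennreal ((exp (1 / 2) / 2) ^ Suc i)" for i
    proof -
      have "(\<integral>\<^sup>+\<omega>. exp ((real i + 1) / 2) * exp (- \<gamma> i \<omega>) \<partial>M) = ennreal (exp ((real i + 1) / 2)) * ennreal ((1 / 2) ^ Suc i)"
        unfolding expectation_exp_\<gamma>[symmetric] by (subst nn_integral_cmult[symmetric]) (auto simp: ennreal_mult')
      also have "\<dots> = ennreal (exp ((real i + 1) / 2) * (1 / 2) ^ Suc i)" by (rule ennreal_mult[symmetric]) auto
      finally have "(\<integral>\<^sup>+\<omega>. exp ((real i + 1) / 2) * exp (- \<gamma> i \<omega>) \<partial>M) = ennreal (exp ((real i + 1) / 2) * (1 / 2) ^ Suc i)" .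
      moreover have "exp ((real i + 1) / 2) = exp (1 / 2 :: real) ^ Suc i"
        by (simp add: exp_of_nat_mult[symmetric] algebra_simps add_divide_distrib del: power_Suc)
      then have "exp ((real i + 1) / 2) * (1 / 2) ^ Suc i = (exp (1 / 2) / 2 :: real) ^ Suc i"
        by (simp only: power_mult_distrib[symmetric]) simp
      ultimately show ?thesis by (simp only: order_refl)
    qed
    have "exp (1 / 2 :: real) < 2"
    proof (rule power2_less_imp_less)
      have "(exp (1 / 2 :: real))\<^sup>2 = exp 1" by (simp add: exp_double[symmetric])
      then show "(exp (1 / 2 :: real))\<^sup>2 < 2\<^sup>2" using exp_le by simp
    qed simp
    then show "summable (\<lambda>i. (exp (1 / 2) / 2 :: real) ^ Suc i)"
      by (subst summable_Suc_iff) (intro summable_geometric, simp)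
  qed auto
  with AE_e_pos show ?thesis
  proof eventually_elim
    case (elim \<omega>)
    from summable_LIMSEQ_zero[OF elim(2)]
    have "eventually (\<lambda>i. exp ((real i + 1) / 2) * exp (- \<gamma> i \<omega>) < 1) sequentially"
      by (rule order_tendstoD) simp
    then obtain m where m: "\<And>i. m \<le> i \<Longrightarrow> exp ((real i + 1) / 2) * exp (- \<gamma> i \<omega>) < 1"
      by (auto simp: eventually_sequentially)
    have large: "1 / 2 * (real i + 1) \<le> \<gamma> i \<omega>" if "m \<le> i" for i
    proof -
      have "exp ((real i + 1) / 2 - \<gamma> i \<omega>) < 1" using m[OF that] by (simp add: exp_add[symmetric])
      then show ?thesis by simp
    qed
    \<comment> \<open>For the finitely many indices below \<open>m\<close>, the second term makes
      \<open>c * (i + 1)\<close> at most \<open>e 0\<close>, which is at most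
      \<open>\<gamma> i\<close>.\<close>
    define c where "c = min (1 / 2) (e 0 \<omega> / (real m + 1))"
    have c: "0 < c" using elim(1) by (simp add: c_def)
    have "c * (real i + 1) \<le> \<gamma> i \<omega>" for i
    proof (cases "m \<le> i")
      case True
      have "c \<le> 1 / 2" unfolding c_def by (rule min.cobounded1)
      then have "c * (real i + 1) \<le> 1 / 2 * (real i + 1)" by (rule mult_right_mono) simp
      from this large[OF True] show ?thesis by (rule order_trans)
    next
      case False
      have "c * (real i + 1) \<le> e 0 \<omega> / (real m + 1) * (real m + 1)"
        using False elim(1) c by (intro mult_mono) (auto simp: c_def less_imp_le)
      also have "\<dots> = e 0 \<omega>" by simp
      also have "\<dots> \<le> \<gamma> i \<omega>" unfolding \<gamma> using elim(1) by (intro member_le_sum) (auto intro: less_imp_le)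
      finally show ?thesis .
    qed
    with c show ?case by blast
  qed
qed

lemma U_distributed: "distributed M lborel (U i) (\<lambda>x. ennreal (indicator {0..1} x))"
proof (rule distributedI_borel_atMost[where g = "\<lambda>a. max 0 (min a 1)"])
  fix a :: real
  have "(\<integral>\<^sup>+x. ennreal (indicator {0..1} x * indicator {..a} x) \<partial>lborel) = (\<integral>\<^sup>+x. indicator {0..min a 1} x \<partial>lborel)"
    by (intro nn_integral_cong) (auto simp: indicator_def)
  also have "\<dots> = ennreal (max 0 (min a 1))"
    by (cases "0 \<le> a") (auto simp: max_def)
  finally show "(\<integral>\<^sup>+x. ennreal (indicator {0..1} x * indicator {..a} x) \<partial>lborel) = ennreal (max 0 (min a 1))" .
  have "prob {\<omega>\<in>space M. U i \<omega> \<le> a} = max 0 (min a 1)"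
  proof -
    consider "a < 0" | "0 \<le> a" "a \<le> 1" | "1 < a" by linarith
    then show ?thesis
    proof cases
      case 1
      then have "\<not> U i \<omega> \<le> a" for \<omega> using U_range(1)[of i \<omega>] by linarith
      then show ?thesis using 1 by simp
    next
      case 3
      then have "{\<omega>\<in>space M. U i \<omega> \<le> a} = space M" using U_range(2)[of i] by (auto intro: less_imp_le less_trans)
      then show ?thesis using 3 prob_space by simp
    qed (use U_law[of a i] in simp)
  qed
  then show "emeasure M {\<omega>\<in>space M. U i \<omega> \<le> a} = ennreal (max 0 (min a 1))"
    by (simp add: emeasure_eq_measure)
qed auto

lemma expectation_U: "(\<integral>\<^sup>+\<omega>. (1 - U i \<omega>) powr (- 3/4) \<partial>M) = ennreal 4"
proof -
  let ?h = "\<lambda>x :: real. indicator {0..1} x * x powr (- 3/4)"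
  have "(\<integral>\<^sup>+\<omega>. (1 - U i \<omega>) powr (- 3/4) \<partial>M) = (\<integral>\<^sup>+x. ennreal (indicator {0..1} x) * ennreal ((1 - x) powr (- 3/4)) \<partial>lborel)"
    by (rule distributed_nn_integral[OF U_distributed, symmetric]) simp
  also have "\<dots> = (\<integral>\<^sup>+x. ennreal (indicator {0..1} x) * ennreal (x powr (- 3/4)) \<partial>lborel)"
    by (subst nn_integral_real_affine[where c = "-1" and t = 1])
      (auto intro!: nn_integral_cong simp: indicator_def)
  also have "\<dots> = (\<integral>\<^sup>+x. ennreal (?h x) \<partial>lborel)"
    by (intro nn_integral_cong) (auto simp: indicator_def)
  also have "\<dots> = ennreal 4"
  proof (rule nn_integral_has_integral_lborel)
    have "((\<lambda>x. x powr (- 3/4)) has_integral (1 powr (- 3/4 + 1) / (- 3/4 + 1))) {0..1 :: real}"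
      by (rule has_integral_powr_from_0) auto
    then have "((\<lambda>x. if x \<in> {0..1} then x powr (- 3/4) else 0) has_integral 4) (UNIV :: real set)"
      by (subst has_integral_restrict_UNIV) simp
    then show "(?h has_integral 4) UNIV"
      by (rule has_integral_cong[THEN iffD1, rotated]) (auto simp: indicator_def)
  qed auto
  finally show ?thesis .
qed

text \<open>As \<open>1 / (1 - U)\<close> is not integrable, expectations are taken of the terms
  raised to the power 3/4: then \<open>(1 - U) powr (- 3/4)\<close> has mean 4 and the exponent
  \<open>3/2\<close> of \<open>i + 1\<close> still gives a convergent series. Terms whose powers are
  summable are eventually below 1, where they are smaller than their powers.\<close>

lemma AE_summable_U: "AE \<omega> in M. summable (\<lambda>i. 1 / ((real i + 1)\<^sup>2 * (1 - U i \<omega>)))"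
proof -
  have "AE \<omega> in M. summable (\<lambda>i. (real i + 1) powr (- 3/2) * (1 - U i \<omega>) powr (- 3/4))"
  proof (rule AE_summable)
    show "(\<integral>\<^sup>+\<omega>. (real i + 1) powr (- 3/2) * (1 - U i \<omega>) powr (- 3/4) \<partial>M) \<le> ennreal ((real i + 1) powr (- 3/2) * 4)" for i
    proof -
      have "(\<integral>\<^sup>+\<omega>. (real i + 1) powr (- 3/2) * (1 - U i \<omega>) powr (- 3/4) \<partial>M) = ennreal ((real i + 1) powr (- 3/2)) * ennreal 4"
        unfolding expectation_U[of i, symmetric] by (subst nn_integral_cmult[symmetric]) (auto simp: ennreal_mult')
      then show ?thesis by (simp add: ennreal_mult')
    qed
    have "summable (\<lambda>i. real (Suc i) powr (- 3/2))"
      by (subst summable_Suc_iff) (simp add: summable_real_powr_iff)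
    then show "summable (\<lambda>i. (real i + 1) powr (- 3/2) * 4)" by (intro summable_mult2) (simp add: add.commute)
  qed auto
  then show ?thesis
  proof eventually_elim
    case (elim \<omega>)
    let ?a = "\<lambda>i. 1 / ((real i + 1)\<^sup>2 * (1 - U i \<omega>))"
    have a: "0 < ?a i" for i using U_range(2)[of i \<omega>] by (intro divide_pos_pos mult_pos_pos) auto
    have eq: "(real i + 1) powr (- 3/2) * (1 - U i \<omega>) powr (- 3/4) = ?a i powr (3/4)" for i
    proof -
      have *: "?a i = (real i + 1) powr (- 2) * (1 - U i \<omega>) powr (- 1)"
        using U_range(2)[of i \<omega>] by (simp add: powr_minus divide_simps)
      show ?thesis unfolding * by (subst powr_mult) (simp_all only: powr_powr powr_ge_zero, simp)
    qed
    have sum: "summable (\<lambda>i. ?a i powr (3/4))" using elim by (simp only: eq)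
    have "eventually (\<lambda>i. ?a i powr (3/4) < 1) sequentially"
      using summable_LIMSEQ_zero[OF sum] by (rule order_tendstoD) simp
    then have "eventually (\<lambda>i. norm (?a i) \<le> ?a i powr (3/4)) sequentially"
    proof eventually_elim
      case (elim i)
      then have "?a i < 1" using a[of i] powr_mono2[of "3/4" 1 "?a i"] by fastforce
      then have "?a i powr 1 \<le> ?a i powr (3/4)" using a[of i] by (intro powr_mono') auto
      then show ?case using a[of i] by simp
    qed
    from summable_comparison_test_ev[OF this sum] show ?case .
  qed
qed

section \<open>Almost sure convergence and the theorem\<close>

lemma AE_coupled_tendsto:
  assumes "fire_regime p"
  shows "AE \<omega> in M. summable (\<lambda>i. \<bar>\<gamma> i \<omega> powi (-2) * (Z i \<omega>)\<^sup>2\<bar>) \<and>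
    (\<lambda>n. (real n * p n) powi (-2) *\<^sub>R ell1_of_list (map real (coupled n 0 n 1 (\<lambda>i. gap (p n) (e i \<omega>)) (\<lambda>i. U i \<omega>))))
      \<longlonglongrightarrow> to_ell1 (\<lambda>i. \<gamma> i \<omega> powi (-2) * (Z i \<omega>)\<^sup>2)"
proof -
  interpret fire_regime p by fact
  have powi: "x powi (-2) = 1 / x\<^sup>2" for x :: real by (simp add: power_int_def field_simps)
  show ?thesis
    using AE_e_pos AE_\<gamma>_linear AE_summable_U
  proof eventually_elim
    case (elim \<omega>)
    then obtain c where c: "0 < c" "\<And>i. c * (real i + 1) \<le> \<gamma> i \<omega>" by blast
    let ?xs = "\<lambda>n. coupled n 0 n 1 (\<lambda>i. gap (p n) (e i \<omega>)) (\<lambda>i. U i \<omega>)"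
    \<comment> \<open>The constant is \<open>2 * 4^2\<close>: the factor 2 comes from the mean
      bound, and 4 from the lower bound \<open>c * (i + 1) / 4\<close> for
      \<open>\<kappa> * p n\<close> proved below.\<close>
    define D where "D i = 32 / c\<^sup>2 * (1 / ((real i + 1)\<^sup>2 * (1 - U i \<omega>)))" for i
    have D: "summable D" unfolding D_def by (rule summable_mult[OF elim(3)])
    have D0: "0 \<le> D i" for i
      using U_range(2)[of i \<omega>] by (auto simp: D_def)
    have lim: "(\<lambda>n. (real n * p n) powi (-2) * coord (?xs n) i) \<longlonglongrightarrow> \<gamma> i \<omega> powi (-2) * (Z i \<omega>)\<^sup>2" for i
    proof -
      have "(\<lambda>n. real n / real n) \<longlonglongrightarrow> 1"
        by (rule tendsto_eventually) (use eventually_gt_at_top[of 0] in eventually_elim, simp)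
      moreover have "(\<lambda>n. p n * real 1) \<longlonglongrightarrow> 0" using p_null by simp
      ultimately have "(\<lambda>n. coord (coupled n 0 n 1 (\<lambda>i. gap (p n) (e i \<omega>)) (\<lambda>i. sq_cdf ((Z i \<omega>)\<^sup>2))) i / (real n * p n)\<^sup>2)
          \<longlonglongrightarrow> (Z (0 + i) \<omega>)\<^sup>2 / (0 + (\<Sum>l=0..0 + i. e l \<omega>))\<^sup>2"
        using elim(1) gap_tendsto
        by (intro coupled_tendsto[where N = "\<lambda>n. n" and k = "\<lambda>_. 1" and f = "\<lambda>n. n" and y = "\<lambda>i. (Z i \<omega>)\<^sup>2" and e = "\<lambda>i. e i \<omega>"]) (auto simp: filterlim_ident)
      then show ?thesis by (simp add: powi U_def \<gamma> atLeast0AtMost)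
    qed
    \<comment> \<open>These two conditions do not involve the coordinate. The first gives
      \<open>l < 2 * p n\<close> for \<open>l = - ln (1 - p n)\<close>; with the second,
      \<open>4 * l \<le> c\<close>.\<close>
    have rate2: "eventually (\<lambda>n. 1 / 2 < p n / - ln (1 - p n)) sequentially"
      by (rule order_tendstoD(1)[OF p_rate]) simp
    have small: "eventually (\<lambda>n. p n < c / 8) sequentially"
      by (rule order_tendstoD(2)[OF p_null]) (use c in simp)
    have bound: "eventually (\<lambda>n. \<forall>i. \<bar>(real n * p n) powi (-2) * coord (?xs n) i\<bar> \<le> D i) sequentially"
      using rate2 small p_range eventually_gt_at_top[of 0]
    proof eventually_elim
      case (elim n)
      define l where "l = - ln (1 - p n)"
      have p: "0 < p n" "p n < 1" using elim by auto
      have l: "0 < l" unfolding l_def using p by simp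
      have l2: "l < 2 * p n" using elim(1) l by (simp add: l_def[symmetric] pos_less_divide_eq)
      show ?case
      proof
        fix i
        show "\<bar>(real n * p n) powi (-2) * coord (?xs n) i\<bar> \<le> D i"
        proof (cases "i < length (?xs n)")
          case False
          then show ?thesis using D0 by (simp add: coord_def)
        next
          case True
          obtain \<kappa> where \<kappa>: "0 < \<kappa>" "real 1 + (\<Sum>l=0..0 + i. real (gap (p n) (e l \<omega>))) - real i \<le> real \<kappa>"
            "real (?xs n ! i) \<le> 2 * (real n)\<^sup>2 / ((real \<kappa>)\<^sup>2 * (1 - U (0 + i) \<omega>))"
            using coupled_bound[OF U_range(2) True] by blast
          have "(\<Sum>j=0..i. e j \<omega> / l - 1) \<le> (\<Sum>j=0..i. real (gap (p n) (e j \<omega>)))"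
            unfolding l_def using gap_bounds(1)[OF p] \<open>\<forall>i. 0 < e i \<omega>\<close> by (intro sum_mono) blast
          moreover have "(\<Sum>j=0..i. e j \<omega> / l - 1) = \<gamma> i \<omega> / l - (real i + 1)"
            by (simp add: sum_subtractf sum_divide_distrib[symmetric] \<gamma> atLeast0AtMost)
          moreover have "c * (real i + 1) / l \<le> \<gamma> i \<omega> / l" using c(2) l by (intro divide_right_mono) auto
          \<comment> \<open>Rounding costs at most 1 for each of the \<open>i + 1\<close> gaps, and
            each earlier fire costs one tree; since \<open>4 * l \<le> c\<close>, these losses take
            at most half of the main term.\<close>
          ultimately have "c * (real i + 1) / l - 2 * (real i + 1) \<le> real \<kappa>" using \<kappa>(2) by simp
          moreover have "4 * (real i + 1) \<le> c * (real i + 1) / l"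
          proof -
            have "4 * l \<le> c" using l2 elim(2) by simp
            then have "4 * l * (real i + 1) \<le> c * (real i + 1)" by (rule mult_right_mono) simp
            moreover have "4 * l * (real i + 1) = 4 * (real i + 1) * l" by simp
            ultimately show ?thesis unfolding pos_le_divide_eq[OF l] by (simp only:)
          qed
          moreover have "c * (real i + 1) / (2 * p n) \<le> c * (real i + 1) / l"
            using l2 l p c by (intro divide_left_mono) auto
          ultimately have "c * (real i + 1) / (4 * p n) \<le> real \<kappa>" by (simp add: field_simps)
          then have kp: "c * (real i + 1) / 4 \<le> real \<kappa> * p n" using p by (simp add: pos_divide_le_eq mult_ac)
          have u: "0 < 1 - U i \<omega>" using U_range(2)[of i \<omega>] by simp
          have "\<bar>(real n * p n) powi (-2) * coord (?xs n) i\<bar> = real (?xs n ! i) / (real n * p n)\<^sup>2"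
            using True by (simp add: coord_def powi)
          also have "\<dots> \<le> 2 * (real n)\<^sup>2 / ((real \<kappa>)\<^sup>2 * (1 - U i \<omega>)) / (real n * p n)\<^sup>2"
            using \<kappa>(3) by (intro divide_right_mono) auto
          also have "\<dots> = 2 / ((real \<kappa> * p n)\<^sup>2 * (1 - U i \<omega>))"
            using elim(4) p \<kappa>(1) u by (simp add: power_mult_distrib)
          also have "\<dots> \<le> 2 / ((c * (real i + 1) / 4)\<^sup>2 * (1 - U i \<omega>))"
            using kp c u by (intro divide_left_mono mult_right_mono power_mono mult_pos_pos zero_less_power)
              (use \<kappa>(1) p in auto)
          also have "\<dots> = D i" by (simp add: D_def power_mult_distrib power_divide)
          finally show ?thesis .
        qed
      qed
    qed
    from ell1_tendsto[OF lim D bound] show ?case by blast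
  qed
qed

end

theorem theorem4:
  fixes p :: "nat \<Rightarrow> real"
    and M :: "'w measure"
    and e \<gamma> Z :: "nat \<Rightarrow> 'w \<Rightarrow> real"
  assumes "\<forall>n\<ge>1. 0 \<le> p n \<and> p n \<le> 1"
    and "(\<lambda>n. sqrt (real n) * p n) \<longlonglongrightarrow> 0"
    and "filterlim (\<lambda>n. real n * p n) at_top sequentially"
    and "prob_space M"
    and "\<forall>i. distributed M lborel (e i) (exponential_density 1)"
    and "prob_space.indep_vars M (\<lambda>_. borel) e UNIV"
    and "\<forall>i \<omega>. \<gamma> i \<omega> = (\<Sum>j\<le>i. e j \<omega>)"
    and "\<forall>i. distributed M lborel (Z i) std_normal_density"
    and "prob_space.indep_vars M (\<lambda>_. borel) Z UNIV"
    and "prob_space.indep_var M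
           (PiM UNIV (\<lambda>_. borel)) (\<lambda>\<omega> i. \<gamma> i \<omega>)
           (PiM UNIV (\<lambda>_. borel)) (\<lambda>\<omega> i. Z i \<omega>)"
  shows "(AE \<omega> in M. summable (\<lambda>i. \<bar>\<gamma> i \<omega> powi (-2) * (Z i \<omega>)\<^sup>2\<bar>))
    \<and> (\<lambda>\<omega>. to_ell1 (\<lambda>i. \<gamma> i \<omega> powi (-2) * (Z i \<omega>)\<^sup>2)) \<in> M \<rightarrow>\<^sub>M borel
    \<and> weak_convergence
        (\<lambda>n. distr (measure_pmf (burnt_subtree_sizes n (p n))) borel
               (\<lambda>b. (real n * p n) powi (-2) *\<^sub>R ell1_of_list (map real b)))
        (distr M borel (\<lambda>\<omega>. to_ell1 (\<lambda>i. \<gamma> i \<omega> powi (-2) * (Z i \<omega>)\<^sup>2)))"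
proof -
  interpret exponential_normal M e \<gamma> Z
    unfolding exponential_normal_def exponential_normal_axioms_def using assms by blast
  interpret fire_regime p
  proof
    show "(\<lambda>n. sqrt (real n) * p n) \<longlonglongrightarrow> 0" "filterlim (\<lambda>n. real n * p n) at_top sequentially"
      by (fact assms)+
    have "eventually (\<lambda>n. 0 < real n * p n) sequentially"
      using assms(3) by (auto simp: filterlim_at_top_dense)
    moreover have "eventually (\<lambda>n. sqrt (real n) * p n < 1) sequentially"
      by (rule order_tendstoD(2)[OF assms(2)]) simp
    ultimately show "eventually (\<lambda>n. 0 < p n \<and> p n < 1) sequentially"
      using eventually_ge_at_top[of 1]
    proof eventually_elim
      case (elim n)
      then have "0 < p n" by (simp add: zero_less_mult_iff)
      then have "1 * p n \<le> sqrt (real n) * p n" using elim(3) by (intro mult_right_mono) auto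
      with elim(2) \<open>0 < p n\<close> show ?case by linarith
    qed
  qed
  note AE = AE_coupled_tendsto[OF fire_regime_axioms]
  let ?X = "\<lambda>\<omega>. to_ell1 (\<lambda>i. \<gamma> i \<omega> powi (-2) * (Z i \<omega>)\<^sup>2)"
  have meas: "?X \<in> M \<rightarrow>\<^sub>M borel"
  proof (rule to_ell1_measurable)
    fix i
    have "x powi (-2) = 1 / x\<^sup>2" for x :: real by (simp add: power_int_def field_simps)
    then show "(\<lambda>\<omega>. \<gamma> i \<omega> powi (-2) * (Z i \<omega>)\<^sup>2) \<in> borel_measurable M" by simp
  qed
  define \<phi> where "\<phi> n b = (real n * p n) powi (-2) *\<^sub>R ell1_of_list (map real b)" for n and b :: "nat list"
  define coupled_list where "coupled_list n \<omega> = coupled n 0 n 1 (\<lambda>i. gap (p n) (e i \<omega>)) (\<lambda>i. U i \<omega>)" for n \<omega>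
  \<comment> \<open>Excludes \<open>p n = 0\<close> and \<open>p n = 1\<close>, where no coupling
    with geometric gaps is set up; all large \<open>n\<close> are good.\<close>
  define good where "good n \<longleftrightarrow> 1 \<le> n \<and> 0 < p n \<and> p n < 1" for n
  have good: "eventually good sequentially"
    unfolding good_def using p_range eventually_ge_at_top[of 1] by eventually_elim simp
  have coupled_list_meas: "coupled_list n \<in> M \<rightarrow>\<^sub>M count_space UNIV"
    and coupled_list_law: "distr M (count_space UNIV) (coupled_list n) = measure_pmf (burnt_subtree_sizes n (p n))" if "good n" for n
  proof -
    interpret C: coupling M "\<lambda>i \<omega>. gap (p n) (e i \<omega>)" U "p n"
      by (rule coupling) (use that in \<open>auto simp: good_def\<close>)
    show "coupled_list n \<in> M \<rightarrow>\<^sub>M count_space UNIV" unfolding coupled_list_def by (rule C.coupled_list_measurable)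
    show "distr M (count_space UNIV) (coupled_list n) = measure_pmf (burnt_subtree_sizes n (p n))"
      unfolding coupled_list_def by (rule C.distr_coupled_list) (use that in \<open>simp add: good_def\<close>)
  qed
  \<comment> \<open>Weak convergence involves only the law for each \<open>n\<close>, so the sizes
    are replaced by the coupled lists on \<open>M\<close>, where almost sure convergence and bounded
    convergence conclude.\<close>
  have "weak_convergence (\<lambda>n. distr (measure_pmf (burnt_subtree_sizes n (p n))) borel (\<phi> n)) (distr M borel ?X)"
    unfolding weak_convergence_def
  proof (intro allI impI, elim conjE)
    fix f :: "ell1 \<Rightarrow> real"
    assume f: "continuous_on UNIV f" "bounded (range f)"
    have fm: "f \<in> borel_measurable borel" by (rule borel_measurable_continuous_onI[OF f(1)])
    obtain K where K: "\<bar>f x\<bar> \<le> K" for x using f(2) by (auto simp: bounded_iff)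
    \<comment> \<open>The default 0 at indices that are not good keeps \<open>h n\<close> measurable
      and bounded for every \<open>n\<close>, as dominated convergence requires.\<close>
    define h where "h n \<omega> = (if good n then f (\<phi> n (coupled_list n \<omega>)) else 0)" for n \<omega>
    have fx: "(\<lambda>\<omega>. f (?X \<omega>)) \<in> borel_measurable M" by (rule measurable_compose[OF meas fm])
    have "(\<lambda>n. \<integral>\<omega>. h n \<omega> \<partial>M) \<longlonglongrightarrow> (\<integral>\<omega>. f (?X \<omega>) \<partial>M)"
    proof (rule integral_dominated_convergence)
      show "h n \<in> borel_measurable M" for n
      proof (cases "good n")
        case True
        have "(\<lambda>\<omega>. f (\<phi> n (coupled_list n \<omega>))) \<in> borel_measurable M"
          by (rule measurable_compose[OF coupled_list_meas[OF True]]) simp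
        then show ?thesis using True by (simp add: h_def[abs_def])
      qed (simp add: h_def[abs_def])
      show "AE \<omega> in M. (\<lambda>n. h n \<omega>) \<longlonglongrightarrow> f (?X \<omega>)"
        using AE
      proof eventually_elim
        case (elim \<omega>)
        then have "(\<lambda>n. \<phi> n (coupled_list n \<omega>)) \<longlonglongrightarrow> ?X \<omega>" by (simp add: \<phi>_def coupled_list_def)
        then have "(\<lambda>n. f (\<phi> n (coupled_list n \<omega>))) \<longlonglongrightarrow> f (?X \<omega>)"
          using f(1) by (auto intro: continuous_on_tendsto_compose)
        then show ?case
          by (rule Lim_transform_eventually) (use good in eventually_elim, simp add: h_def)
      qed
      show "AE \<omega> in M. norm (h n \<omega>) \<le> \<bar>K\<bar>" for n
        using K by (intro AE_I2) (auto simp: h_def intro: order_trans[OF _ abs_ge_self])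
    qed (use fx in simp_all)
    moreover have "eventually (\<lambda>n. (\<integral>\<omega>. h n \<omega> \<partial>M) =
        (\<integral>x. f x \<partial>distr (measure_pmf (burnt_subtree_sizes n (p n))) borel (\<phi> n))) sequentially"
      using good
    proof eventually_elim
      case (elim n)
      have "(\<integral>x. f x \<partial>distr (measure_pmf (burnt_subtree_sizes n (p n))) borel (\<phi> n)) =
          (\<integral>b. f (\<phi> n b) \<partial>distr M (count_space UNIV) (coupled_list n))"
        unfolding coupled_list_law[OF elim] by (rule integral_distr) (simp_all add: fm)
      also have "\<dots> = (\<integral>\<omega>. f (\<phi> n (coupled_list n \<omega>)) \<partial>M)" by (rule integral_distr[OF coupled_list_meas[OF elim]]) simp
      finally show ?case using elim by (simp add: h_def)
    qed
    ultimately have "(\<lambda>n. \<integral>x. f x \<partial>distr (measure_pmf (burnt_subtree_sizes n (p n))) borel (\<phi> n)) \<longlonglongrightarrow> (\<integral>\<omega>. f (?X \<omega>) \<partial>M)"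
      by (rule Lim_transform_eventually)
    then show "(\<lambda>n. \<integral>x. f x \<partial>distr (measure_pmf (burnt_subtree_sizes n (p n))) borel (\<phi> n)) \<longlonglongrightarrow> (\<integral>x. f x \<partial>distr M borel ?X)"
      by (simp add: integral_distr[OF meas fm])
  qed
  moreover have "AE \<omega> in M. summable (\<lambda>i. \<bar>\<gamma> i \<omega> powi (-2) * (Z i \<omega>)\<^sup>2\<bar>)"
    using AE by eventually_elim blast
  ultimately show ?thesis using meas unfolding \<phi>_def by blast
qed

end
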